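(* There is a constant $C$, independent of $h$ and $v_h$, such that for any $v_h \in V_h^0$, $$\|v_h\|_{L^{\infty}(\Omega)} \le C \|v_h\|_h ,$$ where $$\|v_h\|_h^2 := \|D^2 v_h\|_{L^2(\mathcal{T}_h)}^2 + \sum_{F\in\mathcal{F}_h^i} h_F^{-1}\,\big\|[\![\nabla v_h]\!]\big\|_{L^2(F)}^2 .$$
   Context: $\Omega\subset\mathbb{R}^d$, $d\in\{2,3\}$, is a bounded convex polygonal (polyhedral) domain. $\mathcal{T}_h$ is a quasi-uniform, shape-regular, conforming simplicial triangulation of $\Omega$, $h_K=\mathrm{diam}(K)$, $h=\max_{K\in\mathcal{T}_h}h_K$. $\mathcal{F}_h^i$ is the set of interior edges/faces, $h_F=\mathrm{diam}(F)$. For an interior face $F=\partial K^+\cap\partial K^-$ with unit outward normals $\boldsymbol n_\pm$ of $K^\pm$, the jump of a vector field $\boldsymbol w$ is $[\![\boldsymbol w]\!]|_F=\boldsymbol w^+\cdot\boldsymbol n_+|_F+\boldsymbol w^-\cdot\boldsymbol n_-|_F$. For a fixed polynomial degree $k$, $V_h=\{v\in H^1(\Omega): v|_K\in\mathbb{P}_k(K)\ \forall K\in\mathcal{T}_h\}$ is the Lagrange finite element space and $V_h^0=V_h\cap H_0^1(\Omega)$. $D^2v_h$ denotes the elementwise Hessian and $\|v\|_{L^2(\mathcal{T}_h)}^2=\sum_{K\in\mathcal{T}_h}\|v\|_{L^2(K)}^2$. Constants are independent of $h$ (the mesh enters only through its shape-regularity and quasi-uniformity constants). *)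

theory Defs
  imports "HOL-Analysis.Analysis" "HOL-Probability.Essential_Supremum"
begin

section \<open>Partial derivatives and test functions\<close>

definition partial_deriv :: "'a::euclidean_space \<Rightarrow> ('a \<Rightarrow> real) \<Rightarrow> 'a \<Rightarrow> real" where
  "partial_deriv i f x = frechet_derivative f (at x) i"

definition grad :: "('a::euclidean_space \<Rightarrow> real) \<Rightarrow> 'a \<Rightarrow> 'a" where
  "grad f x = (\<Sum>i\<in>Basis. partial_deriv i f x *\<^sub>R i)"

primrec C_k :: "nat \<Rightarrow> ('a::euclidean_space \<Rightarrow> real) \<Rightarrow> bool" where
  "C_k 0 f \<longleftrightarrow> continuous_on UNIV f"
| "C_k (Suc n) f \<longleftrightarrow>
     (\<forall>x. f differentiable (at x)) \<and> (\<forall>i\<in>Basis. C_k n (partial_deriv i f))"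

text \<open>Elements of \<open>C\<^sub>c\<^sup>\<infinity>(\<Omega>)\<close>, extended by zero to the whole space.\<close>

definition test_functions :: "'a::euclidean_space set \<Rightarrow> ('a \<Rightarrow> real) set" where
  "test_functions \<Omega> = {\<phi>. (\<forall>n. C_k n \<phi>) \<and>
     compact (closure {x. \<phi> x \<noteq> 0}) \<and> closure {x. \<phi> x \<noteq> 0} \<subseteq> \<Omega>}"

section \<open>Sobolev spaces\<close>

text \<open>Lebesgue and Sobolev functions are given by representatives \<open>'a \<Rightarrow> real\<close>; all notions below
  are invariant under changes on null sets, and values outside \<open>\<Omega>\<close> are irrelevant.\<close>

definition L2 :: "'a::euclidean_space set \<Rightarrow> ('a \<Rightarrow> real) set" where
  "L2 \<Omega> = {f. f \<in> borel_measurable (lebesgue_on \<Omega>) \<and>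
              integrable (lebesgue_on \<Omega>) (\<lambda>x. (f x)\<^sup>2)}"

definition weak_grad :: "'a::euclidean_space set \<Rightarrow> ('a \<Rightarrow> real) \<Rightarrow> ('a \<Rightarrow> 'a) \<Rightarrow> bool" where
  "weak_grad \<Omega> v G \<longleftrightarrow> (\<forall>i\<in>Basis. \<forall>\<phi>\<in>test_functions \<Omega>.
     integral\<^sup>L (lebesgue_on \<Omega>) (\<lambda>x. v x * partial_deriv i \<phi> x) =
     - integral\<^sup>L (lebesgue_on \<Omega>) (\<lambda>x. (G x \<bullet> i) * \<phi> x))"

definition H1 :: "'a::euclidean_space set \<Rightarrow> ('a \<Rightarrow> real) set" where
  "H1 \<Omega> = {v \<in> L2 \<Omega>. \<exists>G. (\<forall>i\<in>Basis. (\<lambda>x. G x \<bullet> i) \<in> L2 \<Omega>) \<and> weak_grad \<Omega> v G}"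

text \<open>The closure of the test functions in the \<open>H\<^sup>1(\<Omega>)\<close> norm.\<close>

definition H1_0 :: "'a::euclidean_space set \<Rightarrow> ('a \<Rightarrow> real) set" where
  "H1_0 \<Omega> = {v \<in> L2 \<Omega>. \<exists>G. (\<forall>i\<in>Basis. (\<lambda>x. G x \<bullet> i) \<in> L2 \<Omega>) \<and> weak_grad \<Omega> v G \<and>
     (\<forall>\<epsilon>>0. \<exists>\<phi>\<in>test_functions \<Omega>.
        integral\<^sup>L (lebesgue_on \<Omega>) (\<lambda>x. (v x - \<phi> x)\<^sup>2) +
        integral\<^sup>L (lebesgue_on \<Omega>) (\<lambda>x. (norm (G x - grad \<phi> x))\<^sup>2) < \<epsilon>)}"

definition Linf_norm :: "'a::euclidean_space set \<Rightarrow> ('a \<Rightarrow> real) \<Rightarrow> ereal" where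
  "Linf_norm \<Omega> v = esssup (lebesgue_on \<Omega>) (\<lambda>x. ereal \<bar>v x\<bar>)"

section \<open>Domains and meshes\<close>

definition convex_polyhedral_domain :: "'a::euclidean_space set \<Rightarrow> bool" where
  "convex_polyhedral_domain \<Omega> \<longleftrightarrow>
     open \<Omega> \<and> \<Omega> \<noteq> {} \<and> bounded \<Omega> \<and> convex \<Omega> \<and> polyhedron (closure \<Omega>)"

text \<open>The library's \<^const>\<open>triangulation\<close> already requires that any two simplices meet in a
  common (possibly empty) face, i.e. conformity. Elements are closed simplices.\<close>

definition simplicial_mesh :: "'a::euclidean_space set \<Rightarrow> 'a set set \<Rightarrow> bool" where
  "simplicial_mesh \<Omega> \<T> \<longleftrightarrow>
     triangulation \<T> \<and> (\<forall>K\<in>\<T>. int DIM('a) simplex K) \<and> \<Union>\<T> = closure \<Omega>"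

definition inball_diameter :: "'a::euclidean_space set \<Rightarrow> real" where
  "inball_diameter K = 2 * Sup {r. 0 \<le> r \<and> (\<exists>x. cball x r \<subseteq> K)}"

definition shape_regular :: "real \<Rightarrow> 'a::euclidean_space set set \<Rightarrow> bool" where
  "shape_regular \<sigma> \<T> \<longleftrightarrow> (\<forall>K\<in>\<T>. diameter K \<le> \<sigma> * inball_diameter K)"

definition mesh_size :: "'a::euclidean_space set set \<Rightarrow> real" where
  "mesh_size \<T> = Max (diameter ` \<T>)"

definition quasi_uniform :: "real \<Rightarrow> 'a::euclidean_space set set \<Rightarrow> bool" where
  "quasi_uniform \<tau> \<T> \<longleftrightarrow> (\<forall>K\<in>\<T>. mesh_size \<T> \<le> \<tau> * diameter K)"

definition interior_faces :: "'a::euclidean_space set set \<Rightarrow> 'a set set" where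
  "interior_faces \<T> =
     {F. \<exists>K\<in>\<T>. \<exists>K'\<in>\<T>. K \<noteq> K' \<and> F = frontier K \<inter> frontier K' \<and> F facet_of K \<and> F facet_of K'}"

definition outward_normal :: "'a::euclidean_space set \<Rightarrow> 'a set \<Rightarrow> 'a" where
  "outward_normal K F =
     (THE n. norm n = 1 \<and> (\<exists>b. F = K \<inter> {x. n \<bullet> x = b} \<and> K \<subseteq> {x. n \<bullet> x \<le> b}))"

text \<open>The \<open>(d-1)\<close>-dimensional Lebesgue measure on the hyperplane \<open>H\<close> spanned by a facet: since
  Lebesgue measure is the product of the measures along \<open>H\<close> and along its normal line, the surface
  measure of \<open>A \<subseteq> H\<close> is the volume of the right prism over \<open>A\<close> of height \<open>1\<close>. Here the prism is
  the preimage of \<open>A\<close> under orthogonal projection from the slab of thickness \<open>1\<close> about \<open>H\<close>.\<close>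

definition surface_measure :: "'a::euclidean_space set \<Rightarrow> 'a measure" where
  "surface_measure F = (let H = affine hull F in
     distr (restrict_space lborel {x. infdist x H \<le> 1/2}) borel (closest_point H))"

section \<open>The Lagrange finite element space and its discrete norm\<close>

text \<open>Polynomial functions of total degree at most \<open>k\<close>; \<open>\<alpha>\<close> ranges over multi-indices.\<close>

definition poly_space :: "nat \<Rightarrow> ('a::euclidean_space \<Rightarrow> real) set" where
  "poly_space k = {p. \<exists>c. \<forall>x.
     p x = (\<Sum>\<alpha> | \<alpha> \<in> extensional Basis \<and> (\<Sum>i\<in>Basis. \<alpha> i) \<le> k. c \<alpha> * (\<Prod>i\<in>Basis. (x \<bullet> i) ^ \<alpha> i))}"

definition lagrange_space :: "nat \<Rightarrow> 'a::euclidean_space set \<Rightarrow> 'a set set \<Rightarrow> ('a \<Rightarrow> real) set" where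
  "lagrange_space k \<Omega> \<T> =
     {v \<in> H1 \<Omega>. \<forall>K\<in>\<T>. \<exists>p\<in>poly_space k. AE x in lebesgue_on K. v x = p x}"

definition lagrange_space0 :: "nat \<Rightarrow> 'a::euclidean_space set \<Rightarrow> 'a set set \<Rightarrow> ('a \<Rightarrow> real) set" where
  "lagrange_space0 k \<Omega> \<T> = lagrange_space k \<Omega> \<T> \<inter> H1_0 \<Omega>"

text \<open>The polynomial representing \<open>v|\<^sub>K\<close>. Derivatives of it, evaluated on \<open>K\<close> up to the boundary,
  give the elementwise derivatives of \<open>v\<close> and their traces on the faces of \<open>K\<close>.\<close>

definition local_poly :: "nat \<Rightarrow> ('a::euclidean_space \<Rightarrow> real) \<Rightarrow> 'a set \<Rightarrow> 'a \<Rightarrow> real" where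
  "local_poly k v K = (THE p. p \<in> poly_space k \<and> (AE x in lebesgue_on K. v x = p x))"

text \<open>An interior face is a facet of exactly two elements \<open>K\<^sup>+\<close>, \<open>K\<^sup>-\<close>, so this sum is
  \<open>w\<^sup>+ \<bullet> n\<^sub>+ + w\<^sup>- \<bullet> n\<^sub>-\<close>; \<open>w K\<close> is the field on \<open>K\<close>.\<close>

definition jump :: "'a::euclidean_space set set \<Rightarrow> ('a set \<Rightarrow> 'a \<Rightarrow> 'a) \<Rightarrow> 'a set \<Rightarrow> 'a \<Rightarrow> real" where
  "jump \<T> w F x = (\<Sum>K | K \<in> \<T> \<and> F facet_of K. w K x \<bullet> outward_normal K F)"

definition hessian_norm_sq :: "('a::euclidean_space \<Rightarrow> real) \<Rightarrow> 'a \<Rightarrow> real" where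
  "hessian_norm_sq p x = (\<Sum>i\<in>Basis. \<Sum>j\<in>Basis. (partial_deriv i (partial_deriv j p) x)\<^sup>2)"

definition discrete_norm :: "nat \<Rightarrow> 'a::euclidean_space set set \<Rightarrow> ('a \<Rightarrow> real) \<Rightarrow> real" where
  "discrete_norm k \<T> v = sqrt (
     (\<Sum>K\<in>\<T>. integral\<^sup>L (lebesgue_on K) (hessian_norm_sq (local_poly k v K))) +
     (\<Sum>F\<in>interior_faces \<T>. inverse (diameter F) *
        (LINT x:F|surface_measure F. (jump \<T> (\<lambda>K. grad (local_poly k v K)) F x)\<^sup>2)))"

end

theory Submission
  imports Defs
begin

text \<open>On the line through a fixed pole \<open>q\<close> and a point \<open>z\<close>, the function is continuous and piecewise
  polynomial, so its second difference is bounded by the integral of its second derivative plus the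
  jumps of its first derivative at the faces crossed, both weighted by the distance from \<open>q\<close>.
  Averaging over \<open>z \<in> \<Omega>\<close> turns the integrals into volume integrals of the elementwise Hessian and
  the jumps into surface integrals, and the weight compensates for the concentration of the lines at
  \<open>q\<close> as long as \<open>d \<le> 3\<close>. A line meets \<open>O(1/h)\<close> elements by quasi-uniformity, which produces the
  factor \<open>1/h\<close> in front of the jumps. With a pole far outside \<open>\<Omega>\<close>, every line has two zeros on the
  boundary and one obtains the \<open>L\<^sup>1\<close> norm; with a pole \<open>x \<in> \<Omega>\<close>, the values at \<open>z\<close> and at the midpoint
  of \<open>x\<close> and \<open>z\<close> are controlled by that norm and one obtains the value at \<open>x\<close>. No inverse estimate is
  needed, so the constant does not depend on the polynomial degree.\<close>

section \<open>Piecewise smooth functions on an interval\<close>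

text \<open>Membership in \<open>H1_0\<close> supplies neither continuity across faces nor a
  boundary trace in any pointwise sense, and the line argument needs both. They are recovered on
  lines only. Test functions approximating \<open>v\<close> with summable errors have gradients
  dominated by one square-integrable function, so their energies stay bounded on almost every line
  through the pole, away from the pole, and the function has a limit at each parameter there. Since
  it vanishes outside \<open>\<Omega>\<close>, the limit at the end of a chord is zero. Generic
  position of pole and line keeps the crossings finite, transversal and inside facets. Second
  differences are used because they involve no derivative at the end points. Their kernel is
  piecewise linear and vanishes at the end nearest to the pole, which is what permits a weight
  proportional to the distance. Squared, the weight contributes \<open>t^2\<close>; splitting off
  \<open>1 / sqrt t\<close> by AM-GM and dividing by the Jacobian \<open>t^d\<close> of the dilation
  about the pole leaves \<open>t\<close> to the power 5/2 - d, integrable at 0 for d = 2 and d =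
  3.\<close>

lemma jump_ftc:
  fixes Q q L R :: "real \<Rightarrow> real"
  assumes "finite S" "a < b"
    and deriv: "\<And>t. a < t \<Longrightarrow> t < b \<Longrightarrow> t \<notin> S \<Longrightarrow> (Q has_real_derivative q t) (at t)"
    and R: "\<And>t. a \<le> t \<Longrightarrow> t < b \<Longrightarrow> (Q \<longlongrightarrow> R t) (at_right t)"
    and L: "\<And>t. a < t \<Longrightarrow> t \<le> b \<Longrightarrow> (Q \<longlongrightarrow> L t) (at_left t)"
    and q: "q \<in> borel_measurable borel"
  shows "ennreal \<bar>L b - R a\<bar> \<le> (\<integral>\<^sup>+t\<in>{a<..<b}. ennreal \<bar>q t\<bar> \<partial>lborel) + (\<Sum>s\<in>S \<inter> {a<..<b}. ennreal \<bar>R s - L s\<bar>)"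
  using assms(1-5)
\<comment> \<open>Induction on the number of breaks inside the interval: without breaks this is the
  fundamental theorem of calculus, otherwise the interval is cut at one break, whose jump is
  added.\<close>
proof (induction "card (S \<inter> {a<..<b})" arbitrary: a b rule: less_induct)
  case less
  show ?case
  proof (cases "S \<inter> {a<..<b} = {}")
    case True
    \<comment> \<open>The one-sided limits serve as end values, so that \<open>P\<close> is
      continuous on the closed interval although only limits of \<open>Q\<close> are known at its
      ends.\<close>
    define P where "P = (\<lambda>t. if t \<le> a then R a else if b \<le> t then L b else Q t)"
    have d: "(P has_real_derivative q t) (at t)" if "a < t" "t < b" for t
    proof -
      have "t \<notin> S" using True that by auto
      hence "(Q has_real_derivative q t) (at t)" using less that by auto
      moreover have "\<forall>\<^sub>F x in nhds t. P x = Q x"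
        using eventually_nhds_in_open[of "{a<..<b}" t] that
        by (auto elim!: eventually_mono simp: P_def)
      ultimately show ?thesis
        by (metis DERIV_cong_ev)
    qed
    have ca: "continuous (at a within {a..b}) P"
    proof -
      have ev: "\<forall>\<^sub>F x in at_right a. Q x = P x"
        using eventually_at_right_real[OF less(3)] by (auto elim!: eventually_mono simp: P_def)
      have "(P \<longlongrightarrow> R a) (at_right a)"
        using Lim_transform_eventually[OF less(5)[of a] ev] less(3) by auto
      hence "(P \<longlongrightarrow> P a) (at a within {a..b})"
        using less(3) by (simp add: at_within_Icc_at_right P_def)
      thus ?thesis by (simp add: continuous_within)
    qed
    have cb: "continuous (at b within {a..b}) P"
    proof -
      have ev: "\<forall>\<^sub>F x in at_left b. Q x = P x"
        using eventually_at_left_real[OF less(3)] by (auto elim!: eventually_mono simp: P_def)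
      have "(P \<longlongrightarrow> L b) (at_left b)"
        using Lim_transform_eventually[OF less(6)[of b] ev] less(3) by auto
      hence "(P \<longlongrightarrow> P b) (at b within {a..b})"
        using less(3) by (simp add: at_within_Icc_at_left P_def)
      thus ?thesis by (simp add: continuous_within)
    qed
    have cont: "continuous_on {a..b} P"
      unfolding continuous_on_eq_continuous_within
    proof
      fix x assume x: "x \<in> {a..b}"
      show "continuous (at x within {a..b}) P"
      proof (cases "x = a \<or> x = b")
        case True thus ?thesis using ca cb by auto
      next
        case False
        hence "a < x" "x < b" using x by auto
        hence "isCont P x" using d DERIV_isCont by blast
        thus ?thesis by (rule continuous_at_imp_continuous_at_within)
      qed
    qed
    have hi: "(q has_integral (P b - P a)) {a..b}"
      by (rule fundamental_theorem_of_calculus_interior[OF _ cont])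
         (use less(3) d in \<open>auto simp: has_real_derivative_iff_has_vector_derivative[symmetric]\<close>)
    have Pba: "P b - P a = L b - R a" using less(3) by (simp add: P_def)
    show ?thesis
    \<comment> \<open>An infinite right-hand side settles the claim; otherwise \<open>q\<close> is
      Lebesgue integrable and its integral is the gauge integral delivered by the fundamental
      theorem.\<close>
    proof (cases "(\<integral>\<^sup>+t\<in>{a<..<b}. ennreal \<bar>q t\<bar> \<partial>lborel) = \<infinity>")
      case True thus ?thesis by simp
    next
      case False
      have "set_integrable lborel {a<..<b} q"
        unfolding set_integrable_def
      proof (rule integrableI_bounded)
        show "(\<lambda>x. indicat_real {a<..<b} x *\<^sub>R q x) \<in> borel_measurable lborel" using q by simp
        have "(\<integral>\<^sup>+ x. ennreal (norm (indicat_real {a<..<b} x *\<^sub>R q x)) \<partial>lborel) = (\<integral>\<^sup>+t\<in>{a<..<b}. ennreal \<bar>q t\<bar> \<partial>lborel)"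
          by (intro nn_integral_cong) (auto simp: indicator_def)
        thus "(\<integral>\<^sup>+ x. ennreal (norm (indicat_real {a<..<b} x *\<^sub>R q x)) \<partial>lborel) < \<infinity>" using False by (simp add: less_top)
      qed
      note si = this
      have "((\<lambda>t. indicat_real {a<..<b} t *\<^sub>R q t) has_integral (LINT t:{a<..<b}|lborel. q t)) UNIV"
        using si unfolding set_integrable_def set_lebesgue_integral_def by (rule has_integral_integral_lborel)
      moreover have "(\<lambda>t. indicat_real {a<..<b} t *\<^sub>R q t) = (\<lambda>t. if t \<in> {a<..<b} then q t else 0)"
        by (auto simp: indicator_def)
      ultimately have "(q has_integral (LINT t:{a<..<b}|lborel. q t)) {a<..<b}"
        by (simp only: has_integral_restrict_UNIV)
      hence "(q has_integral (LINT t:{a<..<b}|lborel. q t)) {a..b}"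
        using has_integral_Icc_iff_Ioo by blast
      hence e: "L b - R a = (LINT t:{a<..<b}|lborel. q t)"
        using hi Pba has_integral_unique by metis
      have "ennreal (norm (LINT t:{a<..<b}|lborel. q t)) \<le> (\<integral>\<^sup>+t. ennreal (norm (indicat_real {a<..<b} t *\<^sub>R q t)) \<partial>lborel)"
        unfolding set_lebesgue_integral_def
        using si unfolding set_integrable_def by (rule integral_norm_bound_ennreal)
      also have "\<dots> = (\<integral>\<^sup>+t\<in>{a<..<b}. ennreal \<bar>q t\<bar> \<partial>lborel)"
        by (intro nn_integral_cong) (auto simp: indicator_def)
      finally show ?thesis using e by (simp add: add_increasing2)
    qed
  next
    case False
    then obtain s where s: "s \<in> S" "a < s" "s < b" by auto
    have f: "finite (S \<inter> {a<..<b})" using less by auto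
    have c1: "card (S \<inter> {a<..<s}) < card (S \<inter> {a<..<b})"
      by (rule psubset_card_mono[OF f]) (use s in auto)
    have c2: "card (S \<inter> {s<..<b}) < card (S \<inter> {a<..<b})"
      by (rule psubset_card_mono[OF f]) (use s in auto)
    have i1: "ennreal \<bar>L s - R a\<bar> \<le> (\<integral>\<^sup>+t\<in>{a<..<s}. ennreal \<bar>q t\<bar> \<partial>lborel) + (\<Sum>s\<in>S \<inter> {a<..<s}. ennreal \<bar>R s - L s\<bar>)"
      by (rule less(1)[OF c1]) (use less(2-6) s in auto)
    have i2: "ennreal \<bar>L b - R s\<bar> \<le> (\<integral>\<^sup>+t\<in>{s<..<b}. ennreal \<bar>q t\<bar> \<partial>lborel) + (\<Sum>s\<in>S \<inter> {s<..<b}. ennreal \<bar>R s - L s\<bar>)"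
      by (rule less(1)[OF c2]) (use less(2-6) s in auto)
    have "(\<integral>\<^sup>+t\<in>{a<..<s}. ennreal \<bar>q t\<bar> \<partial>lborel) + (\<integral>\<^sup>+t\<in>{s<..<b}. ennreal \<bar>q t\<bar> \<partial>lborel)
       = (\<integral>\<^sup>+t. ennreal \<bar>q t\<bar> * indicator {a<..<s} t + ennreal \<bar>q t\<bar> * indicator {s<..<b} t \<partial>lborel)"
      using q by (subst nn_integral_add) auto
    also have "\<dots> \<le> (\<integral>\<^sup>+t\<in>{a<..<b}. ennreal \<bar>q t\<bar> \<partial>lborel)"
      by (intro nn_integral_mono) (use s in \<open>auto simp: indicator_def\<close>)
    finally have I: "(\<integral>\<^sup>+t\<in>{a<..<s}. ennreal \<bar>q t\<bar> \<partial>lborel) + (\<integral>\<^sup>+t\<in>{s<..<b}. ennreal \<bar>q t\<bar> \<partial>lborel) \<le> (\<integral>\<^sup>+t\<in>{a<..<b}. ennreal \<bar>q t\<bar> \<partial>lborel)" .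
    have un: "S \<inter> {a<..<b} = (S \<inter> {a<..<s}) \<union> insert s (S \<inter> {s<..<b})" using s by auto
    have sm: "(\<Sum>s\<in>S \<inter> {a<..<b}. ennreal \<bar>R s - L s\<bar>) = (\<Sum>s\<in>S \<inter> {a<..<s}. ennreal \<bar>R s - L s\<bar>) + (ennreal \<bar>R s - L s\<bar> + (\<Sum>s\<in>S \<inter> {s<..<b}. ennreal \<bar>R s - L s\<bar>))"
      unfolding un using less(2) by (subst sum.union_disjoint) (auto)
    have "ennreal \<bar>L b - R a\<bar> \<le> ennreal (\<bar>L s - R a\<bar> + (\<bar>R s - L s\<bar> + \<bar>L b - R s\<bar>))"
      by (rule ennreal_leI) linarith
    also have "\<dots> = ennreal \<bar>L s - R a\<bar> + (ennreal \<bar>R s - L s\<bar> + ennreal \<bar>L b - R s\<bar>)"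
      by simp
    also have "\<dots> \<le> ((\<integral>\<^sup>+t\<in>{a<..<s}. ennreal \<bar>q t\<bar> \<partial>lborel) + (\<Sum>s\<in>S \<inter> {a<..<s}. ennreal \<bar>R s - L s\<bar>)) + (ennreal \<bar>R s - L s\<bar> + ((\<integral>\<^sup>+t\<in>{s<..<b}. ennreal \<bar>q t\<bar> \<partial>lborel) + (\<Sum>s\<in>S \<inter> {s<..<b}. ennreal \<bar>R s - L s\<bar>)))"
      using i1 i2 by (intro add_mono order_refl)
    also have "\<dots> = ((\<integral>\<^sup>+t\<in>{a<..<s}. ennreal \<bar>q t\<bar> \<partial>lborel) + (\<integral>\<^sup>+t\<in>{s<..<b}. ennreal \<bar>q t\<bar> \<partial>lborel)) + (\<Sum>s\<in>S \<inter> {a<..<b}. ennreal \<bar>R s - L s\<bar>)"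
      unfolding sm by (simp add: ac_simps)
    finally show ?thesis using I by (meson add_right_mono order_trans)
  qed
qed

text \<open>Integration by parts on each side of \<open>m\<close>. The weights come from the Peano
  kernel of the second difference, the hat function that vanishes at \<open>a\<close> and
  \<open>b\<close> and equals \<open>(b - m) * (m - a)\<close> at \<open>m\<close>. It enters only
  through a majorant \<open>k\<close>, so that a multiple of the parameter can be inserted
  later.\<close>

lemma divided_difference_bound:
  fixes g g1 g2 L R c k :: "real \<Rightarrow> real"
  assumes S: "finite S" and ab: "a < m" "m < b"
    and d1: "\<And>t. a < t \<Longrightarrow> t < b \<Longrightarrow> t \<notin> S \<Longrightarrow> (g has_real_derivative g1 t) (at t)"
    and d2: "\<And>t. a < t \<Longrightarrow> t < b \<Longrightarrow> t \<notin> S \<Longrightarrow> (g1 has_real_derivative g2 t) (at t)"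
    and R: "\<And>t. a \<le> t \<Longrightarrow> t < b \<Longrightarrow> (g1 \<longlongrightarrow> R t) (at_right t)"
    and L: "\<And>t. a < t \<Longrightarrow> t \<le> b \<Longrightarrow> (g1 \<longlongrightarrow> L t) (at_left t)"
    and c: "\<And>t. a < t \<Longrightarrow> t < b \<Longrightarrow> (g \<longlongrightarrow> c t) (at t)"
    and ca: "(g \<longlongrightarrow> c a) (at_right a)" and cb: "(g \<longlongrightarrow> c b) (at_left b)"
    and meas: "g2 \<in> borel_measurable borel"
    and k: "\<And>t. a < t \<Longrightarrow> t \<le> m \<Longrightarrow> (b - m) * (t - a) \<le> k t" "\<And>t. m \<le> t \<Longrightarrow> t < b \<Longrightarrow> (m - a) * (b - t) \<le> k t"
  shows "ennreal \<bar>(b - m) * c a - (b - a) * c m + (m - a) * c b\<bar>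
    \<le> (\<integral>\<^sup>+t\<in>{a<..<b}. ennreal (k t * \<bar>g2 t\<bar>) \<partial>lborel) + (\<Sum>s\<in>S \<inter> {a<..<b}. ennreal (k s * \<bar>R s - L s\<bar>))"
proof -
  \<comment> \<open>Primitives of the two branches of the kernel times \<open>g2\<close>. Since
    \<open>g\<close> has the two-sided limit \<open>c\<close>, only the jumps of \<open>g1\<close>
    survive in the jumps of \<open>Q1\<close> and \<open>Q2\<close>.\<close>
  define Q1 where "Q1 = (\<lambda>t. (b - m) * (t - a) * g1 t - (b - m) * g t)"
  define Q2 where "Q2 = (\<lambda>t. (m - a) * (b - t) * g1 t + (m - a) * g t)"
  have cr: "(g \<longlongrightarrow> c t) (at_right t)" if "a \<le> t" "t < b" for t
    using c[of t] ca that by (cases "t = a") (auto intro: filterlim_mono[OF _ order_refl] simp: at_le)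
  have cl: "(g \<longlongrightarrow> c t) (at_left t)" if "a < t" "t \<le> b" for t
    using c[of t] cb that by (cases "t = b") (auto intro: filterlim_mono[OF _ order_refl] simp: at_le)
  have A: "ennreal \<bar>((b - m) * (m - a) * L m - (b - m) * c m) - ((b - m) * (a - a) * R a - (b - m) * c a)\<bar>
     \<le> (\<integral>\<^sup>+t\<in>{a<..<m}. ennreal \<bar>(b - m) * (t - a) * g2 t\<bar> \<partial>lborel)
      + (\<Sum>s\<in>S \<inter> {a<..<m}. ennreal \<bar>((b - m) * (s - a) * R s - (b - m) * c s) - ((b - m) * (s - a) * L s - (b - m) * c s)\<bar>)"
  proof (rule jump_ftc[of S a m Q1 "\<lambda>t. (b - m) * (t - a) * g2 t" "\<lambda>s. ((b - m) * (s - a) * R s - (b - m) * c s)" "\<lambda>s. ((b - m) * (s - a) * L s - (b - m) * c s)"])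
    show "(Q1 has_real_derivative (b - m) * (t - a) * g2 t) (at t)" if "a < t" "t < m" "t \<notin> S" for t
      unfolding Q1_def using that ab
      by (auto intro!: derivative_eq_intros d1 d2 simp: algebra_simps)
    show "(Q1 \<longlongrightarrow> (b - m) * (t - a) * R t - (b - m) * c t) (at_right t)" if "a \<le> t" "t < m" for t
      unfolding Q1_def using that ab by (intro tendsto_intros R cr) auto
    show "(Q1 \<longlongrightarrow> (b - m) * (t - a) * L t - (b - m) * c t) (at_left t)" if "a < t" "t \<le> m" for t
      unfolding Q1_def using that ab by (intro tendsto_intros L cl) auto
  qed (use S ab meas in auto)
  have B: "ennreal \<bar>((m - a) * (b - b) * L b + (m - a) * c b) - ((m - a) * (b - m) * R m + (m - a) * c m)\<bar>
     \<le> (\<integral>\<^sup>+t\<in>{m<..<b}. ennreal \<bar>(m - a) * (b - t) * g2 t\<bar> \<partial>lborel)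
      + (\<Sum>s\<in>S \<inter> {m<..<b}. ennreal \<bar>((m - a) * (b - s) * R s + (m - a) * c s) - ((m - a) * (b - s) * L s + (m - a) * c s)\<bar>)"
  proof (rule jump_ftc[of S m b Q2 "\<lambda>t. (m - a) * (b - t) * g2 t" "\<lambda>s. ((m - a) * (b - s) * R s + (m - a) * c s)" "\<lambda>s. ((m - a) * (b - s) * L s + (m - a) * c s)"])
    show "(Q2 has_real_derivative (m - a) * (b - t) * g2 t) (at t)" if "m < t" "t < b" "t \<notin> S" for t
      unfolding Q2_def using that ab
      by (auto intro!: derivative_eq_intros d1 d2 simp: algebra_simps)
    show "(Q2 \<longlongrightarrow> (m - a) * (b - t) * R t + (m - a) * c t) (at_right t)" if "m \<le> t" "t < b" for t
      unfolding Q2_def using that ab by (intro tendsto_intros R cr) auto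
    show "(Q2 \<longlongrightarrow> (m - a) * (b - t) * L t + (m - a) * c t) (at_left t)" if "m < t" "t \<le> b" for t
      unfolding Q2_def using that ab by (intro tendsto_intros L cl) auto
  qed (use S ab meas in auto)
  \<comment> \<open>The split point lies in neither open subinterval, so a jump there is accounted
    for separately; it is zero unless \<open>m\<close> is a break.\<close>
  have mid: "R m = L m" if "m \<notin> S"
  proof -
    have "isCont g1 m" using d2[of m] that ab DERIV_isCont by blast
    hence "(g1 \<longlongrightarrow> g1 m) (at m)" by (simp add: isCont_def)
    hence "(g1 \<longlongrightarrow> g1 m) (at_right m)" "(g1 \<longlongrightarrow> g1 m) (at_left m)" by (auto intro: filterlim_mono[OF _ order_refl] simp: at_le)
    moreover have "(g1 \<longlongrightarrow> R m) (at_right m)" "(g1 \<longlongrightarrow> L m) (at_left m)" using R L ab by auto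
    ultimately have "R m = g1 m" "L m = g1 m" by (auto intro: tendsto_unique[OF trivial_limit_at_right_real] tendsto_unique[OF trivial_limit_at_left_real])
    thus ?thesis by simp
  qed
  have IA: "(\<integral>\<^sup>+t\<in>{a<..<m}. ennreal \<bar>(b - m) * (t - a) * g2 t\<bar> \<partial>lborel) + (\<integral>\<^sup>+t\<in>{m<..<b}. ennreal \<bar>(m - a) * (b - t) * g2 t\<bar> \<partial>lborel)
     \<le> (\<integral>\<^sup>+t\<in>{a<..<b}. ennreal (k t * \<bar>g2 t\<bar>) \<partial>lborel)"
  proof -
    have "(\<integral>\<^sup>+t\<in>{a<..<m}. ennreal \<bar>(b - m) * (t - a) * g2 t\<bar> \<partial>lborel) + (\<integral>\<^sup>+t\<in>{m<..<b}. ennreal \<bar>(m - a) * (b - t) * g2 t\<bar> \<partial>lborel)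
      = (\<integral>\<^sup>+t. ennreal \<bar>(b - m) * (t - a) * g2 t\<bar> * indicator {a<..<m} t + ennreal \<bar>(m - a) * (b - t) * g2 t\<bar> * indicator {m<..<b} t \<partial>lborel)"
      using meas by (subst nn_integral_add) auto
    also have "\<dots> \<le> (\<integral>\<^sup>+t\<in>{a<..<b}. ennreal (k t * \<bar>g2 t\<bar>) \<partial>lborel)"
    proof (intro nn_integral_mono)
      fix t
      show "ennreal \<bar>(b - m) * (t - a) * g2 t\<bar> * indicator {a<..<m} t + ennreal \<bar>(m - a) * (b - t) * g2 t\<bar> * indicator {m<..<b} t \<le> ennreal (k t * \<bar>g2 t\<bar>) * indicator {a<..<b} t"
        using ab k[of t] by (auto simp: indicator_def abs_mult intro!: ennreal_leI mult_right_mono)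
    qed
    finally show ?thesis .
  qed
  define J where "J = (\<lambda>s. ennreal (k s * \<bar>R s - L s\<bar>))"
  have SA: "(\<Sum>s\<in>S \<inter> {a<..<m}. ennreal \<bar>((b - m) * (s - a) * R s - (b - m) * c s) - ((b - m) * (s - a) * L s - (b - m) * c s)\<bar>) \<le> (\<Sum>s\<in>S \<inter> {a<..<m}. J s)"
  proof (intro sum_mono)
    fix s assume s: "s \<in> S \<inter> {a<..<m}"
    have "((b - m) * (s - a) * R s - (b - m) * c s) - ((b - m) * (s - a) * L s - (b - m) * c s) = (b - m) * (s - a) * (R s - L s)" by (simp add: algebra_simps)
    thus "ennreal \<bar>((b - m) * (s - a) * R s - (b - m) * c s) - ((b - m) * (s - a) * L s - (b - m) * c s)\<bar> \<le> J s"
      using s k(1)[of s] ab by (auto simp: J_def abs_mult intro!: ennreal_leI mult_right_mono)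
  qed
  have SB: "(\<Sum>s\<in>S \<inter> {m<..<b}. ennreal \<bar>((m - a) * (b - s) * R s + (m - a) * c s) - ((m - a) * (b - s) * L s + (m - a) * c s)\<bar>) \<le> (\<Sum>s\<in>S \<inter> {m<..<b}. J s)"
  proof (intro sum_mono)
    fix s assume s: "s \<in> S \<inter> {m<..<b}"
    have "((m - a) * (b - s) * R s + (m - a) * c s) - ((m - a) * (b - s) * L s + (m - a) * c s) = (m - a) * (b - s) * (R s - L s)" by (simp add: algebra_simps)
    thus "ennreal \<bar>((m - a) * (b - s) * R s + (m - a) * c s) - ((m - a) * (b - s) * L s + (m - a) * c s)\<bar> \<le> J s"
      using s k(2)[of s] ab by (auto simp: J_def abs_mult intro!: ennreal_leI mult_right_mono)
  qed
  have SM: "ennreal \<bar>(b - m) * (m - a) * (R m - L m)\<bar> \<le> (\<Sum>s\<in>S \<inter> {m}. J s)"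
    using mid k(1)[of m] ab by (cases "m \<in> S") (auto simp: J_def abs_mult intro!: ennreal_leI mult_right_mono)
  have un: "S \<inter> {a<..<b} = (S \<inter> {a<..<m}) \<union> ((S \<inter> {m}) \<union> (S \<inter> {m<..<b}))" using ab by auto
  have SS: "(\<Sum>s\<in>S \<inter> {a<..<b}. J s) = (\<Sum>s\<in>S \<inter> {a<..<m}. J s) + ((\<Sum>s\<in>S \<inter> {m}. J s) + (\<Sum>s\<in>S \<inter> {m<..<b}. J s))"
  proof -
    have 1: "(\<Sum>s\<in>(S \<inter> {m}) \<union> (S \<inter> {m<..<b}). J s) = (\<Sum>s\<in>S \<inter> {m}. J s) + (\<Sum>s\<in>S \<inter> {m<..<b}. J s)"
      by (rule sum.union_disjoint) (use S in auto)
    have 2: "(\<Sum>s\<in>(S \<inter> {a<..<m}) \<union> ((S \<inter> {m}) \<union> (S \<inter> {m<..<b})). J s) = (\<Sum>s\<in>S \<inter> {a<..<m}. J s) + (\<Sum>s\<in>(S \<inter> {m}) \<union> (S \<inter> {m<..<b}). J s)"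
      by (rule sum.union_disjoint) (use S in auto)
    show ?thesis unfolding un using 1 2 by simp
  qed
  \<comment> \<open>The two boundary contributions at \<open>m\<close> fit together up to the kernel
    value at \<open>m\<close> times the jump of \<open>g1\<close>.\<close>
  have alg: "(b - m) * c a - (b - a) * c m + (m - a) * c b
     = (((b - m) * (m - a) * L m - (b - m) * c m) - ((b - m) * (a - a) * R a - (b - m) * c a))
      + ((((m - a) * (b - b) * L b + (m - a) * c b) - ((m - a) * (b - m) * R m + (m - a) * c m))
      + (b - m) * (m - a) * (R m - L m))" by (simp add: algebra_simps)
  have "ennreal \<bar>(b - m) * c a - (b - a) * c m + (m - a) * c b\<bar>
    \<le> ennreal (\<bar>((b - m) * (m - a) * L m - (b - m) * c m) - ((b - m) * (a - a) * R a - (b - m) * c a)\<bar>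
      + (\<bar>((m - a) * (b - b) * L b + (m - a) * c b) - ((m - a) * (b - m) * R m + (m - a) * c m)\<bar>
      + \<bar>(b - m) * (m - a) * (R m - L m)\<bar>))"
    unfolding alg by (rule ennreal_leI) (rule order_trans[OF abs_triangle_ineq add_left_mono[OF abs_triangle_ineq]])
  also have "\<dots> = ennreal \<bar>((b - m) * (m - a) * L m - (b - m) * c m) - ((b - m) * (a - a) * R a - (b - m) * c a)\<bar>
      + (ennreal \<bar>((m - a) * (b - b) * L b + (m - a) * c b) - ((m - a) * (b - m) * R m + (m - a) * c m)\<bar>
      + ennreal \<bar>(b - m) * (m - a) * (R m - L m)\<bar>)" by (simp del: diff_self mult_zero_right)
  also have "\<dots> \<le> ((\<integral>\<^sup>+t\<in>{a<..<m}. ennreal \<bar>(b - m) * (t - a) * g2 t\<bar> \<partial>lborel) + (\<Sum>s\<in>S \<inter> {a<..<m}. J s))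
      + (((\<integral>\<^sup>+t\<in>{m<..<b}. ennreal \<bar>(m - a) * (b - t) * g2 t\<bar> \<partial>lborel) + (\<Sum>s\<in>S \<inter> {m<..<b}. J s)) + (\<Sum>s\<in>S \<inter> {m}. J s))"
    by (intro add_mono SM order_trans[OF A] order_trans[OF B] SA SB order_refl)
  also have "\<dots> = ((\<integral>\<^sup>+t\<in>{a<..<m}. ennreal \<bar>(b - m) * (t - a) * g2 t\<bar> \<partial>lborel) + (\<integral>\<^sup>+t\<in>{m<..<b}. ennreal \<bar>(m - a) * (b - t) * g2 t\<bar> \<partial>lborel)) + (\<Sum>s\<in>S \<inter> {a<..<b}. J s)"
    unfolding SS by (simp add: ac_simps)
  also have "\<dots> \<le> (\<integral>\<^sup>+t\<in>{a<..<b}. ennreal (k t * \<bar>g2 t\<bar>) \<partial>lborel) + (\<Sum>s\<in>S \<inter> {a<..<b}. J s)"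
    using IA by (rule add_right_mono)
  finally show ?thesis unfolding J_def .
qed

section \<open>Fubini along a direction and central projections\<close>

lemma nn_integral_lborel_translate:
  fixes f :: "'a::euclidean_space \<Rightarrow> ennreal"
  assumes [measurable]: "f \<in> borel_measurable borel"
  shows "(\<integral>\<^sup>+x. f (x + c) \<partial>lborel) = (\<integral>\<^sup>+x. f x \<partial>lborel)"
proof -
  have "(\<integral>\<^sup>+x. f x \<partial>lborel) = (\<integral>\<^sup>+x. f x \<partial>distr lborel borel ((+) c))"
    by (simp add: lborel_distr_plus)
  also have "\<dots> = (\<integral>\<^sup>+x. f (c + x) \<partial>lborel)"
    by (rule nn_integral_distr) auto
  finally show ?thesis by (simp add: add.commute)
qed

lemma nn_integral_lborel_scale:
  fixes f :: "'a::euclidean_space \<Rightarrow> ennreal"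
  assumes f[measurable]: "f \<in> borel_measurable borel" and s: "0 < s"
  shows "ennreal (s ^ DIM('a)) * (\<integral>\<^sup>+x. f (c + s *\<^sub>R x) \<partial>lborel) = (\<integral>\<^sup>+x. f x \<partial>lborel)"
proof -
  have "(\<integral>\<^sup>+x. f x \<partial>lborel) = (\<integral>\<^sup>+x. f x \<partial>density (distr lborel borel (\<lambda>x. c + s *\<^sub>R x)) (\<lambda>_. \<bar>s\<bar>^DIM('a)))"
    using lborel_affine[of s c] s by simp
  also have "\<dots> = (\<integral>\<^sup>+x. ennreal (\<bar>s\<bar>^DIM('a)) * f x \<partial>distr lborel borel (\<lambda>x. c + s *\<^sub>R x))"
    by (subst nn_integral_density) auto
  also have "\<dots> = (\<integral>\<^sup>+x. ennreal (\<bar>s\<bar>^DIM('a)) * f (c + s *\<^sub>R x) \<partial>lborel)"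
    by (subst nn_integral_distr) auto
  also have "\<dots> = ennreal (s ^ DIM('a)) * (\<integral>\<^sup>+x. f (c + s *\<^sub>R x) \<partial>lborel)"
    using s by (subst nn_integral_cmult) auto
  finally show ?thesis by simp
qed

lemma nn_integral_lborel_swap:
  fixes f :: "'a::euclidean_space \<Rightarrow> 'b::euclidean_space \<Rightarrow> ennreal"
  assumes "case_prod f \<in> borel_measurable (lborel \<Otimes>\<^sub>M lborel)"
  shows "(\<integral>\<^sup>+y. (\<integral>\<^sup>+x. f x y \<partial>lborel) \<partial>lborel) = (\<integral>\<^sup>+x. (\<integral>\<^sup>+y. f x y \<partial>lborel) \<partial>lborel)"
  by (rule pair_sigma_finite.Fubini'[OF _ assms]) (simp add: pair_sigma_finite_def sigma_finite_lborel)

text \<open>The integral over the hyperplane \<open>n \<bullet> x = a\<close>, taken over a slab of thickness one. Since this uses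
  no coordinates adapted to \<open>n\<close>, Fubini's theorem in the direction \<open>n\<close> follows from translation
  invariance alone.\<close>
definition plane_integral :: "'a::euclidean_space \<Rightarrow> ('a \<Rightarrow> ennreal) \<Rightarrow> real \<Rightarrow> ennreal" where
  "plane_integral n f a = (\<integral>\<^sup>+w. f (w + (a - n \<bullet> w) *\<^sub>R n) * indicator {w. 0 \<le> n \<bullet> w \<and> n \<bullet> w < 1} w \<partial>lborel)"

lemma plane_integral_fubini:
  fixes f :: "'a::euclidean_space \<Rightarrow> ennreal"
  assumes [measurable]: "f \<in> borel_measurable borel" and n: "norm n = 1"
  shows "(\<integral>\<^sup>+a. plane_integral n f a \<partial>lborel) = (\<integral>\<^sup>+w. f w \<partial>lborel)"
proof -
  have nn: "n \<bullet> n = 1" using n by (simp add: norm_eq_1)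
  let ?I = "indicator {w. 0 \<le> n \<bullet> w \<and> n \<bullet> w < 1} :: 'a \<Rightarrow> ennreal"
  have "(\<integral>\<^sup>+a. plane_integral n f a \<partial>lborel) = (\<integral>\<^sup>+w. (\<integral>\<^sup>+a. f (w + (a - n \<bullet> w) *\<^sub>R n) * ?I w \<partial>lborel) \<partial>lborel)"
    unfolding plane_integral_def by (rule nn_integral_lborel_swap) measurable
  also have "\<dots> = (\<integral>\<^sup>+w. (\<integral>\<^sup>+a. f (w + a *\<^sub>R n) * ?I w \<partial>lborel) \<partial>lborel)"
  proof (rule nn_integral_cong)
    fix w :: 'a
    show "(\<integral>\<^sup>+a. f (w + (a - n \<bullet> w) *\<^sub>R n) * ?I w \<partial>lborel) = (\<integral>\<^sup>+a. f (w + a *\<^sub>R n) * ?I w \<partial>lborel)"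
      using nn_integral_lborel_translate[of "\<lambda>a. f (w + a *\<^sub>R n) * ?I w" "- (n \<bullet> w)"] by simp
  qed
  also have "\<dots> = (\<integral>\<^sup>+a. (\<integral>\<^sup>+w. f (w + a *\<^sub>R n) * ?I w \<partial>lborel) \<partial>lborel)"
    by (rule nn_integral_lborel_swap[symmetric]) measurable
  \<comment> \<open>Substituting w for w + a n turns the slab condition into membership of
    \<open>a\<close> in a half-open interval of length one, so that integrating over
    \<open>a\<close> next leaves exactly \<open>f w\<close>.\<close>
  also have "\<dots> = (\<integral>\<^sup>+a. (\<integral>\<^sup>+w. f w * indicator {n \<bullet> w - 1 <.. n \<bullet> w} a \<partial>lborel) \<partial>lborel)"
  proof (rule nn_integral_cong)
    fix a :: real
    have "(\<integral>\<^sup>+w. f w * indicator {n \<bullet> w - 1 <.. n \<bullet> w} a \<partial>lborel) = (\<integral>\<^sup>+w. f (w + a *\<^sub>R n) * indicator {n \<bullet> (w + a *\<^sub>R n) - 1 <.. n \<bullet> (w + a *\<^sub>R n)} a \<partial>lborel)"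
      by (rule nn_integral_lborel_translate[symmetric]) (simp add: greaterThanAtMost_def greaterThan_def atMost_def indicator_def of_bool_def, measurable)
    also have "\<dots> = (\<integral>\<^sup>+w. f (w + a *\<^sub>R n) * ?I w \<partial>lborel)"
      by (intro nn_integral_cong) (auto simp: indicator_def inner_add_right nn)
    finally show "(\<integral>\<^sup>+w. f (w + a *\<^sub>R n) * ?I w \<partial>lborel) = (\<integral>\<^sup>+w. f w * indicator {n \<bullet> w - 1 <.. n \<bullet> w} a \<partial>lborel)" by simp
  qed
  also have "\<dots> = (\<integral>\<^sup>+w. (\<integral>\<^sup>+a. f w * indicator {n \<bullet> w - 1 <.. n \<bullet> w} a \<partial>lborel) \<partial>lborel)"
    by (rule nn_integral_lborel_swap) (simp add: greaterThanAtMost_def greaterThan_def atMost_def indicator_def of_bool_def, measurable)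
  also have "\<dots> = (\<integral>\<^sup>+w. f w \<partial>lborel)"
    by (intro nn_integral_cong) (simp add: nn_integral_cmult)
  finally show ?thesis .
qed

text \<open>On each slice orthogonal to \<open>n\<close> the profile is constant and the other
  factor depends only on the projection to the plane at \<open>b\<close>. Only the total mass of the
  profile counts, which lets the slab be shifted, rescaled or recentred.\<close>

lemma plane_integral_product:
  fixes F :: "'a::euclidean_space \<Rightarrow> ennreal"
  assumes [measurable]: "F \<in> borel_measurable borel" "\<phi> \<in> borel_measurable borel" and n: "norm n = 1"
  shows "(\<integral>\<^sup>+w. \<phi> (n \<bullet> w) * F (w + (b - n \<bullet> w) *\<^sub>R n) \<partial>lborel) = (\<integral>\<^sup>+a. \<phi> a \<partial>lborel) * plane_integral n F b"
proof -
  have nn: "n \<bullet> n = 1" using n by (simp add: norm_eq_1)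
  have e: "plane_integral n (\<lambda>w. \<phi> (n \<bullet> w) * F (w + (b - n \<bullet> w) *\<^sub>R n)) a = \<phi> a * plane_integral n F b" for a
  proof -
    have *: "n \<bullet> (w + (a - n \<bullet> w) *\<^sub>R n) = a" for w by (simp add: inner_add_right nn)
    have **: "w + (a - n \<bullet> w) *\<^sub>R n + (b - a) *\<^sub>R n = w + (b - n \<bullet> w) *\<^sub>R n" for w by (simp add: algebra_simps)
    show ?thesis unfolding plane_integral_def * **
      by (subst nn_integral_cmult[symmetric]) (auto simp: mult.assoc)
  qed
  have "(\<integral>\<^sup>+w. \<phi> (n \<bullet> w) * F (w + (b - n \<bullet> w) *\<^sub>R n) \<partial>lborel) = (\<integral>\<^sup>+a. \<phi> a * plane_integral n F b \<partial>lborel)"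
    using plane_integral_fubini[of "\<lambda>w. \<phi> (n \<bullet> w) * F (w + (b - n \<bullet> w) *\<^sub>R n)" n] n by (simp add: e)
  thus ?thesis by (simp add: nn_integral_multc)
qed

text \<open>The dilation by \<open>s\<close> changes volumes by \<open>s\<close> to the power d, but
  also changes the slab thickness from 1 to \<open>s\<close>; dividing by that thickness leaves the
  (d-1)-dimensional factor.\<close>

lemma plane_integral_scale:
  fixes f :: "'a::euclidean_space \<Rightarrow> ennreal"
  assumes [measurable]: "f \<in> borel_measurable borel" and n: "norm n = 1" and s: "0 < s"
  shows "ennreal (s ^ (DIM('a) - 1)) * plane_integral n (\<lambda>u. f (s *\<^sub>R u)) a = plane_integral n f (s * a)"
proof -
  let ?F = "\<lambda>w. indicator {0..<s} (n \<bullet> w) * f (w + (s * a - n \<bullet> w) *\<^sub>R n)"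
  have "ennreal (s ^ DIM('a)) * plane_integral n (\<lambda>u. f (s *\<^sub>R u)) a = ennreal (s ^ DIM('a)) * (\<integral>\<^sup>+w. ?F (0 + s *\<^sub>R w) \<partial>lborel)"
    unfolding plane_integral_def
  proof (rule arg_cong[where f="\<lambda>x. ennreal (s ^ DIM('a)) * x"], rule nn_integral_cong)
    fix w :: 'a
    have 1: "s *\<^sub>R (w + (a - n \<bullet> w) *\<^sub>R n) = 0 + s *\<^sub>R w + (s * a - n \<bullet> (0 + s *\<^sub>R w)) *\<^sub>R n"
      by (simp add: algebra_simps)
    have 2: "n \<bullet> (0 + s *\<^sub>R w) \<in> {0..<s} \<longleftrightarrow> 0 \<le> n \<bullet> w \<and> n \<bullet> w < 1"
      using s by (auto simp: zero_le_mult_iff)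
    show "f (s *\<^sub>R (w + (a - n \<bullet> w) *\<^sub>R n)) * indicator {w. 0 \<le> n \<bullet> w \<and> n \<bullet> w < 1} w = ?F (0 + s *\<^sub>R w)"
      using 2 unfolding 1 by (simp add: indicator_def del: scaleR_right_distrib add_0_left inner_scaleR_right)
  qed
  also have "\<dots> = (\<integral>\<^sup>+w. ?F w \<partial>lborel)"
    by (rule nn_integral_lborel_scale[OF _ s]) measurable
  also have "\<dots> = ennreal s * plane_integral n f (s * a)"
    using s n by (subst plane_integral_product) auto
  finally have *: "ennreal (s ^ DIM('a)) * plane_integral n (\<lambda>u. f (s *\<^sub>R u)) a = ennreal s * plane_integral n f (s * a)" .
  have "s ^ DIM('a) = s * s ^ (DIM('a) - 1)" by (metis DIM_positive power_eq_if not_less0)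
  with * have "ennreal s * (ennreal (s ^ (DIM('a) - 1)) * plane_integral n (\<lambda>u. f (s *\<^sub>R u)) a) = ennreal s * plane_integral n f (s * a)"
    using s by (simp add: ennreal_mult mult.assoc)
  moreover have "ennreal s \<noteq> 0" "ennreal s \<noteq> top" using s by auto
  ultimately show ?thesis by (metis ennreal_mult_cancel_left)
qed

text \<open>The Jacobian of the central projection of the slice \<open>n \<bullet> u = l\<close> to \<open>n \<bullet> u = a\<close> is
  \<open>(l/a)\<^sup>d\<^sup>-\<^sup>1\<close>; the factor \<open>a\<^sup>2\<close> absorbs its singularity for \<open>d \<le> 3\<close>.\<close>
lemma cone_integral_bound:
  fixes f :: "'a::euclidean_space \<Rightarrow> ennreal"
  assumes [measurable]: "f \<in> borel_measurable borel" and n: "norm n = 1" and a: "0 < a" and D: "0 \<le> D"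
    and dim: "DIM('a) = 2 \<or> DIM('a) = 3"
  shows "(\<integral>\<^sup>+u. indicator {u. a < 2 * (n \<bullet> u) \<and> n \<bullet> u \<le> D} u * ennreal (a\<^sup>2) * f ((a / (n \<bullet> u)) *\<^sub>R u) \<partial>lborel)
     \<le> ennreal (2 * D ^ 3) * plane_integral n f a"
proof -
  have nn: "n \<bullet> n = 1" using n by (simp add: norm_eq_1)
  let ?G = "\<lambda>u. indicator {u. a < 2 * (n \<bullet> u) \<and> n \<bullet> u \<le> D} u * ennreal (a\<^sup>2) * f ((a / (n \<bullet> u)) *\<^sub>R u)"
  \<comment> \<open>Slice by slice: \<open>l\<close> is the height of the slice above the pole, and
    \<open>a < 2 * l\<close> says that the projected point sits at a parameter below 2 on its
    ray.\<close>
  have pl: "plane_integral n ?G l \<le> indicator {0..D} l * ennreal (2 * D ^ 2) * plane_integral n f a" for l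
  proof (cases "a < 2 * l \<and> l \<le> D")
    case False
    have "plane_integral n ?G l = (\<integral>\<^sup>+w. 0 \<partial>(lborel::'a measure))"
      unfolding plane_integral_def using False
      by (intro nn_integral_cong) (auto simp: indicator_def inner_add_right nn)
    thus ?thesis by simp
  next
    case True
    hence l: "0 < l" using a by linarith
    have "plane_integral n ?G l = plane_integral n (\<lambda>u. ennreal (a\<^sup>2) * f ((a / l) *\<^sub>R u)) l"
      unfolding plane_integral_def using True
      by (intro nn_integral_cong) (auto simp: indicator_def inner_add_right nn)
    also have "\<dots> = ennreal (a\<^sup>2) * plane_integral n (\<lambda>u. f ((a / l) *\<^sub>R u)) l"
      unfolding plane_integral_def by (subst nn_integral_cmult[symmetric]) (auto simp: mult.assoc)
    also have "\<dots> \<le> ennreal (2 * D\<^sup>2 * (a / l) ^ (DIM('a) - 1)) * plane_integral n (\<lambda>u. f ((a / l) *\<^sub>R u)) l"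
    proof (intro mult_right_mono ennreal_leI)
      have "a\<^sup>2 * (l ^ (DIM('a) - 1)) \<le> 2 * D\<^sup>2 * a ^ (DIM('a) - 1)"
        using dim
      proof
        \<comment> \<open>Here the factor 2 comes from \<open>a < 2 * l\<close> together with
          \<open>l \<le> D\<close>. In dimension 3 the powers of \<open>a\<close> cancel and the
          factor 2 is slack.\<close>
        assume d: "DIM('a) = 2"
        have "a * l \<le> (2 * D) * D" using True a l by (intro mult_mono) auto
        hence "a * (a * l) \<le> a * (2 * D * D)" using a by (intro mult_left_mono) auto
        thus ?thesis using d by (simp add: power2_eq_square algebra_simps)
      next
        assume d: "DIM('a) = 3"
        have "l\<^sup>2 \<le> D\<^sup>2" using True l by (intro power_mono) auto
        hence "l\<^sup>2 \<le> 2 * D\<^sup>2" using zero_le_power2[of D] by linarith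
        hence "a\<^sup>2 * l\<^sup>2 \<le> a\<^sup>2 * (2 * D\<^sup>2)" by (intro mult_left_mono) auto
        thus ?thesis using d by (simp add: algebra_simps)
      qed
      thus "a\<^sup>2 \<le> 2 * D\<^sup>2 * (a / l) ^ (DIM('a) - 1)"
        using l by (simp add: power_divide field_simps)
    qed auto
    also have "\<dots> = ennreal (2 * D\<^sup>2) * plane_integral n f a"
      using plane_integral_scale[of f n "a / l" l] n a l by (simp add: ennreal_mult mult.assoc)
    finally show ?thesis using True l by simp
  qed
  have "(\<integral>\<^sup>+u. ?G u \<partial>lborel) = (\<integral>\<^sup>+l. plane_integral n ?G l \<partial>lborel)"
    by (rule plane_integral_fubini[symmetric, OF _ n]) measurable
  also have "\<dots> \<le> (\<integral>\<^sup>+l. indicator {0..D} l * ennreal (2 * D ^ 2) * plane_integral n f a \<partial>lborel)"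
    by (intro nn_integral_mono pl)
  also have "\<dots> = ennreal D * ennreal (2 * D ^ 2) * plane_integral n f a"
    using D by (simp add: mult.assoc nn_integral_multc)
  also have "ennreal D * ennreal (2 * D ^ 2) = ennreal (2 * D ^ 3)"
    using D by (simp add: ennreal_mult[symmetric] power3_eq_cube power2_eq_square algebra_simps)
  finally show ?thesis .
qed

text \<open>Reconciles two conventions: \<open>surface_measure\<close> uses the closed slab of
  half-width 1/2 about the hyperplane, \<open>plane_integral\<close> the half-open slab starting at
  height 0.\<close>

lemma plane_integral_slab:
  fixes f :: "'a::euclidean_space \<Rightarrow> ennreal"
  assumes [measurable]: "f \<in> borel_measurable borel" and n: "norm n = 1"
  shows "(\<integral>\<^sup>+w. indicator {w. \<bar>n \<bullet> w - b\<bar> \<le> 1/2} w * f (w + (b - n \<bullet> w) *\<^sub>R n) \<partial>lborel) = plane_integral n f b"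
proof -
  have "(\<integral>\<^sup>+w. indicator {w. \<bar>n \<bullet> w - b\<bar> \<le> 1/2} w * f (w + (b - n \<bullet> w) *\<^sub>R n) \<partial>lborel)
     = (\<integral>\<^sup>+w. indicator {b - 1/2..b + 1/2} (n \<bullet> w) * f (w + (b - n \<bullet> w) *\<^sub>R n) \<partial>lborel)"
  proof (intro nn_integral_cong)
    fix w :: 'a
    have "\<bar>n \<bullet> w - b\<bar> \<le> 1/2 \<longleftrightarrow> n \<bullet> w \<in> {b - 1/2..b + 1/2}"
      unfolding atLeastAtMost_iff by linarith
    thus "indicator {w. \<bar>n \<bullet> w - b\<bar> \<le> 1/2} w * f (w + (b - n \<bullet> w) *\<^sub>R n) = indicator {b - 1/2..b + 1/2} (n \<bullet> w) * f (w + (b - n \<bullet> w) *\<^sub>R n)"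
      by (simp add: indicator_def)
  qed
  also have "\<dots> = (\<integral>\<^sup>+a. indicator {b - 1/2..b + 1/2} a \<partial>lborel) * plane_integral n f b"
    by (rule plane_integral_product) (use n in auto)
  also have "\<dots> = plane_integral n f b" by simp
  finally show ?thesis .
qed

section \<open>Polynomial functions\<close>

lemma real_polynomial_function_differentiable:
  fixes p :: "'a::euclidean_space \<Rightarrow> real"
  assumes "real_polynomial_function p"
  shows "p differentiable (at x)"
  using assms by induction (auto simp: bounded_linear_imp_differentiable)

lemma real_polynomial_function_continuous:
  fixes p :: "'a::euclidean_space \<Rightarrow> real"
  assumes "real_polynomial_function p"
  shows "continuous_on A p"
  by (meson assms continuous_at_imp_continuous_on differentiable_imp_continuous_within real_polynomial_function_differentiable)

lemma real_polynomial_function_partial_deriv: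
  fixes p :: "'a::euclidean_space \<Rightarrow> real"
  assumes "real_polynomial_function p"
  shows "real_polynomial_function (partial_deriv i p)"
  using assms
proof induction
  case (linear f)
  have "frechet_derivative f (at x) = f" for x
    using linear by (metis bounded_linear_imp_has_derivative frechet_derivative_at)
  hence "partial_deriv i f = (\<lambda>x. f i)" by (simp add: partial_deriv_def fun_eq_iff)
  thus ?case by (simp add: real_polynomial_function.intros(2))
next
  case (const c)
  have "partial_deriv i (\<lambda>x. c) = (\<lambda>x::'a. 0)" by (simp add: partial_deriv_def fun_eq_iff)
  thus ?case by (simp add: real_polynomial_function.intros(2))
next
  case (add f g)
  have "frechet_derivative (\<lambda>x. f x + g x) (at x) = (\<lambda>h. frechet_derivative f (at x) h + frechet_derivative g (at x) h)" for x
    using add(1,2)[THEN real_polynomial_function_differentiable, of x]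
    by (intro frechet_derivative_at[symmetric]) (auto intro!: derivative_eq_intros simp: frechet_derivative_works)
  hence "partial_deriv i (\<lambda>x. f x + g x) = (\<lambda>x. partial_deriv i f x + partial_deriv i g x)"
    by (simp add: partial_deriv_def fun_eq_iff)
  thus ?case using add by (simp add: real_polynomial_function.intros(3))
next
  case (mult f g)
  have "frechet_derivative (\<lambda>x. f x * g x) (at x) = (\<lambda>h. f x * frechet_derivative g (at x) h + frechet_derivative f (at x) h * g x)" for x
    using mult(1,2)[THEN real_polynomial_function_differentiable, of x]
    by (intro frechet_derivative_at[symmetric]) (auto intro!: derivative_eq_intros simp: frechet_derivative_works)
  hence "partial_deriv i (\<lambda>x. f x * g x) = (\<lambda>x. f x * partial_deriv i g x + partial_deriv i f x * g x)"
    by (simp add: partial_deriv_def fun_eq_iff)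
  thus ?case using mult by (auto intro!: real_polynomial_function.intros(3) real_polynomial_function.intros(4))
qed

lemma has_derivative_grad:
  fixes p :: "'a::euclidean_space \<Rightarrow> real"
  assumes "p differentiable (at x)"
  shows "(p has_derivative (\<lambda>h. grad p x \<bullet> h)) (at x)"
proof -
  have d: "(p has_derivative frechet_derivative p (at x)) (at x)"
    using assms by (simp add: frechet_derivative_works)
  interpret l: linear "frechet_derivative p (at x)" by (rule linear_frechet_derivative[OF assms])
  have "frechet_derivative p (at x) h = grad p x \<bullet> h" for h
  proof -
    have "frechet_derivative p (at x) h = frechet_derivative p (at x) (\<Sum>i\<in>Basis. (h \<bullet> i) *\<^sub>R i)"
      by (simp add: euclidean_representation)
    also have "\<dots> = grad p x \<bullet> h"
      by (simp add: l.sum l.scaleR grad_def partial_deriv_def inner_sum_left inner_sum_right inner_commute[of _ h] mult.commute)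
    finally show ?thesis .
  qed
  hence "frechet_derivative p (at x) = (\<lambda>h. grad p x \<bullet> h)" by (rule ext)
  with d show ?thesis by simp
qed

lemma grad_inner:
  fixes p :: "'a::euclidean_space \<Rightarrow> real"
  shows "grad p y \<bullet> e = (\<Sum>j\<in>Basis. partial_deriv j p y * (e \<bullet> j))"
  by (simp add: grad_def inner_sum_left inner_commute[of e])

lemma has_derivative_along_line:
  fixes p :: "'a::euclidean_space \<Rightarrow> real"
  assumes "p differentiable (at (q + t *\<^sub>R e))"
  shows "((\<lambda>t. p (q + t *\<^sub>R e)) has_real_derivative (grad p (q + t *\<^sub>R e) \<bullet> e)) (at t)"
proof -
  have "((\<lambda>t. p (q + t *\<^sub>R e)) has_derivative (\<lambda>s. grad p (q + t *\<^sub>R e) \<bullet> (s *\<^sub>R e))) (at t)"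
    by (rule has_derivative_compose[where f = "\<lambda>t. q + t *\<^sub>R e" and g = p and g' = "\<lambda>h. grad p (q + t *\<^sub>R e) \<bullet> h" and f' = "\<lambda>s. s *\<^sub>R e" and x = t and s = UNIV, OF _ has_derivative_grad[OF assms]])
       (auto intro!: derivative_eq_intros)
  moreover have "(\<lambda>s. grad p (q + t *\<^sub>R e) \<bullet> (s *\<^sub>R e)) = (\<lambda>s. (grad p (q + t *\<^sub>R e) \<bullet> e) * s)" by (auto simp: mult.commute)
  ultimately show ?thesis by (simp add: has_field_derivative_def)
qed

text \<open>The quadratic form of the Hessian, evaluated at the direction \<open>e\<close>.\<close>

definition hess :: "('a::euclidean_space \<Rightarrow> real) \<Rightarrow> 'a \<Rightarrow> 'a \<Rightarrow> real" where
  "hess p y e = (\<Sum>j\<in>Basis. (grad (partial_deriv j p) y \<bullet> e) * (e \<bullet> j))"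

lemma has_second_derivative_along_line:
  fixes p :: "'a::euclidean_space \<Rightarrow> real"
  assumes "real_polynomial_function p"
  shows "((\<lambda>t. grad p (q + t *\<^sub>R e) \<bullet> e) has_real_derivative hess p (q + t *\<^sub>R e) e) (at t)"
  unfolding grad_inner[of p] hess_def
  by (auto intro!: derivative_eq_intros has_derivative_along_line real_polynomial_function_differentiable
        real_polynomial_function_partial_deriv assms simp: mult.commute)

text \<open>Cauchy-Schwarz for matrices: the rank-one matrix with entries
  \<open>(e \<bullet> i) * (e \<bullet> j)\<close> has Frobenius norm
  \<open>(norm e)^2\<close>.\<close>

lemma hess_le:
  fixes p :: "'a::euclidean_space \<Rightarrow> real"
  shows "\<bar>hess p y e\<bar> \<le> (norm e)\<^sup>2 * sqrt (hessian_norm_sq p y)"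
proof -
  let ?a = "\<lambda>(j,i). partial_deriv i (partial_deriv j p) y"
  let ?b = "\<lambda>(j,i). (e \<bullet> i) * (e \<bullet> j)"
  have h: "hess p y e = (\<Sum>x\<in>Basis\<times>Basis. ?a x * ?b x)"
    by (simp add: hess_def grad_inner sum_distrib_right sum.cartesian_product mult.assoc case_prod_unfold)
  have n: "(norm e)\<^sup>2 = (\<Sum>i\<in>Basis. (e \<bullet> i)\<^sup>2)"
    unfolding power2_norm_eq_inner by (subst euclidean_inner) (simp add: power2_eq_square)
  have b: "(\<Sum>x\<in>Basis\<times>Basis. (?b x)\<^sup>2) = ((norm e)\<^sup>2)\<^sup>2"
    unfolding n power2_eq_square[of "sum _ _"] sum_product sum.cartesian_product
    by (intro sum.cong) (auto simp: power2_eq_square)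
  have a: "(\<Sum>x\<in>Basis\<times>Basis. (?a x)\<^sup>2) = hessian_norm_sq p y"
    unfolding hessian_norm_sq_def by (subst sum.swap) (simp add: sum.cartesian_product case_prod_unfold)
  have "(hess p y e)\<^sup>2 \<le> hessian_norm_sq p y * ((norm e)\<^sup>2)\<^sup>2"
    unfolding h a[symmetric] b[symmetric] by (rule Cauchy_Schwarz_ineq_sum)
  hence "sqrt ((hess p y e)\<^sup>2) \<le> sqrt (hessian_norm_sq p y * ((norm e)\<^sup>2)\<^sup>2)" by (rule real_sqrt_le_mono)
  thus ?thesis by (simp only: real_sqrt_mult real_sqrt_abs abs_power2 mult.commute abs_of_nonneg[OF zero_le_power2])
qed

lemma real_polynomial_function_hessian_norm_sq:
  fixes p :: "'a::euclidean_space \<Rightarrow> real"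
  assumes "real_polynomial_function p"
  shows "real_polynomial_function (hessian_norm_sq p)"
proof -
  have "hessian_norm_sq p = (\<lambda>x. \<Sum>i\<in>Basis. \<Sum>j\<in>Basis. (partial_deriv i (partial_deriv j p) x)\<^sup>2)"
    by (simp add: hessian_norm_sq_def fun_eq_iff)
  thus ?thesis
    by (auto intro!: real_polynomial_function_sum real_polynomial_function_power real_polynomial_function_partial_deriv assms)
qed

lemma hessian_norm_sq_nonneg: "0 \<le> hessian_norm_sq p y"
  by (simp add: hessian_norm_sq_def sum_nonneg)

lemma continuous_grad:
  fixes p :: "'a::euclidean_space \<Rightarrow> real"
  assumes "real_polynomial_function p"
  shows "continuous_on A (grad p)"
proof -
  have "grad p = (\<lambda>x. \<Sum>i\<in>Basis. partial_deriv i p x *\<^sub>R i)" by (simp add: grad_def fun_eq_iff)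
  thus ?thesis using assms
    by (auto intro!: continuous_intros real_polynomial_function_continuous real_polynomial_function_partial_deriv)
qed

text \<open>On the line from \<open>x0\<close> to \<open>y\<close> the function becomes a univariate
  polynomial that vanishes on an interval; infinitely many roots force all its coefficients to be
  zero.\<close>

lemma real_polynomial_function_eq_0:
  fixes p :: "'a::euclidean_space \<Rightarrow> real"
  assumes p: "real_polynomial_function p" and U: "open U" "x0 \<in> U" and z: "\<And>x. x \<in> U \<Longrightarrow> p x = 0"
  shows "p y = 0"
proof -
  define h where "h = (\<lambda>t. p (x0 + t *\<^sub>R (y - x0)))"
  have "real_polynomial_function (p \<circ> (\<lambda>t. x0 + t *\<^sub>R (y - x0)))"
    by (intro real_polynomial_function_compose p polynomial_function_add polynomial_function_const)
       (auto simp: polynomial_function_def o_def intro!: real_polynomial_function.intros(1) bounded_linear_compose[OF _ bounded_linear_scaleR_left])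
  hence "real_polynomial_function h" by (simp add: h_def o_def)
  then obtain a n where h: "h = (\<lambda>x. \<Sum>i\<le>n. a i * x^i)" using real_polynomial_function_iff_sum by blast
  have "continuous (at 0) (\<lambda>t::real. x0 + t *\<^sub>R (y - x0))" by (intro continuous_intros)
  hence "\<forall>\<^sub>F t in at 0. x0 + t *\<^sub>R (y - x0) \<in> U"
    using U by (auto simp: continuous_at dest!: topological_tendstoD[of _ _ _ U])
  hence "\<forall>\<^sub>F t in at 0. h t = 0" by eventually_elim (simp add: h_def z)
  then obtain d where d: "d > 0" "\<And>t. t \<noteq> 0 \<Longrightarrow> dist t 0 < d \<Longrightarrow> h t = 0"
    unfolding eventually_at by auto
  have "{0<..<d} \<subseteq> {t. h t = 0}" using d(2) by auto
  hence "infinite {t. h t = 0}" using d(1) infinite_Ioo finite_subset by blast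
  hence "\<forall>i\<le>n. a i = 0" using polyfun_finite_roots[of a n] unfolding h by blast
  hence "h 1 = 0" by (simp add: h)
  thus ?thesis by (simp add: h_def)
qed

lemma poly_space_real_polynomial_function:
  fixes p :: "'a::euclidean_space \<Rightarrow> real"
  assumes "p \<in> poly_space k"
  shows "real_polynomial_function p"
proof -
  obtain c where "\<forall>x. p x = (\<Sum>\<alpha> | \<alpha> \<in> extensional Basis \<and> (\<Sum>i\<in>Basis. \<alpha> i) \<le> k. c \<alpha> * (\<Prod>i\<in>Basis. (x \<bullet> i) ^ \<alpha> i))"
    using assms unfolding poly_space_def by blast
  hence p: "p = (\<lambda>x. \<Sum>\<alpha> | \<alpha> \<in> extensional Basis \<and> (\<Sum>i\<in>Basis. \<alpha> i) \<le> k. c \<alpha> * (\<Prod>i\<in>Basis. (x \<bullet> i) ^ \<alpha> i))" by auto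
  have t: "real_polynomial_function (\<lambda>x. c \<alpha> * (\<Prod>i\<in>Basis. ((x::'a) \<bullet> i) ^ \<alpha> i))" for \<alpha>
    by (intro real_polynomial_function.intros(4) real_polynomial_function.intros(2) real_polynomial_function_prod
        real_polynomial_function_power real_polynomial_function.intros(1) bounded_linear_inner_left) auto
  show ?thesis
  \<comment> \<open>A sum over an infinite set is 0 by convention, so both cases yield a polynomial
    function.\<close>
  proof (cases "finite {\<alpha>::'a \<Rightarrow> nat. \<alpha> \<in> extensional Basis \<and> (\<Sum>i\<in>Basis. \<alpha> i) \<le> k}")
    case True thus ?thesis unfolding p by (intro real_polynomial_function_sum t)
  next
    case False thus ?thesis unfolding p by (simp add: real_polynomial_function.intros(2))
  qed
qed

lemma continuous_AE_eq_on_open: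
  fixes p :: "'a::euclidean_space \<Rightarrow> real"
  assumes p: "continuous_on UNIV p" and U: "open U" and ae: "AE x in lebesgue. x \<in> U \<longrightarrow> p x = 0" and x: "x \<in> U"
  shows "p x = 0"
proof (rule ccontr)
  assume "p x \<noteq> 0"
  have o: "open (U \<inter> {x. p x \<noteq> 0})"
    using p U by (intro open_Int open_Collect_neq) (auto intro: continuous_intros)
  have "negligible {x. \<not> (x \<in> U \<longrightarrow> p x = 0)}"
    using ae by (auto simp: eventually_ae_filter negligible_iff_null_sets intro: completion.complete2)
  hence "negligible (U \<inter> {x. p x \<noteq> 0})" by (rule negligible_subset) auto
  thus False using o open_not_negligible x \<open>p x \<noteq> 0\<close> by blast
qed

text \<open>Makes the description in \<open>local_poly\<close> meaningful: two polynomials agreeing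
  almost everywhere on \<open>K\<close> agree on the open interior by continuity, hence
  everywhere.\<close>

lemma local_poly_eqI:
  fixes v :: "'a::euclidean_space \<Rightarrow> real"
  assumes K: "closed K" "interior K \<noteq> {}" and p: "p \<in> poly_space k" "AE x in lebesgue_on K. v x = p x"
  shows "local_poly k v K = p"
  unfolding local_poly_def
proof (rule the_equality)
  fix p' assume p': "p' \<in> poly_space k \<and> (AE x in lebesgue_on K. v x = p' x)"
  have rp: "real_polynomial_function (\<lambda>x. p' x - p x)"
    using p p' poly_space_real_polynomial_function by (intro real_polynomial_function_diff) auto
  have "AE x in lebesgue_on K. p' x - p x = 0"
    using p(2) conjunct2[OF p'] by eventually_elim auto
  hence "AE x in lebesgue. x \<in> K \<longrightarrow> p' x - p x = 0"
    using K by (subst (asm) AE_restrict_space_iff) auto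
  hence "AE x in lebesgue. x \<in> interior K \<longrightarrow> p' x - p x = 0"
    by eventually_elim (use interior_subset in auto)
  hence z: "p' x - p x = 0" if "x \<in> interior K" for x
    using continuous_AE_eq_on_open[OF real_polynomial_function_continuous[OF rp] open_interior _ that] by blast
  obtain x0 where "x0 \<in> interior K" using K by auto
  hence "p' y - p y = 0" for y
    by (rule real_polynomial_function_eq_0[OF rp open_interior]) (rule z)
  thus "p' = p" by (auto simp: fun_eq_iff)
qed (use p in simp)

section \<open>Geometry of the mesh along generic lines\<close>

text \<open>The part \<open>\<tau>\<close> of \<open>n'\<close> orthogonal to \<open>n\<close> is a
  direction inside the smaller hyperplane, hence also inside the larger set, so it is orthogonal to
  \<open>n'\<close> and must be zero.\<close>

lemma hyperplane_unit_normal_unique: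
  fixes n n' :: "'a::euclidean_space"
  assumes n: "norm n = 1" "norm n' = 1" and sub: "{x. n \<bullet> x = b} \<subseteq> {x. n' \<bullet> x = b'}"
  shows "n' = n \<or> n' = - n"
proof -
  have nn: "n \<bullet> n = 1" "n' \<bullet> n' = 1" using n by (simp_all add: norm_eq_1)
  define \<tau> where "\<tau> = n' - (n' \<bullet> n) *\<^sub>R n"
  have t: "n \<bullet> \<tau> = 0" by (simp add: \<tau>_def inner_diff_right nn inner_commute)
  have "b *\<^sub>R n \<in> {x. n \<bullet> x = b}" "b *\<^sub>R n + \<tau> \<in> {x. n \<bullet> x = b}" using t nn by (auto simp: inner_add_right)
  hence "n' \<bullet> (b *\<^sub>R n) = b'" "n' \<bullet> (b *\<^sub>R n + \<tau>) = b'" using sub by blast+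
  hence "n' \<bullet> \<tau> = 0" by (simp add: inner_add_right)
  hence "\<tau> \<bullet> \<tau> = 0" using t by (subst \<tau>_def) (simp add: inner_diff_left)
  hence e: "n' = (n' \<bullet> n) *\<^sub>R n" by (simp add: \<tau>_def)
  have "(n' \<bullet> n)\<^sup>2 = 1"
  proof -
    have "n' \<bullet> n' = (n' \<bullet> n) * (n' \<bullet> n) * (n \<bullet> n)" by (subst (1 2) e) simp
    thus ?thesis by (simp add: nn power2_eq_square)
  qed
  hence "n' \<bullet> n = 1 \<or> n' \<bullet> n = -1" by (simp add: power2_eq_1_iff)
  thus ?thesis using e by (metis scaleR_minus1_left scaleR_one)
qed

text \<open>Makes the description in \<open>outward_normal\<close> meaningful. A facet of a
  polyhedron is exposed, and by dimension its affine hull is the whole supporting hyperplane, so the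
  unit normal is fixed up to sign.\<close>

lemma facet_outward_normal:
  fixes K :: "'a::euclidean_space set"
  assumes K: "polyhedron K" "interior K \<noteq> {}" and F: "F facet_of K"
  obtains b where "norm (outward_normal K F) = 1" "F = K \<inter> {x. outward_normal K F \<bullet> x = b}"
    "K \<subseteq> {x. outward_normal K F \<bullet> x \<le> b}" "affine hull F = {x. outward_normal K F \<bullet> x = b}"
proof -
  have dimK: "aff_dim K = int DIM('a)" using K(2) by (rule aff_dim_nonempty_interior)
  have Ff: "F face_of K" "F \<noteq> {}" "aff_dim F = int DIM('a) - 1" using F dimK by (auto simp: facet_of_def)
  have "F \<noteq> K" using Ff dimK by auto
  hence "\<exists>a b. a \<noteq> 0 \<and> K \<subseteq> {x. a \<bullet> x \<le> b} \<and> F = K \<inter> {x. a \<bullet> x = b}"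
    using exposed_face_of_polyhedron[OF K(1), of F] exposed_face_of[of F K] Ff by auto
  then obtain a b where ab: "a \<noteq> 0" "K \<subseteq> {x. a \<bullet> x \<le> b}" "F = K \<inter> {x. a \<bullet> x = b}" by blast
  define n where "n = (1 / norm a) *\<^sub>R a"
  define c where "c = b / norm a"
  have n1: "norm n = 1" using ab(1) by (simp add: n_def)
  have s1: "K \<subseteq> {x. n \<bullet> x \<le> c}" using ab by (auto simp: n_def c_def divide_simps)
  have s2: "F = K \<inter> {x. n \<bullet> x = c}" using ab by (auto simp: n_def c_def divide_simps)
  have n0: "n \<noteq> 0" using n1 by auto
  have hull: "affine hull F = {x. m \<bullet> x = d}" if m: "norm m = 1" "F \<subseteq> {x. m \<bullet> x = d}" for m :: 'a and d
  proof -
    have m0: "m \<noteq> 0" using m by auto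
    have sub: "affine hull F \<subseteq> affine hull {x. m \<bullet> x = d}" using m(2) by (rule hull_mono)
    have "affine {x. m \<bullet> x = d}" by (rule affine_hyperplane)
    hence eq: "affine hull {x. m \<bullet> x = d} = {x. m \<bullet> x = d}" by (simp add: affine_hull_eq)
    have "aff_dim {x. m \<bullet> x = d} = int (DIM('a) - 1)" using m0 by (rule aff_dim_hyperplane)
    also have "\<dots> = aff_dim F" using Ff DIM_positive[where 'a='a] by (simp add: of_nat_diff Suc_leI)
    finally have "\<not> affine hull F \<subset> affine hull {x. m \<bullet> x = d}" using aff_dim_psubset[of F "{x. m \<bullet> x = d}"] by auto
    thus ?thesis using sub eq by auto
  qed
  have hn: "affine hull F = {x. n \<bullet> x = c}" by (rule hull[OF n1]) (use s2 in auto)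
  have "outward_normal K F = n"
    unfolding outward_normal_def
  proof (rule the_equality)
    show "norm n = 1 \<and> (\<exists>b. F = K \<inter> {x. n \<bullet> x = b} \<and> K \<subseteq> {x. n \<bullet> x \<le> b})" using n1 s1 s2 by blast
    fix m assume "norm m = 1 \<and> (\<exists>b. F = K \<inter> {x. m \<bullet> x = b} \<and> K \<subseteq> {x. m \<bullet> x \<le> b})"
    then obtain d where m: "norm m = 1" "F = K \<inter> {x. m \<bullet> x = d}" "K \<subseteq> {x. m \<bullet> x \<le> d}" by blast
    have "affine hull F = {x. m \<bullet> x = d}" by (rule hull[OF m(1)]) (use m(2) in auto)
    hence "m = n \<or> m = - n" using hyperplane_unit_normal_unique[OF n1 m(1), of c d] hn by auto
    \<comment> \<open>If both signs were outward, \<open>K\<close> would lie in the hyperplane,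
      against its full dimension.\<close>
    moreover have False if mn: "m = - n"
    proof -
      obtain f where f: "f \<in> F" using Ff by auto
      hence "- (n \<bullet> f) = d" "n \<bullet> f = c" using m(2) s2 mn by auto
      hence dc: "d = - c" by simp
      have "K \<subseteq> {x. n \<bullet> x = c}"
      proof
        fix x assume "x \<in> K"
        hence "n \<bullet> x \<le> c" "- (n \<bullet> x) \<le> - c" using s1 m(3) mn dc by auto
        thus "x \<in> {x. n \<bullet> x = c}" by simp
      qed
      hence "aff_dim K \<le> aff_dim {x. n \<bullet> x = c}" by (rule aff_dim_subset)
      also have "\<dots> = int (DIM('a) - 1)" using n0 by (rule aff_dim_hyperplane)
      finally show False using dimK DIM_positive[where 'a='a] by linarith
    qed
    ultimately show "m = n" by blast
  qed
  thus ?thesis using that n1 s1 s2 hn by blast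
qed

text \<open>Near a relative interior point \<open>y\<close> of the common facet, a short step from \<open>y\<close> towards \<open>w\<close> is a
  convex combination of \<open>w'\<close> and a point of the facet.\<close>
lemma same_side_interior_meet:
  fixes K K' :: "'a::euclidean_space set"
  assumes cv: "convex K" "convex K'" and F: "F \<subseteq> K" "F \<subseteq> K'" and y: "y \<in> rel_interior F"
    and hull: "affine hull F = {x. n \<bullet> x = b}"
    and w: "w \<in> interior K" "n \<bullet> w < b" and w': "w' \<in> interior K'" "n \<bullet> w' < b"
  shows "interior K \<inter> interior K' \<noteq> {}"
proof -
  have yF: "y \<in> F" using y rel_interior_subset by blast
  hence ny: "n \<bullet> y = b" using hull hull_subset[of F affine] by auto
  obtain r where r: "r > 0" "ball y r \<inter> affine hull F \<subseteq> F" using y mem_rel_interior_ball by blast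
  \<comment> \<open>The ratio of the depths of \<open>w\<close> and \<open>w'\<close> below the
    hyperplane, chosen so that the difference \<open>\<tau>\<close> is parallel to it.\<close>
  define \<alpha> where "\<alpha> = (b - n \<bullet> w) / (b - n \<bullet> w')"
  have a: "\<alpha> > 0" using w w' by (simp add: \<alpha>_def)
  define \<tau> where "\<tau> = (w - y) - \<alpha> *\<^sub>R (w' - y)"
  have t: "n \<bullet> \<tau> = 0" using w' by (simp add: \<tau>_def \<alpha>_def inner_diff_right ny divide_simps) (simp add: algebra_simps)
  \<comment> \<open>Three demands on the step: it is at most 1, the weight
    \<open>e * \<alpha>\<close> of \<open>w'\<close> is at most 1/2, and the tangential correction
    \<open>(e / c) *\<^sub>R \<tau>\<close> is shorter than \<open>r\<close>, even after division by
    \<open>c \<ge> 1/2\<close>.\<close>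
  define e where "e = min 1 (min (1 / (2 * \<alpha>)) (r / (2 * (norm \<tau> + 1))))"
  have np: "norm \<tau> + 1 > 0" by (simp add: add_nonneg_pos)
  have e: "0 < e" "e \<le> 1" using a r np by (auto simp: e_def)
  have ea: "e * \<alpha> \<le> 1/2"
  proof -
    have "e \<le> 1 / (2 * \<alpha>)" by (simp add: e_def)
    hence "e * \<alpha> \<le> 1 / (2 * \<alpha>) * \<alpha>" using a by (intro mult_right_mono) auto
    thus ?thesis using a by simp
  qed
  have et: "e * norm \<tau> < r / 2"
  proof -
    have "e \<le> r / (2 * (norm \<tau> + 1))" by (simp add: e_def)
    hence "e * (norm \<tau> + 1) \<le> r / (2 * (norm \<tau> + 1)) * (norm \<tau> + 1)" using np by (intro mult_right_mono) auto
    moreover have "r / (2 * (norm \<tau> + 1)) * (norm \<tau> + 1) = r / 2" using np by (simp add: divide_simps)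
    ultimately have "e * (norm \<tau> + 1) \<le> r / 2" by linarith
    thus ?thesis using e(1) by (simp add: distrib_left)
  qed
  define P where "P = y - e *\<^sub>R (y - w)"
  have P1: "P \<in> interior K" unfolding P_def
    using cv(1) w(1) yF F e by (intro mem_interior_convex_shrink) auto
  define c where "c = 1 - e * \<alpha>"
  have c: "c \<ge> 1/2" using ea by (simp add: c_def)
  define y' where "y' = y + (e / c) *\<^sub>R \<tau>"
  have "y' \<in> affine hull F" unfolding hull y'_def using ny t by (simp add: inner_add_right)
  moreover have "y' \<in> ball y r"
  proof -
    have "norm ((e / c) *\<^sub>R \<tau>) = (e * norm \<tau>) / c" using e c by simp
    also have "\<dots> \<le> (e * norm \<tau>) / (1/2)" using c e by (intro divide_left_mono) auto
    also have "\<dots> < r" using et by simp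
    finally show ?thesis by (simp add: y'_def dist_norm)
  qed
  ultimately have y': "y' \<in> K'" using r F by blast
  have cy: "c *\<^sub>R y' = c *\<^sub>R y + e *\<^sub>R \<tau>" using c by (simp add: y'_def algebra_simps)
  have "y' - (e * \<alpha>) *\<^sub>R (y' - w') = c *\<^sub>R y' + (e * \<alpha>) *\<^sub>R w'" by (simp add: c_def algebra_simps)
  also have "\<dots> = P" unfolding cy by (simp add: c_def P_def \<tau>_def algebra_simps)
  finally have "P = y' - (e * \<alpha>) *\<^sub>R (y' - w')" by simp
  moreover have "y' - (e * \<alpha>) *\<^sub>R (y' - w') \<in> interior K'"
    using cv(2) w'(1) y' e a ea by (intro mem_interior_convex_shrink) auto
  ultimately show ?thesis using P1 by auto
qed

section \<open>Consequences of conformity: elements sharing a facet\<close>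

locale mesh_on_domain =
  fixes \<Omega> :: "'a::euclidean_space set" and \<T> :: "'a set set"
  assumes domain: "convex_polyhedral_domain \<Omega>" and mesh: "simplicial_mesh \<Omega> \<T>"
begin

lemma open_domain: "open \<Omega>" and convex_domain: "convex \<Omega>" and bounded_domain: "bounded \<Omega>" and nonempty_domain: "\<Omega> \<noteq> {}"
  using domain by (auto simp: convex_polyhedral_domain_def)

lemma finite_mesh: "finite \<T>" and union_mesh: "\<Union>\<T> = closure \<Omega>"
  using mesh by (auto simp: simplicial_mesh_def triangulation_def)

lemma element_polytope: "K \<in> \<T> \<Longrightarrow> polytope K"
  using mesh by (auto simp: simplicial_mesh_def intro: simplex_imp_polytope)

lemma element_polyhedron: "K \<in> \<T> \<Longrightarrow> polyhedron K"
  using element_polytope polytope_imp_polyhedron by blast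

lemma element_convex: "K \<in> \<T> \<Longrightarrow> convex K"
  using element_polytope polytope_imp_convex by blast

lemma element_compact: "K \<in> \<T> \<Longrightarrow> compact K"
  using element_polytope polytope_imp_compact by blast

lemma element_closed: "K \<in> \<T> \<Longrightarrow> closed K"
  using element_compact compact_imp_closed by blast

lemma element_aff_dim: "K \<in> \<T> \<Longrightarrow> aff_dim K = int DIM('a)"
  using mesh by (auto simp: simplicial_mesh_def intro: aff_dim_simplex)

lemma element_rel_interior: "K \<in> \<T> \<Longrightarrow> rel_interior K = interior K"
  using element_aff_dim aff_dim_eq_full rel_interior_interior by metis

lemma element_interior_nonempty: assumes "K \<in> \<T>" shows "interior K \<noteq> {}"
proof -
  have "K \<noteq> {}" using element_aff_dim[OF assms] by (auto simp: aff_dim_empty)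
  thus ?thesis using element_rel_interior[OF assms] rel_interior_eq_empty element_convex[OF assms] by blast
qed

lemma element_Int_face: "K \<in> \<T> \<Longrightarrow> K' \<in> \<T> \<Longrightarrow> K \<inter> K' face_of K"
  using mesh by (auto simp: simplicial_mesh_def triangulation_def)

text \<open>An open convex set is the interior of its closure.\<close>

lemma element_interior_subset_domain: "K \<in> \<T> \<Longrightarrow> interior K \<subseteq> \<Omega>"
  using union_mesh convex_interior_closure[OF convex_domain] open_domain
  by (metis Union_upper interior_mono interior_open)

text \<open>Conformity makes the intersection a face of both elements. A face of \<open>K\<close>
  through an interior point is all of \<open>K\<close>, and a full-dimensional face of
  \<open>K'\<close> is all of \<open>K'\<close>.\<close>

lemma element_interior_disjoint:
  assumes K: "K \<in> \<T>" "K' \<in> \<T>" and y: "y \<in> interior K" "y \<in> K'"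
  shows "K = K'"
proof -
  have "K \<inter> K' = K"
    using face_of_disjoint_interior[OF element_Int_face[OF K]] y interior_subset by blast
  hence f: "K face_of K'" using element_Int_face[OF K(2,1)] by (simp add: Int_commute)
  show ?thesis
    using face_of_aff_dim_lt[OF element_convex[OF K(2)] f] element_aff_dim K by fastforce
qed

lemma element_facet_normal:
  assumes "K \<in> \<T>" "F facet_of K"
  obtains b where "norm (outward_normal K F) = 1" "F = K \<inter> {x. outward_normal K F \<bullet> x = b}"
    "K \<subseteq> {x. outward_normal K F \<bullet> x \<le> b}" "affine hull F = {x. outward_normal K F \<bullet> x = b}"
  using facet_outward_normal[OF element_polyhedron[OF assms(1)] element_interior_nonempty[OF assms(1)] assms(2)] .

text \<open>Equal outward normals put both interiors strictly on the same side of the hyperplane of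
  the facet, where they are forced to intersect.\<close>

lemma facet_same_normal:
  assumes K: "K \<in> \<T>" "K' \<in> \<T>" and F: "F facet_of K" "F facet_of K'"
    and n: "outward_normal K F = outward_normal K' F"
  shows "K = K'"
proof -
  let ?n = "outward_normal K F"
  obtain b where b: "norm ?n = 1" "F = K \<inter> {x. ?n \<bullet> x = b}" "K \<subseteq> {x. ?n \<bullet> x \<le> b}" "affine hull F = {x. ?n \<bullet> x = b}"
    using element_facet_normal[OF K(1) F(1)] by metis
  obtain b' where b': "F = K' \<inter> {x. ?n \<bullet> x = b'}" "K' \<subseteq> {x. ?n \<bullet> x \<le> b'}"
    using element_facet_normal[OF K(2) F(2)] n by metis
  have Fne: "F \<noteq> {}" using F by (auto simp: facet_of_def)
  then obtain f where "f \<in> F" by blast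
  hence "?n \<bullet> f = b" "?n \<bullet> f = b'" using b(2) b'(1) by blast+
  hence bb: "b' = b" by simp
  have Ff: "F face_of K" "F face_of K'" using F by (auto simp: facet_of_def)
  have cF: "convex F" using Ff face_of_imp_convex by blast
  then obtain y where y: "y \<in> rel_interior F" using Fne rel_interior_eq_empty by blast
  obtain w where "w \<in> interior K" using element_interior_nonempty[OF K(1)] by blast
  moreover obtain w' where "w' \<in> interior K'" using element_interior_nonempty[OF K(2)] by blast
  ultimately have w: "w \<in> interior K" "w' \<in> interior K'" .
  have "F \<noteq> K" "F \<noteq> K'" using F by auto
  hence "w \<notin> F" "w' \<notin> F" using face_of_disjoint_interior Ff w by blast+
  moreover have "w \<in> K" "w' \<in> K'" using w interior_subset by blast+
  ultimately have "?n \<bullet> w < b" "?n \<bullet> w' < b"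
    using b(2,3) b' bb by (auto simp: less_le)
  hence "interior K \<inter> interior K' \<noteq> {}"
    using same_side_interior_meet[OF element_convex[OF K(1)] element_convex[OF K(2)] _ _ y b(4) w(1) _ w(2)]
      face_of_imp_subset Ff by blast
  thus ?thesis using element_interior_disjoint[OF K] interior_subset by blast
qed

lemma facet_opposite_normal:
  assumes K: "K \<in> \<T>" "K' \<in> \<T>" "K \<noteq> K'" and F: "F facet_of K" "F facet_of K'"
  shows "outward_normal K' F = - outward_normal K F"
proof -
  obtain b where b: "norm (outward_normal K F) = 1" "affine hull F = {x. outward_normal K F \<bullet> x = b}"
    using element_facet_normal[OF K(1) F(1)] by metis
  obtain b' where b': "norm (outward_normal K' F) = 1" "affine hull F = {x. outward_normal K' F \<bullet> x = b'}"
    using element_facet_normal[OF K(2) F(2)] by metis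
  have "outward_normal K' F = outward_normal K F \<or> outward_normal K' F = - outward_normal K F"
    using hyperplane_unit_normal_unique[OF b(1) b'(1), of b b'] b(2) b'(2) by auto
  thus ?thesis using facet_same_normal[OF K(1,2) F] K(3) by auto
qed

text \<open>A hyperplane has only two unit normals, so among three elements sharing a facet two
  would have the same outward normal. Consequently \<open>jump\<close> has exactly two summands at
  such a facet.\<close>

lemma elements_at_facet:
  assumes K: "K \<in> \<T>" "K' \<in> \<T>" "K \<noteq> K'" and F: "F facet_of K" "F facet_of K'"
  shows "{L \<in> \<T>. F facet_of L} = {K, K'}"
proof -
  have "L = K \<or> L = K'" if L: "L \<in> \<T>" "F facet_of L" for L
  proof (rule ccontr)
    assume "\<not> ?thesis"
    hence "outward_normal L F = - outward_normal K F" "outward_normal L F = - outward_normal K' F"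
      using facet_opposite_normal[of K L] facet_opposite_normal[of K' L] K F L by auto
    hence "outward_normal K F = outward_normal K' F" by simp
    thus False using facet_same_normal K F by blast
  qed
  thus ?thesis using K F by blast
qed

text \<open>A face of \<open>M\<close> through a relative interior point of \<open>A\<close>
  contains \<open>A\<close>. The intersection is a proper face, of dimension at most d - 1, and
  cannot exceed the facet.\<close>

lemma facet_eq_Int:
  assumes M: "M \<in> \<T>" "M' \<in> \<T>" "M \<noteq> M'" and A: "A facet_of M" and y: "y \<in> rel_interior A" "y \<in> M'"
  shows "A = M \<inter> M'"
proof -
  have Ff: "A face_of M" "aff_dim A = int DIM('a) - 1" using A element_aff_dim M by (auto simp: facet_of_def)
  have "y \<in> M" using y(1) rel_interior_subset face_of_imp_subset[OF Ff(1)] by blast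
  hence sub: "A \<subseteq> M \<inter> M'"
    using subset_of_face_of[OF element_Int_face[OF M(1,2)] face_of_imp_subset[OF Ff(1)]] y by blast
  have "A face_of M \<inter> M'" using face_of_subset[OF Ff(1) sub] by blast
  moreover have "aff_dim (M \<inter> M') < int DIM('a)"
  proof -
    have "M \<inter> M' \<noteq> M"
      using element_interior_disjoint[OF M(1,2)] M(3) element_interior_nonempty[OF M(1)] interior_subset by blast
    thus ?thesis
      using face_of_aff_dim_lt[OF element_convex[OF M(1)] element_Int_face[OF M(1,2)]] element_aff_dim M by auto
  qed
  moreover have "convex (M \<inter> M')" using element_convex M by (blast intro: convex_Int)
  ultimately show ?thesis using face_of_aff_dim_lt[of "M \<inter> M'" A] Ff(2) by fastforce
qed

text \<open>\<open>interior_faces\<close> asks for equality with the intersection of the two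
  frontiers. That set is contained in \<open>K \<inter> K'\<close>, which is the facet
  itself.\<close>

lemma common_facet_interior_face:
  assumes K: "K \<in> \<T>" "K' \<in> \<T>" "K \<noteq> K'" and F: "F facet_of K" "F facet_of K'"
  shows "F \<in> interior_faces \<T>"
proof -
  have Ff: "F face_of K" "F face_of K'" "F \<noteq> {}" using F by (auto simp: facet_of_def)
  obtain y where y: "y \<in> rel_interior F" using Ff rel_interior_eq_empty face_of_imp_convex by blast
  have sub: "F \<subseteq> K \<inter> K'" using Ff face_of_imp_subset by blast
  have e: "F = K \<inter> K'"
    by (rule facet_eq_Int[OF K F(1) y]) (use y rel_interior_subset sub in blast)
  have ne: "F \<noteq> K" "F \<noteq> K'" using F by auto
  have "F \<inter> interior K = {}" "F \<inter> interior K' = {}"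
    using face_of_disjoint_interior Ff ne by blast+
  hence "F \<subseteq> frontier K" "F \<subseteq> frontier K'" using sub closure_subset unfolding frontier_def by blast+
  moreover have "frontier K \<inter> frontier K' \<subseteq> K \<inter> K'" using element_closed K frontier_subset_closed by blast
  ultimately have "F = frontier K \<inter> frontier K'" using e by blast
  thus "F \<in> interior_faces \<T>" unfolding interior_faces_def using K F by blast
qed

section \<open>Lines in general position and their crossings with the mesh\<close>

definition generic_point :: "'a \<Rightarrow> bool" where
  "generic_point q \<longleftrightarrow> (\<forall>K\<in>\<T>. \<forall>G. G face_of K \<and> aff_dim G < int DIM('a) \<longrightarrow> q \<notin> affine hull G)"

text \<open>The two exclusions have different purposes. A pole off the affine hulls of all proper
  faces prevents a line through it from lying in the plane of a facet; avoiding faces of codimension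
  two or more forces every crossing into the relative interior of a facet.\<close>

definition generic_line :: "'a \<Rightarrow> 'a \<Rightarrow> bool" where
  "generic_line q e \<longleftrightarrow> generic_point q \<and> e \<noteq> 0 \<and>
     (\<forall>K\<in>\<T>. \<forall>G. G face_of K \<and> aff_dim G < int DIM('a) - 1 \<longrightarrow> (\<forall>t. q + t *\<^sub>R e \<notin> G))"

definition breaks :: "'a \<Rightarrow> 'a \<Rightarrow> real set" where
  "breaks q e = {t. \<exists>K\<in>\<T>. q + t *\<^sub>R e \<in> frontier K}"

lemma generic_line_uminus: "generic_line q e \<Longrightarrow> generic_line q (- e)"
  unfolding generic_line_def by (metis neg_equal_0_iff_equal scaleR_minus_left scaleR_minus_right)

text \<open>The relative boundary of a facet is made of faces of codimension two, which a generic
  line avoids.\<close>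

lemma frontier_element_imp_facet:
  assumes g: "generic_line q e" and K: "K \<in> \<T>" and f: "q + t *\<^sub>R e \<in> frontier K"
  obtains F where "F facet_of K" "q + t *\<^sub>R e \<in> rel_interior F"
proof -
  have "frontier K = rel_frontier K"
    using element_rel_interior[OF K] by (simp add: frontier_def rel_frontier_def)
  then obtain F where F: "F facet_of K" "q + t *\<^sub>R e \<in> F"
    using f rel_frontier_of_polyhedron[OF element_polyhedron[OF K]] by auto
  have Ff: "F face_of K" "aff_dim F = int DIM('a) - 1" using F element_aff_dim K by (auto simp: facet_of_def)
  have pF: "polyhedron F" using face_of_polyhedron_polyhedron[OF element_polyhedron[OF K] Ff(1)] .
  have "q + t *\<^sub>R e \<in> rel_interior F"
  proof (rule ccontr)
    assume "q + t *\<^sub>R e \<notin> rel_interior F"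
    hence "q + t *\<^sub>R e \<in> rel_frontier F" using F(2) closure_subset unfolding rel_frontier_def by blast
    then obtain G where G: "G facet_of F" "q + t *\<^sub>R e \<in> G"
      using rel_frontier_of_polyhedron[OF pF] by auto
    hence "G face_of K" "aff_dim G < int DIM('a) - 1" using Ff face_of_trans by (auto simp: facet_of_def)
    thus False using g K G(2) by (auto simp: generic_line_def)
  qed
  thus ?thesis using that F by blast
qed

text \<open>A line that meets \<open>F\<close> and is parallel to its plane stays in that plane,
  pole included, against the choice of the pole.\<close>

lemma generic_line_transversal:
  assumes g: "generic_line q e" and K: "K \<in> \<T>" and F: "F facet_of K" "q + t *\<^sub>R e \<in> F"
  shows "outward_normal K F \<bullet> e \<noteq> 0"
proof
  assume 0: "outward_normal K F \<bullet> e = 0"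
  obtain b where b: "F = K \<inter> {x. outward_normal K F \<bullet> x = b}" "affine hull F = {x. outward_normal K F \<bullet> x = b}"
    using element_facet_normal[OF K F(1)] by metis
  have "outward_normal K F \<bullet> (q + t *\<^sub>R e) = b" using b F(2) by blast
  hence "q \<in> affine hull F" unfolding b(2) using 0 by (simp add: inner_add_right)
  moreover have "F face_of K" "aff_dim F < int DIM('a)" using F element_aff_dim K by (auto simp: facet_of_def)
  ultimately show False using g K by (auto simp: generic_line_def generic_point_def)
qed

text \<open>At a boundary point strictly between, the linear form defining a facet would attain its
  maximum over the segment at an inner parameter. It would then be constant along the line,
  contradicting transversality.\<close>

lemma generic_line_between_interior:
  assumes g: "generic_line q e" and K: "K \<in> \<T>" and t: "t1 < t" "t < t2"
    and y: "q + t1 *\<^sub>R e \<in> K" "q + t2 *\<^sub>R e \<in> K"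
  shows "q + t *\<^sub>R e \<in> interior K"
proof (rule ccontr)
  assume n: "\<not> ?thesis"
  define u where "u = (t - t1) / (t2 - t1)"
  have u: "0 \<le> u" "u \<le> 1" using t by (auto simp: u_def divide_simps)
  have "u * (t2 - t1) = t - t1" using t by (simp add: u_def)
  hence tu: "t = (1 - u) * t1 + u * t2" by (simp add: algebra_simps)
  have "q + t *\<^sub>R e = (1 - u) *\<^sub>R (q + t1 *\<^sub>R e) + u *\<^sub>R (q + t2 *\<^sub>R e)"
    unfolding tu by (simp add: algebra_simps)
  hence "q + t *\<^sub>R e \<in> K" using element_convex[OF K] y u by (simp add: convex_alt)
  hence fr: "q + t *\<^sub>R e \<in> frontier K" using n closure_subset by (auto simp: frontier_def)
  obtain F where F: "F facet_of K" "q + t *\<^sub>R e \<in> rel_interior F"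
    using frontier_element_imp_facet[OF g K fr] .
  have F2: "q + t *\<^sub>R e \<in> F" using F rel_interior_subset by blast
  obtain b where b: "F = K \<inter> {x. outward_normal K F \<bullet> x = b}" "K \<subseteq> {x. outward_normal K F \<bullet> x \<le> b}"
    using element_facet_normal[OF K F(1)] by metis
  let ?n = "outward_normal K F"
  have 1: "?n \<bullet> q + t1 * (?n \<bullet> e) \<le> b" "?n \<bullet> q + t2 * (?n \<bullet> e) \<le> b"
    using y b(2) by (auto simp: inner_add_right)
  have "?n \<bullet> (q + t *\<^sub>R e) = b" using F2 b by blast
  hence 2: "?n \<bullet> q + t * (?n \<bullet> e) = b" by (simp add: inner_add_right)
  have "(t - t1) * (?n \<bullet> e) \<ge> 0" "(t2 - t) * (?n \<bullet> e) \<le> 0" using 1 2 by (simp_all add: algebra_simps)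
  hence "?n \<bullet> e = 0" using t by (simp add: zero_le_mult_iff mult_le_0_iff)
  thus False using generic_line_transversal[OF g K F(1) F2] by simp
qed

text \<open>Even at a break the line runs through a single interior for a while afterwards; this
  makes the one-sided limits of all elementwise derivatives computable.\<close>

lemma generic_line_right_element:
  assumes g: "generic_line q e" and y: "\<forall>\<^sub>F t in at_right s. q + t *\<^sub>R e \<in> \<Omega>"
  obtains K \<delta> where "K \<in> \<T>" "\<delta> > 0" "q + s *\<^sub>R e \<in> K" "\<And>t. s < t \<Longrightarrow> t < s + \<delta> \<Longrightarrow> q + t *\<^sub>R e \<in> interior K"
proof -
  have lim: "((\<lambda>t. q + t *\<^sub>R e) \<longlongrightarrow> q + s *\<^sub>R e) (at_right s)" by (intro tendsto_intros)
  have "\<forall>\<^sub>F t in at_right s. \<exists>K\<in>\<T>. q + t *\<^sub>R e \<in> K"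
    using y by eventually_elim (use union_mesh closure_subset in blast)
  hence "\<exists>\<^sub>F t in at_right s. \<exists>K\<in>\<T>. q + t *\<^sub>R e \<in> K"
    using eventually_frequently trivial_limit_at_right_real by blast
  \<comment> \<open>Finitely many elements cover the parameters approaching \<open>s\<close> from
    the right, so one of them is met arbitrarily close to \<open>s\<close>. Closedness then adds
    \<open>s\<close> itself, and convexity fills the gap.\<close>
  then obtain K where K: "K \<in> \<T>" "\<exists>\<^sub>F t in at_right s. q + t *\<^sub>R e \<in> K"
    using frequently_bex_finite[OF finite_mesh, where P = "\<lambda>t K. q + t *\<^sub>R e \<in> K"] by blast
  have sK: "q + s *\<^sub>R e \<in> K"
  proof (rule ccontr)
    assume "\<not> ?thesis"
    hence "\<forall>\<^sub>F t in at_right s. q + t *\<^sub>R e \<in> - K"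
      using topological_tendstoD[OF lim, of "- K"] element_closed[OF K(1)] by (simp add: open_Compl)
    hence "\<forall>\<^sub>F t in at_right s. \<not> q + t *\<^sub>R e \<in> K" by eventually_elim auto
    thus False using K(2) by (simp add: frequently_def)
  qed
  obtain t1 where t1: "s < t1" "q + t1 *\<^sub>R e \<in> K"
  proof -
    have "\<forall>\<^sub>F t in at_right s. s < t" by (simp add: eventually_at_filter)
    hence "\<exists>\<^sub>F t in at_right s. q + t *\<^sub>R e \<in> K \<and> s < t"
      by (intro frequently_rev_mp[OF K(2)]) (auto elim!: eventually_mono)
    thus ?thesis using that frequently_ex by blast
  qed
  show ?thesis
    by (rule that[of K "t1 - s"]) (use K sK t1 generic_line_between_interior[OF g K(1) _ _ sK t1(2)] in auto)
qed

lemma generic_line_left_element: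
  assumes g: "generic_line q e" and y: "\<forall>\<^sub>F t in at_left s. q + t *\<^sub>R e \<in> \<Omega>"
  obtains K \<delta> where "K \<in> \<T>" "\<delta> > 0" "q + s *\<^sub>R e \<in> K" "\<And>t. s - \<delta> < t \<Longrightarrow> t < s \<Longrightarrow> q + t *\<^sub>R e \<in> interior K"
proof -
  have y': "\<forall>\<^sub>F t in at_right (- s). q + t *\<^sub>R (- e) \<in> \<Omega>"
    using y unfolding at_left_minus[of s] eventually_filtermap by simp
  obtain K \<delta> where K: "K \<in> \<T>" "\<delta> > 0" "q + (- s) *\<^sub>R (- e) \<in> K" "\<And>t. - s < t \<Longrightarrow> t < - s + \<delta> \<Longrightarrow> q + t *\<^sub>R (- e) \<in> interior K"
    by (rule generic_line_right_element[OF generic_line_uminus[OF g] y']) blast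
  have "q + t *\<^sub>R e \<in> interior K" if "s - \<delta> < t" "t < s" for t using K(4)[of "- t"] that by simp
  thus ?thesis using that[of K \<delta>] K(1-3) by simp
qed

lemma generic_line_crossing:
  assumes g: "generic_line q e" and y: "q + s *\<^sub>R e \<in> \<Omega>" and s: "s \<in> breaks q e"
  obtains K K' F \<delta> where "K \<in> \<T>" "K' \<in> \<T>" "K \<noteq> K'" "F facet_of K" "F facet_of K'" "q + s *\<^sub>R e \<in> rel_interior F"
    "\<delta> > 0" "\<And>t. s - \<delta> < t \<Longrightarrow> t < s \<Longrightarrow> q + t *\<^sub>R e \<in> interior K" "\<And>t. s < t \<Longrightarrow> t < s + \<delta> \<Longrightarrow> q + t *\<^sub>R e \<in> interior K'"
proof -
  have lim: "((\<lambda>t. q + t *\<^sub>R e) \<longlongrightarrow> q + s *\<^sub>R e) (at s within A)" for A by (intro tendsto_intros)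
  note y1 = topological_tendstoD[OF lim open_domain y]
  obtain K \<delta> where K: "K \<in> \<T>" "\<delta> > 0" "q + s *\<^sub>R e \<in> K" "\<And>t. s - \<delta> < t \<Longrightarrow> t < s \<Longrightarrow> q + t *\<^sub>R e \<in> interior K"
    by (rule generic_line_left_element[OF g y1]) blast
  obtain K' \<delta>' where K': "K' \<in> \<T>" "\<delta>' > 0" "q + s *\<^sub>R e \<in> K'" "\<And>t. s < t \<Longrightarrow> t < s + \<delta>' \<Longrightarrow> q + t *\<^sub>R e \<in> interior K'"
    by (rule generic_line_right_element[OF g y1]) blast
  obtain L where L: "L \<in> \<T>" "q + s *\<^sub>R e \<in> frontier L" using s by (auto simp: breaks_def)
  have LL: "q + s *\<^sub>R e \<in> L" "q + s *\<^sub>R e \<notin> interior L"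
    using L element_closed[OF L(1)] frontier_subset_closed by (auto simp: frontier_def)
  \<comment> \<open>With a single element on both sides the point would be interior to it, whereas
    the break puts the point on the frontier of some \<open>L\<close>.\<close>
  have ne: "K \<noteq> K'"
  proof
    assume e: "K = K'"
    have "q + s *\<^sub>R e \<in> interior K"
      using generic_line_between_interior[OF g K(1), of "s - \<delta>/2" s "s + \<delta>'/2"] K(4)[of "s - \<delta>/2"] K'(4)[of "s + \<delta>'/2"] K(2) K'(2) e interior_subset[of K]
      by auto
    thus False using element_interior_disjoint[OF K(1) L(1) _ LL(1)] LL(2) by blast
  qed
  have "q + s *\<^sub>R e \<notin> interior K" "q + s *\<^sub>R e \<notin> interior K'"
    using element_interior_disjoint K K' ne by blast+
  hence fr: "q + s *\<^sub>R e \<in> frontier K" "q + s *\<^sub>R e \<in> frontier K'"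
    using K(3) K'(3) closure_subset by (auto simp: frontier_def)
  obtain F where F: "F facet_of K" "q + s *\<^sub>R e \<in> rel_interior F"
    using frontier_element_imp_facet[OF g K(1) fr(1)] .
  obtain F' where F': "F' facet_of K'" "q + s *\<^sub>R e \<in> rel_interior F'"
    using frontier_element_imp_facet[OF g K'(1) fr(2)] .
  \<comment> \<open>Each of the two facets contains the point in its relative interior and therefore
    equals the intersection of the two elements.\<close>
  have "F = K \<inter> K'" by (rule facet_eq_Int) (use K K' ne F in auto)
  moreover have "F' = K' \<inter> K" by (rule facet_eq_Int) (use K K' ne F' in auto)
  ultimately have FF: "F' = F" by blast
  show ?thesis
    by (rule that[of K K' F "min \<delta> \<delta>'"]) (use K K' ne F F' FF in auto)
qed

text \<open>The face \<open>K \<inter> M\<close> contains a relative interior point of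
  \<open>F\<close>, hence all of \<open>F\<close>. This identifies the elements met at a crossing
  with the two that share a given facet.\<close>

lemma facet_of_touching_element:
  assumes K: "K \<in> \<T>" "M \<in> \<T>" and F: "F facet_of K" and y: "y \<in> rel_interior F" "y \<in> M"
  shows "F facet_of M"
proof -
  have Ff: "F face_of K" "F \<noteq> {}" "aff_dim F = int DIM('a) - 1" using F element_aff_dim K by (auto simp: facet_of_def)
  have "y \<in> K" using y(1) rel_interior_subset face_of_imp_subset[OF Ff(1)] by blast
  hence sub: "F \<subseteq> K \<inter> M"
    using subset_of_face_of[OF element_Int_face[OF K] face_of_imp_subset[OF Ff(1)]] y by blast
  have "F face_of K \<inter> M" using face_of_subset[OF Ff(1) sub] by blast
  moreover have "K \<inter> M face_of M" using element_Int_face[OF K(2,1)] by (simp add: Int_commute)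
  ultimately have "F face_of M" by (rule face_of_trans)
  thus ?thesis using Ff element_aff_dim K by (simp add: facet_of_def)
qed

lemma generic_point_not_frontier:
  assumes "generic_point q" "K \<in> \<T>" shows "q \<notin> frontier K"
proof
  assume "q \<in> frontier K"
  moreover have "frontier K = rel_frontier K"
    using element_rel_interior[OF assms(2)] by (simp add: frontier_def rel_frontier_def)
  ultimately obtain F where F: "F facet_of K" "q \<in> F"
    using rel_frontier_of_polyhedron[OF element_polyhedron[OF assms(2)]] by auto
  have "F face_of K" "aff_dim F < int DIM('a)" using F element_aff_dim assms by (auto simp: facet_of_def)
  thus False using assms F(2) hull_inc[of q F] by (auto simp: generic_point_def)
qed

lemma not_break_imp_interior:
  assumes "q + t *\<^sub>R e \<in> \<Omega>" "t \<notin> breaks q e"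
  obtains K where "K \<in> \<T>" "q + t *\<^sub>R e \<in> interior K"
proof -
  obtain K where K: "K \<in> \<T>" "q + t *\<^sub>R e \<in> K" using assms(1) union_mesh closure_subset by blast
  moreover have "q + t *\<^sub>R e \<notin> frontier K" using assms(2) K by (auto simp: breaks_def)
  ultimately show ?thesis using that closure_subset by (auto simp: frontier_def)
qed

text \<open>Of three frontier parameters the middle one would be interior. Finiteness follows from
  the same count, since an infinite set has a subset of three elements.\<close>

lemma card_frontier_line:
  assumes g: "generic_line q e" and K: "K \<in> \<T>"
  shows "finite {t. q + t *\<^sub>R e \<in> frontier K}" "card {t. q + t *\<^sub>R e \<in> frontier K} \<le> 2"
proof -
  let ?A = "{t. q + t *\<^sub>R e \<in> frontier K}"
  have no3: False if "t1 \<in> ?A" "t \<in> ?A" "t2 \<in> ?A" "t1 < t" "t < t2" for t1 t t2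
    using generic_line_between_interior[OF g K that(4,5)] that(1-3) frontier_subset_closed[OF element_closed[OF K]]
    by (auto simp: frontier_def)
  have c: "card B \<le> 2" if B: "finite B" "B \<subseteq> ?A" for B
  proof (rule ccontr)
    assume "\<not> card B \<le> 2"
    hence c3: "card B \<ge> 3" by simp
    hence ne: "B \<noteq> {}" by auto
    have "card (B - {Min B, Max B}) \<ge> card B - card {Min B, Max B}" by (rule diff_card_le_card_Diff) auto
    moreover have "card {Min B, Max B} \<le> 2" by (simp add: card_insert_if)
    ultimately have "card (B - {Min B, Max B}) > 0" using c3 by linarith
    then obtain t where t: "t \<in> B" "t \<noteq> Min B" "t \<noteq> Max B" by (auto simp: card_gt_0_iff)
    have "Min B < t" "t < Max B" using t Min_le[OF B(1) t(1)] Max_ge[OF B(1) t(1)] by auto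
    thus False using no3[of "Min B" t "Max B"] t B Min_in[OF B(1) ne] Max_in[OF B(1) ne] by blast
  qed
  show f: "finite ?A"
  proof (rule ccontr)
    assume "infinite ?A"
    then obtain B where "B \<subseteq> ?A" "card B = 3" "finite B" using infinite_arbitrarily_large by blast
    thus False using c[of B] by auto
  qed
  show "card ?A \<le> 2" using c[OF f] by blast
qed

lemma finite_breaks:
  assumes "generic_line q e" shows "finite (breaks q e)"
proof -
  have "breaks q e = (\<Union>K\<in>\<T>. {t. q + t *\<^sub>R e \<in> frontier K})" by (auto simp: breaks_def)
  thus ?thesis using finite_mesh card_frontier_line(1)[OF assms] by simp
qed

lemma card_breaks_le:
  assumes g: "generic_line q e"
  shows "card (breaks q e \<inter> I) \<le> 2 * card {K \<in> \<T>. \<exists>t\<in>I. q + t *\<^sub>R e \<in> K}"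
proof -
  let ?M = "{K \<in> \<T>. \<exists>t\<in>I. q + t *\<^sub>R e \<in> K}"
  have fM: "finite ?M" using finite_mesh by auto
  have "breaks q e \<inter> I \<subseteq> (\<Union>K\<in>?M. {t. q + t *\<^sub>R e \<in> frontier K})"
    using element_closed frontier_subset_closed by (fastforce simp: breaks_def)
  hence "card (breaks q e \<inter> I) \<le> card (\<Union>K\<in>?M. {t. q + t *\<^sub>R e \<in> frontier K})"
    using fM card_frontier_line(1)[OF g] by (intro card_mono) auto
  also have "\<dots> \<le> (\<Sum>K\<in>?M. card {t. q + t *\<^sub>R e \<in> frontier K})" by (rule card_UN_le[OF fM])
  also have "\<dots> \<le> (\<Sum>K\<in>?M. 2)" by (intro sum_mono card_frontier_line(2)[OF g]) auto
  finally show ?thesis by simp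
qed

section \<open>Exceptional poles and lines form null sets\<close>

lemma finite_faces: "finite {G. \<exists>K\<in>\<T>. G face_of K}"
proof -
  have "{G. \<exists>K\<in>\<T>. G face_of K} = (\<Union>K\<in>\<T>. {G. G face_of K})" by auto
  thus ?thesis using finite_mesh by (auto intro: finite_polytope_faces element_polytope)
qed

lemma negligible_low_aff_dim:
  fixes G :: "'a set"
  assumes "aff_dim G < int DIM('a)" shows "negligible (affine hull G)"
proof -
  have "aff_dim (affine hull G) < int DIM('a)" using assms by simp
  then obtain a b where "a \<noteq> 0" "affine hull G \<subseteq> {x. a \<bullet> x = b}" by (rule aff_lowdim_subset_hyperplane)
  thus ?thesis using negligible_hyperplane[of a b] negligible_subset by blast
qed

lemma negligible_nongeneric_point: "negligible {q. \<not> generic_point q}"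
proof -
  have "{q. \<not> generic_point q} \<subseteq> (\<Union>G\<in>{G \<in> {G. \<exists>K\<in>\<T>. G face_of K}. aff_dim G < int DIM('a)}. affine hull G)"
    by (auto simp: generic_point_def)
  moreover have "negligible (\<Union>G\<in>{G \<in> {G. \<exists>K\<in>\<T>. G face_of K}. aff_dim G < int DIM('a)}. affine hull G)"
    using finite_faces by (intro negligible_Union) (auto intro: negligible_low_aff_dim)
  ultimately show ?thesis using negligible_subset by blast
qed

text \<open>If the line through \<open>q\<close> and \<open>z\<close> meets a face of codimension at
  least two, then \<open>z\<close> lies in the affine hull of that face and \<open>q\<close>, whose
  dimension is at most d - 1.\<close>

lemma negligible_nongeneric_line:
  assumes q: "generic_point q"
  shows "negligible {z. \<not> generic_line q (z - q)}"
proof -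
  let ?A = "\<Union>G\<in>{G \<in> {G. \<exists>K\<in>\<T>. G face_of K}. aff_dim G < int DIM('a) - 1}. affine hull (insert q G)"
  have "{z. \<not> generic_line q (z - q)} \<subseteq> {q} \<union> ?A"
  proof
    fix z assume "z \<in> {z. \<not> generic_line q (z - q)}"
    hence z: "\<not> generic_line q (z - q)" by simp
    show "z \<in> {q} \<union> ?A"
    proof (cases "z = q")
      case False
      then obtain K G t where G: "K \<in> \<T>" "G face_of K" "aff_dim G < int DIM('a) - 1" "q + t *\<^sub>R (z - q) \<in> G"
        using z q by (auto simp: generic_line_def)
      \<comment> \<open>At \<open>t = 0\<close> the point would be the pole, which lies in no such
        face; so \<open>z\<close> can be solved for as an affine combination.\<close>
      have "t \<noteq> 0"
      proof
        assume "t = 0"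
        hence "q \<in> affine hull G" using G(4) hull_inc by fastforce
        thus False using q G by (auto simp: generic_point_def)
      qed
      define g where "g = q + t *\<^sub>R (z - q)"
      have "z = (1 - 1/t) *\<^sub>R q + (1/t) *\<^sub>R g" using \<open>t \<noteq> 0\<close> by (simp add: g_def algebra_simps)
      moreover have "q \<in> affine hull (insert q G)" "g \<in> affine hull (insert q G)" using G(4) by (auto simp: g_def intro: hull_inc)
      ultimately have "z \<in> affine hull (insert q G)"
        using mem_affine[OF affine_affine_hull, of q "insert q G" g "1 - 1/t" "1/t"] by simp
      thus ?thesis using G by blast
    qed simp
  qed
  moreover have "negligible ({q} \<union> ?A)"
    using finite_faces by (intro negligible_Un negligible_Union) (auto intro!: negligible_low_aff_dim simp: aff_dim_insert)
  ultimately show ?thesis using negligible_subset by blast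
qed

end

section \<open>Counting elements along a line\<close>

context mesh_on_domain
begin

lemma mesh_nonempty: "\<T> \<noteq> {}"
  using union_mesh nonempty_domain closure_subset by fastforce

lemma element_bounded: "K \<in> \<T> \<Longrightarrow> bounded K"
  using element_compact compact_imp_bounded by blast

lemma element_diameter_pos: assumes "K \<in> \<T>" shows "diameter K > 0"
proof -
  obtain x where "x \<in> interior K" using element_interior_nonempty[OF assms] by blast
  then obtain r where r: "r > 0" "cball x r \<subseteq> K" using mem_interior_cball by blast
  have "2 * r = diameter (cball x r)" using r by simp
  also have "\<dots> \<le> diameter K" using r element_bounded[OF assms] by (intro diameter_subset)
  finally show ?thesis using r by linarith
qed

lemma diameter_le_mesh_size: "K \<in> \<T> \<Longrightarrow> diameter K \<le> mesh_size \<T>"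
  unfolding mesh_size_def using finite_mesh by (intro Max_ge) auto

lemma mesh_size_pos: "mesh_size \<T> > 0"
  using mesh_nonempty diameter_le_mesh_size element_diameter_pos by (metis all_not_in_conv less_le_trans)

text \<open>The regularity constants bound the supremum of the inscribed radii below by
  \<open>mesh_size \<T> / (2 * \<sigma> * \<tau>)\<close>. Half of that is taken, so that a ball
  exists without the supremum being attained.\<close>

lemma element_contains_ball:
  assumes sr: "shape_regular \<sigma> \<T>" and qu: "quasi_uniform \<tau> \<T>" and K: "K \<in> \<T>"
  shows "\<sigma> > 0" "\<tau> > 0" "\<exists>x. cball x (mesh_size \<T> / (4 * \<sigma> * \<tau>)) \<subseteq> K"
proof -
  let ?R = "{r. 0 \<le> r \<and> (\<exists>x. cball x r \<subseteq> K)}" and ?h = "mesh_size \<T>"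
  have dK: "diameter K > 0" by (rule element_diameter_pos[OF K])
  have "0 \<in> ?R" using element_interior_nonempty[OF K] interior_subset by auto
  hence ne: "?R \<noteq> {}" by blast
  have bd: "bdd_above ?R"
  proof (rule bdd_aboveI)
    fix r assume "r \<in> ?R"
    then obtain x where r: "0 \<le> r" "cball x r \<subseteq> K" by blast
    have "2 * r = diameter (cball x r)" using r by simp
    also have "\<dots> \<le> diameter K" using r element_bounded[OF K] by (intro diameter_subset)
    finally show "r \<le> diameter K" using r by linarith
  qed
  have S0: "Sup ?R \<ge> 0" using \<open>0 \<in> ?R\<close> bd by (rule cSup_upper)
  have s: "diameter K \<le> \<sigma> * (2 * Sup ?R)" using sr K by (auto simp: shape_regular_def inball_diameter_def)
  have t: "?h \<le> \<tau> * diameter K" using qu K by (auto simp: quasi_uniform_def)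
  show \<sigma>: "\<sigma> > 0"
  proof (rule ccontr)
    assume "\<not> \<sigma> > 0"
    hence "\<sigma> * (2 * Sup ?R) \<le> 0" using S0 by (intro mult_nonpos_nonneg) auto
    thus False using s dK by linarith
  qed
  show \<tau>: "\<tau> > 0"
  proof (rule ccontr)
    assume "\<not> \<tau> > 0"
    hence "\<tau> * diameter K \<le> 0" using dK by (intro mult_nonpos_nonneg) auto
    thus False using t mesh_size_pos by linarith
  qed
  have "?h \<le> \<tau> * (\<sigma> * (2 * Sup ?R))" using t s \<tau> by (meson mult_left_mono less_imp_le order_trans)
  hence "?h / (2 * \<sigma> * \<tau>) \<le> Sup ?R" using \<sigma> \<tau> by (simp add: field_simps)
  moreover have "?h / (4 * \<sigma> * \<tau>) < ?h / (2 * \<sigma> * \<tau>)" using \<sigma> \<tau> mesh_size_pos by (simp add: field_simps)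
  ultimately have "?h / (4 * \<sigma> * \<tau>) < Sup ?R" by linarith
  then obtain r where r: "r \<in> ?R" "?h / (4 * \<sigma> * \<tau>) < r" using less_cSup_iff[OF ne bd] by blast
  then obtain x where "cball x r \<subseteq> K" by blast
  moreover have "cball x (?h / (4 * \<sigma> * \<tau>)) \<subseteq> cball x r" using r(2) by (intro subset_cball) auto
  ultimately show "\<exists>x. cball x (?h / (4 * \<sigma> * \<tau>)) \<subseteq> K" by blast
qed

text \<open>Volume packing: with h the mesh size, inscribed balls of radius
  \<open>h / (4 * \<sigma> * \<tau>)\<close> are disjoint and contained in the balls of radius
  \<open>2 * h\<close> about the \<open>c j\<close>; the ratio of the radii is
  \<open>8 * \<sigma> * \<tau>\<close>.\<close>

lemma card_elements_near:
  assumes sr: "shape_regular \<sigma> \<T>" and qu: "quasi_uniform \<tau> \<T>"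
    and A: "A \<subseteq> (\<Union>j<m. cball (c j) (mesh_size \<T>))"
  shows "real (card {K \<in> \<T>. K \<inter> A \<noteq> {}}) \<le> real m * (8 * \<sigma> * \<tau>) ^ DIM('a)"
proof -
  let ?h = "mesh_size \<T>"
  let ?N = "{K \<in> \<T>. K \<inter> A \<noteq> {}}"
  obtain K0 where K0: "K0 \<in> \<T>" using mesh_nonempty by blast
  have st: "\<sigma> > 0" "\<tau> > 0" using element_contains_ball[OF sr qu K0] by auto
  define r where "r = ?h / (4 * \<sigma> * \<tau>)"
  have r: "r > 0" using st mesh_size_pos by (simp add: r_def)
  have "\<forall>K\<in>\<T>. \<exists>x. cball x r \<subseteq> K" using element_contains_ball[OF sr qu] by (auto simp: r_def)
  then obtain x where x: "\<And>K. K \<in> \<T> \<Longrightarrow> cball (x K) r \<subseteq> K" by metis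
  have bi: "ball (x K) r \<subseteq> interior K" if "K \<in> \<T>" for K
    using x[OF that] ball_subset_cball by (intro interior_maximal) (blast, simp)
  have fN: "finite ?N" using finite_mesh by simp
  have dj: "disjoint_family_on (\<lambda>K. ball (x K) r) ?N"
    unfolding disjoint_family_on_def
  proof (intro ballI impI)
    fix K K' assume K: "K \<in> ?N" "K' \<in> ?N" "K \<noteq> K'"
    hence "interior K \<inter> interior K' = {}" using element_interior_disjoint interior_subset by blast
    thus "ball (x K) r \<inter> ball (x K') r = {}" using bi K by blast
  qed
  have cover: "(\<Union>K\<in>?N. ball (x K) r) \<subseteq> (\<Union>j<m. cball (c j) (2 * ?h))"
  proof
    fix p assume "p \<in> (\<Union>K\<in>?N. ball (x K) r)"
    then obtain K where K: "K \<in> \<T>" "K \<inter> A \<noteq> {}" "p \<in> K" using bi interior_subset by blast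
    then obtain a j where a: "a \<in> K" "j < m" "a \<in> cball (c j) ?h" using A by blast
    have "dist a p \<le> diameter K" using element_bounded[OF K(1)] a K(3) by (intro diameter_bounded_bound)
    hence "dist (c j) p \<le> ?h + ?h" using a(3) diameter_le_mesh_size[OF K(1)] dist_triangle[of "c j" p a] by auto
    thus "p \<in> (\<Union>j<m. cball (c j) (2 * ?h))" using a(2) by auto
  qed
  let ?\<omega> = "unit_ball_vol (real DIM('a))"
  have w: "?\<omega> > 0" by simp
  have "ennreal (real (card ?N) * (?\<omega> * r ^ DIM('a))) = (\<Sum>K\<in>?N. emeasure lborel (ball (x K) r))"
    using r w by (simp add: emeasure_ball ennreal_mult ennreal_of_nat_eq_real_of_nat)
  also have "\<dots> = emeasure lborel (\<Union>K\<in>?N. ball (x K) r)"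
    by (rule sum_emeasure[OF _ dj fN]) auto
  also have "\<dots> \<le> emeasure lborel (\<Union>j<m. cball (c j) (2 * ?h))"
    by (rule emeasure_mono[OF cover]) auto
  also have "\<dots> \<le> (\<Sum>j<m. emeasure lborel (cball (c j) (2 * ?h)))"
    by (rule emeasure_subadditive_finite) auto
  also have "\<dots> = ennreal (real m * (?\<omega> * (2 * ?h) ^ DIM('a)))"
    using mesh_size_pos w by (simp add: emeasure_cball ennreal_mult ennreal_of_nat_eq_real_of_nat)
  finally have "real (card ?N) * (?\<omega> * r ^ DIM('a)) \<le> real m * (?\<omega> * (2 * ?h) ^ DIM('a))"
    using mesh_size_pos w by (subst (asm) ennreal_le_iff) auto
  hence "?\<omega> * (real (card ?N) * r ^ DIM('a)) \<le> ?\<omega> * (real m * (2 * ?h) ^ DIM('a))" by (simp only: mult.assoc mult.left_commute)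
  hence "real (card ?N) * r ^ DIM('a) \<le> real m * (2 * ?h) ^ DIM('a)" using w by simp
  also have "2 * ?h = 8 * \<sigma> * \<tau> * r" using st by (simp add: r_def)
  also have "(8 * \<sigma> * \<tau> * r) ^ DIM('a) = (8 * \<sigma> * \<tau>) ^ DIM('a) * r ^ DIM('a)" by (rule power_mult_distrib)
  finally show ?thesis using r by simp
qed

text \<open>The parameters between 0 and 2 trace a segment of length \<open>2 * norm e\<close>,
  which is covered by balls whose number is about that length divided by the mesh size. Each element
  met contributes at most two breaks.\<close>

lemma card_breaks_bound:
  assumes sr: "shape_regular \<sigma> \<T>" and qu: "quasi_uniform \<tau> \<T>" and g: "generic_line q e"
  shows "real (card (breaks q e \<inter> {0<..<2})) * mesh_size \<T> \<le> 2 * (2 * norm e + mesh_size \<T>) * (8 * \<sigma> * \<tau>) ^ DIM('a)"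
proof -
  let ?h = "mesh_size \<T>"
  have h: "?h > 0" by (rule mesh_size_pos)
  obtain K0 where K0: "K0 \<in> \<T>" using mesh_nonempty by blast
  have st: "\<sigma> > 0" "\<tau> > 0" using element_contains_ball[OF sr qu K0] by auto
  have e: "norm e > 0" using g by (simp add: generic_line_def)
  \<comment> \<open>With \<open>m\<close> equally spaced centres the spacing is at most the mesh
    size. Rounding up costs an additive 1, which becomes the summand \<open>mesh_size \<T>\<close>
    in the bound.\<close>
  define m where "m = nat \<lceil>2 * norm e / ?h\<rceil>"
  have m1: "2 * norm e / ?h \<le> real m" unfolding m_def by linarith
  have m2: "real m \<le> 2 * norm e / ?h + 1" using e h unfolding m_def by (simp add: ceiling_correct less_imp_le)
  have mpos: "real m > 0" using m1 e h by (meson divide_pos_pos less_le_trans mult_pos_pos zero_less_numeral)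
  define A where "A = {q + t *\<^sub>R e |t. t \<in> {0<..<2}}"
  have "A \<subseteq> (\<Union>j<m. cball (q + (2 * real j / real m) *\<^sub>R e) ?h)"
  proof
    fix y assume "y \<in> A"
    then obtain t where t: "0 < t" "t < 2" "y = q + t *\<^sub>R e" by (auto simp: A_def)
    \<comment> \<open>The index of the last centre at or before \<open>t\<close>.\<close>
    define j where "j = nat \<lfloor>t * real m / 2\<rfloor>"
    have j1: "real j \<le> t * real m / 2" "t * real m / 2 < real j + 1" using mult_pos_pos[OF t(1) mpos] unfolding j_def by linarith+
    have "t * real m / 2 < real m" using t mpos by simp
    hence jm: "j < m" using j1(1) by linarith
    have "t - 2 * real j / real m = (t * real m - 2 * real j) / real m" using mpos by (simp add: diff_divide_distrib)
    hence d: "0 \<le> t - 2 * real j / real m" "t - 2 * real j / real m \<le> 2 / real m"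
      using j1 mpos by (simp_all add: divide_right_mono)
    have "dist (q + (2 * real j / real m) *\<^sub>R e) y = norm ((t - 2 * real j / real m) *\<^sub>R e)"
      unfolding t(3) dist_norm by (subst norm_minus_commute) (simp add: algebra_simps)
    also have "\<dots> = (t - 2 * real j / real m) * norm e" using d by simp
    also have "\<dots> \<le> 2 / real m * norm e" using d e by (intro mult_right_mono) auto
    also have "\<dots> \<le> ?h" using m1 mpos h by (simp add: field_simps)
    finally show "y \<in> (\<Union>j<m. cball (q + (2 * real j / real m) *\<^sub>R e) ?h)" using jm by auto
  qed
  note near = card_elements_near[OF sr qu this]
  have eq: "{K \<in> \<T>. \<exists>t\<in>{0<..<2}. q + t *\<^sub>R e \<in> K} = {K \<in> \<T>. K \<inter> A \<noteq> {}}" unfolding A_def by blast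
  have "real (card (breaks q e \<inter> {0<..<2})) \<le> 2 * (real m * (8 * \<sigma> * \<tau>) ^ DIM('a))"
    using card_breaks_le[OF g, of "{0<..<2}"] near unfolding eq by linarith
  also have "\<dots> \<le> 2 * ((2 * norm e / ?h + 1) * (8 * \<sigma> * \<tau>) ^ DIM('a))"
    using m2 st by (intro mult_left_mono mult_right_mono) auto
  finally have "real (card (breaks q e \<inter> {0<..<2})) * ?h \<le> 2 * ((2 * norm e / ?h + 1) * (8 * \<sigma> * \<tau>) ^ DIM('a)) * ?h"
    using h by (intro mult_right_mono) auto
  also have "\<dots> = 2 * ((2 * norm e / ?h + 1) * ?h) * (8 * \<sigma> * \<tau>) ^ DIM('a)" by (simp only: mult.assoc mult.commute mult.left_commute)
  also have "(2 * norm e / ?h + 1) * ?h = 2 * norm e + ?h" using h by (simp add: field_simps)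
  finally show ?thesis .
qed

end

section \<open>Surface integrals over facets\<close>

lemma closest_point_hyperplane:
  fixes n :: "'a::euclidean_space"
  assumes n: "norm n = 1"
  shows "closest_point {x. n \<bullet> x = b} w = w + (b - n \<bullet> w) *\<^sub>R n"
    and "infdist w {x. n \<bullet> x = b} = \<bar>n \<bullet> w - b\<bar>"
proof -
  let ?H = "{x. n \<bullet> x = b}"
  have nn: "n \<bullet> n = 1" using n by (simp add: norm_eq_1)
  have inH: "w + (b - n \<bullet> w) *\<^sub>R n \<in> ?H" by (simp add: inner_add_right nn)
  have d: "dist w (w + (b - n \<bullet> w) *\<^sub>R n) = \<bar>n \<bullet> w - b\<bar>" using n by (simp add: dist_norm)
  have le: "\<bar>n \<bullet> w - b\<bar> \<le> dist w z" if "z \<in> ?H" for z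
  proof -
    have "\<bar>n \<bullet> w - b\<bar> = \<bar>n \<bullet> (w - z)\<bar>" using that by (simp add: inner_diff_right)
    also have "\<dots> \<le> norm n * norm (w - z)" by (rule Cauchy_Schwarz_ineq2)
    finally show ?thesis using n by (simp add: dist_norm)
  qed
  have cl: "closed ?H" by (rule closed_hyperplane)
  show c: "closest_point ?H w = w + (b - n \<bullet> w) *\<^sub>R n"
    by (rule closest_point_unique[symmetric, OF convex_hyperplane cl inH]) (use d le in auto)
  have "infdist w ?H = dist w (closest_point ?H w)"
    unfolding infdist_eq_setdist using inH by (intro setdist_closest_point cl) auto
  thus "infdist w ?H = \<bar>n \<bullet> w - b\<bar>" by (simp only: c d)
qed

text \<open>The slab in the definition of \<open>surface_measure\<close> becomes explicit once the
  normal is known. A Bochner integral of a non-integrable function is 0, so integrability is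
  established before passing to \<open>ennreal\<close>; compactness of \<open>F\<close> provides
  it.\<close>

lemma surface_integral_eq_plane_integral:
  fixes F :: "'a::euclidean_space set" and f :: "'a \<Rightarrow> real"
  assumes n: "norm n = 1" and H: "affine hull F = {x. n \<bullet> x = b}" and F: "compact F"
    and f: "continuous_on UNIV f" "\<And>x. 0 \<le> f x"
  shows "ennreal (LINT x:F|surface_measure F. f x) = plane_integral n (\<lambda>x. ennreal (f x) * indicator F x) b"
proof -
  let ?H = "{x. n \<bullet> x = b}" and ?P = "\<lambda>w. w + (b - n \<bullet> w) *\<^sub>R n" and ?S = "{w. \<bar>n \<bullet> w - b\<bar> \<le> 1/2}"
  have Fs[measurable]: "F \<in> sets borel" by (intro borel_closed compact_imp_closed F)
  have fm[measurable]: "f \<in> borel_measurable borel" using f(1) by (rule borel_measurable_continuous_onI)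
  have sm: "surface_measure F = distr (restrict_space lborel ?S) borel ?P"
    unfolding surface_measure_def H Let_def closest_point_hyperplane(2)[OF n]
    by (intro distr_cong refl) (simp add: closest_point_hyperplane(1)[OF n])
  have Pm: "?P \<in> borel_measurable (restrict_space lborel ?S)" by (rule measurable_restrict_space1) measurable
  have nn: "(\<integral>\<^sup>+x. g x \<partial>surface_measure F) = plane_integral n g b" if g[measurable]: "g \<in> borel_measurable borel" for g :: "'a \<Rightarrow> ennreal"
  proof -
    have "(\<integral>\<^sup>+x. g x \<partial>surface_measure F) = (\<integral>\<^sup>+w. g (?P w) \<partial>restrict_space lborel ?S)"
      unfolding sm by (rule nn_integral_distr[OF Pm]) simp
    also have "\<dots> = (\<integral>\<^sup>+w. g (?P w) * indicator ?S w \<partial>lborel)"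
      by (rule nn_integral_restrict_space) simp
    also have "\<dots> = plane_integral n g b"
      by (subst plane_integral_slab[OF g n, symmetric]) (simp add: mult.commute)
    finally show ?thesis .
  qed
  obtain M where M: "M \<ge> 0" "\<And>x. x \<in> F \<Longrightarrow> f x \<le> M"
  proof -
    have "compact (f ` F)" using F f(1) by (intro compact_continuous_image) (auto intro: continuous_on_subset)
    then obtain B where "\<forall>x\<in>F. norm (f x) \<le> B" using compact_imp_bounded bounded_iff by (metis imageI)
    thus ?thesis using that[of "max B 0"] by fastforce
  qed
  obtain r where r: "r > 0" "\<And>x. x \<in> F \<Longrightarrow> norm x \<le> r" using compact_imp_bounded[OF F] bounded_pos by blast
  let ?g = "\<lambda>x. ennreal (f x) * indicator F x"
  \<comment> \<open>The prism over a compact set is bounded: its points are within distance 1/2 of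
    \<open>F\<close>.\<close>
  have "plane_integral n ?g b = (\<integral>\<^sup>+w. indicator ?S w * ?g (?P w) \<partial>lborel)"
    by (rule plane_integral_slab[symmetric, OF _ n]) measurable
  also have "\<dots> \<le> (\<integral>\<^sup>+w. ennreal M * indicator (cball 0 (r + 1/2)) w \<partial>(lborel::'a measure))"
  proof (rule nn_integral_mono)
    fix w :: 'a
    show "indicator ?S w * ?g (?P w) \<le> ennreal M * indicator (cball 0 (r + 1/2)) w"
    proof (cases "w \<in> ?S \<and> ?P w \<in> F")
      case True
      have "norm w \<le> norm (?P w) + norm ((b - n \<bullet> w) *\<^sub>R n)"
        by (metis add_diff_cancel_right' norm_triangle_ineq4)
      also have "norm ((b - n \<bullet> w) *\<^sub>R n) = \<bar>n \<bullet> w - b\<bar>" using n by simp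
      finally have "norm w \<le> r + 1/2" using r(2)[of "?P w"] True by auto
      thus ?thesis using True M by (auto simp: ennreal_leI)
    qed (auto simp: indicator_def)
  qed
  also have "\<dots> = ennreal M * emeasure lborel (cball (0::'a) (r + 1/2))" by (rule nn_integral_cmult_indicator) simp
  also have "\<dots> < \<infinity>" using emeasure_lborel_cball_finite[of "0::'a" "r + 1/2"] by (simp add: ennreal_mult_less_top)
  finally have fin: "plane_integral n ?g b < \<infinity>" .
  have gm: "?g \<in> borel_measurable borel" by measurable
  have e: "ennreal (indicat_real F x *\<^sub>R f x) = ?g x" for x by (auto simp: indicator_def)
  have sets: "sets (surface_measure F) = sets borel" unfolding sm by simp
  have meas: "(\<lambda>x. indicat_real F x *\<^sub>R f x) \<in> borel_measurable (surface_measure F)"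
    unfolding measurable_cong_sets[OF sets refl] by measurable
  have "integrable (surface_measure F) (\<lambda>x. indicat_real F x *\<^sub>R f x)"
  proof (rule integrableI_nonneg[OF meas])
    show "(\<integral>\<^sup>+x. ennreal (indicat_real F x *\<^sub>R f x) \<partial>surface_measure F) < \<infinity>" unfolding e nn[OF gm] by (rule fin)
  qed (use f(2) in auto)
  hence "ennreal (LINT x|surface_measure F. indicat_real F x *\<^sub>R f x) = (\<integral>\<^sup>+x. ennreal (indicat_real F x *\<^sub>R f x) \<partial>surface_measure F)"
    using f(2) by (intro nn_integral_eq_integral[symmetric]) auto
  thus ?thesis unfolding set_lebesgue_integral_def e nn[OF gm] .
qed

section \<open>Approximation by test functions on lines\<close>

text \<open>Uniform continuity off a null set yields a continuous extension across it. By density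
  the extension agrees with \<open>g\<close> wherever \<open>g\<close> is continuous, and so
  supplies a limit also at the points of \<open>S\<close>, where \<open>g\<close> itself may have a
  wrong value.\<close>

lemma uniformly_continuous_extension_off_finite:
  fixes g :: "real \<Rightarrow> real"
  assumes cd: "c < d" and N: "N \<in> null_sets lborel" and S: "finite S"
    and uc: "uniformly_continuous_on ({c<..<d} - N) g"
    and ct: "\<And>t. t \<in> {c<..<d} - S \<Longrightarrow> isCont g t"
    and t0: "t0 \<in> {c<..<d}"
  shows "\<exists>l. (g \<longlongrightarrow> l) (at t0)"
proof -
  let ?D = "{c<..<d} - N"
  \<comment> \<open>A nonempty open set is never null, so the complement of \<open>N\<close> is
    dense.\<close>
  have dense: "t \<in> closure (?D \<inter> U)" if t: "t \<in> {c<..<d}" "t \<in> U" "open U" for t U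
  proof (rule ccontr)
    assume "t \<notin> closure (?D \<inter> U)"
    hence "t \<in> (- closure (?D \<inter> U)) \<inter> (U \<inter> {c<..<d})" using t by auto
    moreover have o: "open ((- closure (?D \<inter> U)) \<inter> (U \<inter> {c<..<d}))" using t by (intro open_Int open_Compl) auto
    moreover have "(- closure (?D \<inter> U)) \<inter> (U \<inter> {c<..<d}) \<subseteq> N" using closure_subset[of "?D \<inter> U"] by auto
    moreover have "negligible N" using N by (simp add: negligible_iff_null_sets null_sets_completionI)
    ultimately show False using open_not_negligible[OF o] negligible_subset[of N] by (metis empty_iff)
  qed
  obtain G where G: "uniformly_continuous_on (closure ?D) G" "\<And>x. x \<in> ?D \<Longrightarrow> g x = G x"
    using uniformly_continuous_on_extension_on_closure[OF uc] by metis
  have sub: "{c<..<d} \<subseteq> closure ?D" using dense[of _ UNIV] by auto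
  have Gc: "isCont G t" if "t \<in> {c<..<d}" for t
    using continuous_on_subset[OF uniformly_continuous_imp_continuous[OF G(1)] sub] that
    by (simp add: continuous_on_eq_continuous_at)
  have eq: "g t = G t" if t: "t \<in> {c<..<d} - S" for t
  proof (rule ccontr)
    assume ne: "g t \<noteq> G t"
    have "isCont (\<lambda>x. g x - G x) t" using ct[OF t] Gc[of t] t by (intro continuous_intros) auto
    hence "((\<lambda>x. g x - G x) \<longlongrightarrow> g t - G t) (nhds t)" by (simp add: isCont_def tendsto_nhds_iff)
    hence "\<forall>\<^sub>F x in nhds t. g x - G x \<in> - {0}"
      by (rule topological_tendstoD) (use ne in auto)
    then obtain U where U: "open U" "t \<in> U" "\<And>x. x \<in> U \<Longrightarrow> g x - G x \<noteq> 0" unfolding eventually_nhds by auto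
    have "t \<in> closure (?D \<inter> U)" using dense U t by blast
    then obtain x where "x \<in> ?D \<inter> U" by (metis closure_empty empty_iff ex_in_conv)
    thus False using G(2) U(3) by auto
  qed
  have "\<forall>\<^sub>F x in at t0. x \<in> {c<..<d} - (S - {t0})"
  proof (rule eventually_at_in_open')
    show "open ({c<..<d} - (S - {t0}))" using S by (intro open_Diff finite_imp_closed) auto
  qed (use t0 in auto)
  moreover have "\<forall>\<^sub>F x in at t0. x \<noteq> t0" by (simp add: eventually_at_filter)
  ultimately have "\<forall>\<^sub>F x in at t0. G x = g x" by eventually_elim (use eq in auto)
  moreover have "(G \<longlongrightarrow> G t0) (at t0)" using Gc[OF t0] by (simp add: isCont_def)
  ultimately show ?thesis using Lim_transform_eventually by blast
qed

text \<open>Integrating \<open>\<bar>f'\<bar> \<le> \<mu> + f'^2 / \<mu>\<close> bounds increments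
  by \<open>\<mu> * \<bar>t - s\<bar> + Y / \<mu>\<close>, uniformly in the index. The estimate
  passes to the pointwise limit, and a suitable \<open>\<mu>\<close> for each tolerance gives
  uniform continuity.\<close>

lemma bounded_energy_limit_uniformly_continuous:
  fixes f :: "nat \<Rightarrow> real \<Rightarrow> real" and f' :: "nat \<Rightarrow> real \<Rightarrow> real"
  assumes d: "\<And>n t. (f n has_real_derivative f' n t) (at t)"
    and cont: "\<And>n. continuous_on UNIV (f' n)"
    and Y: "\<And>n. (\<integral>\<^sup>+t\<in>{c<..<d}. ennreal ((f' n t)\<^sup>2) \<partial>lborel) \<le> ennreal Y" "0 \<le> Y"
    and lim: "\<And>t. t \<in> D \<Longrightarrow> (\<lambda>n. f n t) \<longlonglongrightarrow> g t" and D: "D \<subseteq> {c<..<d}"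
  shows "uniformly_continuous_on D g"
proof -
  have est: "\<bar>f n t - f n s\<bar> \<le> \<mu> * (t - s) + Y / \<mu>" if st: "s < t" "c < s" "t < d" and \<mu>: "\<mu> > 0" for n s t \<mu>
  proof -
    have cf: "isCont (f n) x" for x using d DERIV_isCont by blast
    have m[measurable]: "f' n \<in> borel_measurable borel" using cont by (rule borel_measurable_continuous_onI)
    have "ennreal \<bar>f n t - f n s\<bar> \<le> (\<integral>\<^sup>+x\<in>{s<..<t}. ennreal \<bar>f' n x\<bar> \<partial>lborel) + (\<Sum>x\<in>{} \<inter> {s<..<t}. ennreal \<bar>f n x - f n x\<bar>)"
      by (rule jump_ftc[where Q = "f n"]) (use st d m cf in \<open>auto simp: isCont_def intro: filterlim_mono[OF _ order_refl] at_le\<close>)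
    also have "\<dots> \<le> (\<integral>\<^sup>+x. ennreal \<mu> * indicator {s<..<t} x + ennreal (1 / \<mu>) * (ennreal ((f' n x)\<^sup>2) * indicator {c<..<d} x) \<partial>lborel)"
    proof (simp, intro nn_integral_mono)
      fix x
      have "\<bar>f' n x\<bar> \<le> \<mu> + 1 / \<mu> * (f' n x)\<^sup>2"
      proof -
        have "0 \<le> (\<bar>f' n x\<bar> - \<mu>)\<^sup>2" by simp
        hence "2 * (\<mu> * \<bar>f' n x\<bar>) \<le> \<mu>\<^sup>2 + (f' n x)\<^sup>2" by (simp add: power2_diff algebra_simps)
        hence "\<mu> * \<bar>f' n x\<bar> \<le> \<mu>\<^sup>2 + (f' n x)\<^sup>2" using \<mu> by (smt (verit) mult_nonneg_nonneg abs_ge_zero)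
        thus ?thesis using \<mu> by (simp add: field_simps power2_eq_square)
      qed
      hence "ennreal \<bar>f' n x\<bar> \<le> ennreal \<mu> + ennreal (1 / \<mu>) * ennreal ((f' n x)\<^sup>2)"
        using \<mu> by (simp add: ennreal_mult[symmetric] ennreal_plus[symmetric] ennreal_leI del: ennreal_plus)
      thus "ennreal \<bar>f' n x\<bar> * indicator {s<..<t} x \<le> ennreal \<mu> * indicator {s<..<t} x + ennreal (1 / \<mu>) * (ennreal ((f' n x)\<^sup>2) * indicator {c<..<d} x)"
        using st by (auto simp: indicator_def)
    qed
    also have "\<dots> = ennreal \<mu> * ennreal (t - s) + ennreal (1 / \<mu>) * (\<integral>\<^sup>+x\<in>{c<..<d}. ennreal ((f' n x)\<^sup>2) \<partial>lborel)"
      using st by (subst nn_integral_add) (auto simp: nn_integral_cmult_indicator nn_integral_cmult)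
    also have "\<dots> \<le> ennreal \<mu> * ennreal (t - s) + ennreal (1 / \<mu>) * ennreal Y"
      by (intro add_left_mono mult_left_mono Y) auto
    also have "\<dots> = ennreal (\<mu> * (t - s) + Y / \<mu>)"
      using \<mu> st Y(2) by (simp add: ennreal_mult[symmetric] ennreal_plus[symmetric] del: ennreal_plus)
    finally show ?thesis using \<mu> st Y(2) by (subst (asm) ennreal_le_iff) (auto intro!: add_nonneg_nonneg)
  qed
  have est': "\<bar>f n t - f n s\<bar> \<le> \<mu> * \<bar>t - s\<bar> + Y / \<mu>" if st: "s \<in> D" "t \<in> D" and \<mu>: "\<mu> > 0" for n s t \<mu>
    using est[of s t \<mu> n] est[of t s \<mu> n] st D \<mu> Y(2) by (cases s t rule: linorder_cases) (fastforce simp: abs_minus_commute)+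
  have estg: "\<bar>g t - g s\<bar> \<le> \<mu> * \<bar>t - s\<bar> + Y / \<mu>" if st: "s \<in> D" "t \<in> D" and \<mu>: "\<mu> > 0" for s t \<mu>
  proof (rule LIMSEQ_le_const2)
    show "(\<lambda>n. \<bar>f n t - f n s\<bar>) \<longlonglongrightarrow> \<bar>g t - g s\<bar>" using lim st by (intro tendsto_intros) auto
  qed (use est' st \<mu> in blast)
  show ?thesis
    unfolding uniformly_continuous_on_def dist_real_def
  proof (intro allI impI)
    fix \<epsilon> :: real assume e: "\<epsilon> > 0"
    \<comment> \<open>Large enough for \<open>Y / \<mu>\<close> to stay below half of
      \<open>\<epsilon>\<close>; the added 1 keeps it positive when \<open>Y = 0\<close>.\<close>
    define \<mu> where "\<mu> = 2 * (Y + 1) / \<epsilon>"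
    have \<mu>: "\<mu> > 0" using e Y(2) by (simp add: \<mu>_def)
    have y: "Y / \<mu> < \<epsilon> / 2" using e Y(2) by (simp add: \<mu>_def field_simps)
    show "\<exists>\<delta>>0. \<forall>x\<in>D. \<forall>x'\<in>D. \<bar>x' - x\<bar> < \<delta> \<longrightarrow> \<bar>g x' - g x\<bar> < \<epsilon>"
    proof (intro exI[of _ "\<epsilon> / (2 * \<mu>)"] conjI ballI impI)
      fix x x' assume x: "x \<in> D" "x' \<in> D" "\<bar>x' - x\<bar> < \<epsilon> / (2 * \<mu>)"
      have "\<mu> * \<bar>x' - x\<bar> < \<epsilon> / 2" using x(3) \<mu> by (simp add: field_simps)
      thus "\<bar>g x' - g x\<bar> < \<epsilon>" using estg[OF x(1,2) \<mu>] y by linarith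
    qed (use e \<mu> in simp)
  qed
qed

section \<open>Test functions converging to an element of \<open>H1_0\<close>\<close>

lemma test_function_C_k: "\<phi> \<in> test_functions \<Omega> \<Longrightarrow> C_k n \<phi>"
  by (simp add: test_functions_def)

lemma test_function_differentiable: "\<phi> \<in> test_functions \<Omega> \<Longrightarrow> \<phi> differentiable (at x)"
  using test_function_C_k[of \<phi> \<Omega> "Suc 0"] by simp

lemma test_function_partial_continuous: "\<phi> \<in> test_functions \<Omega> \<Longrightarrow> i \<in> Basis \<Longrightarrow> continuous_on UNIV (partial_deriv i \<phi>)"
  using test_function_C_k[of \<phi> \<Omega> "Suc 0"] by simp

lemma test_function_continuous: "\<phi> \<in> test_functions \<Omega> \<Longrightarrow> continuous_on UNIV \<phi>"
  using test_function_C_k[of \<phi> \<Omega> 0] by simp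

lemma test_function_grad_continuous:
  assumes "\<phi> \<in> test_functions \<Omega>" shows "continuous_on UNIV (grad \<phi>)"
proof -
  have "grad \<phi> = (\<lambda>x. \<Sum>i\<in>Basis. partial_deriv i \<phi> x *\<^sub>R i)" by (simp add: grad_def fun_eq_iff)
  thus ?thesis using test_function_partial_continuous[OF assms] by (auto intro!: continuous_intros)
qed

lemma test_function_zero: "\<phi> \<in> test_functions \<Omega> \<Longrightarrow> x \<notin> \<Omega> \<Longrightarrow> \<phi> x = 0"
  using closure_subset[of "{x. \<phi> x \<noteq> 0}"] by (auto simp: test_functions_def)

lemma test_function_grad_zero:
  assumes \<phi>: "\<phi> \<in> test_functions \<Omega>" and x: "x \<notin> \<Omega>" shows "partial_deriv i \<phi> x = 0" "grad \<phi> x = 0"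
proof -
  let ?U = "- closure {x. \<phi> x \<noteq> 0}"
  have xU: "x \<in> ?U" using \<phi> x unfolding test_functions_def by auto
  have z: "\<phi> y = 0" if "y \<in> ?U" for y using that closure_subset[of "{x. \<phi> x \<noteq> 0}"] by auto
  have "(\<phi> has_derivative (\<lambda>h. 0)) (at x)"
    by (rule has_derivative_transform_within_open[OF has_derivative_const[of 0 "at x"] _ xU])
       (blast, erule z[symmetric])
  hence "frechet_derivative \<phi> (at x) = (\<lambda>h. 0)" by (rule frechet_derivative_at[symmetric])
  thus a: "partial_deriv i \<phi> x = 0" for i by (simp add: partial_deriv_def)
  show "grad \<phi> x = 0" by (simp add: grad_def a)
qed

lemma L2_diff_square_integrable:
  fixes f :: "'a::euclidean_space \<Rightarrow> real"
  assumes \<Omega>: "open \<Omega>" "bounded \<Omega>" and f: "f \<in> L2 \<Omega>" and c: "continuous_on UNIV c" and z: "\<And>x. x \<notin> \<Omega> \<Longrightarrow> c x = 0"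
  shows "integrable (lebesgue_on \<Omega>) (\<lambda>x. (f x - c x)\<^sup>2)"
proof -
  have fm[measurable]: "f \<in> borel_measurable (lebesgue_on \<Omega>)" and fi: "integrable (lebesgue_on \<Omega>) (\<lambda>x. (f x)\<^sup>2)"
    using f by (auto simp: L2_def)
  have cm[measurable]: "c \<in> borel_measurable (lebesgue_on \<Omega>)"
  proof -
    have "c \<in> borel_measurable borel" using c by (rule borel_measurable_continuous_onI)
    hence "c \<in> borel_measurable lebesgue" by (simp add: measurable_completion)
    thus ?thesis by (rule measurable_restrict_space1)
  qed
  have "compact (c ` closure \<Omega>)" using \<Omega> c by (intro compact_continuous_image) (auto intro: continuous_on_subset)
  then obtain B where B: "\<forall>x\<in>closure \<Omega>. norm (c x) \<le> B" using compact_imp_bounded bounded_iff by (metis imageI)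
  have lm: "\<Omega> \<in> lmeasurable" using \<Omega> by (intro lmeasurable_open)
  have fin: "emeasure (lebesgue_on \<Omega>) (space (lebesgue_on \<Omega>)) < \<infinity>"
    using lm by (simp add: emeasure_restrict_space fmeasurable_def del: emeasure_completion)
  have ci: "integrable (lebesgue_on \<Omega>) (\<lambda>x. B\<^sup>2)"
    by (rule finite_measure.integrable_const, rule finite_measureI) (use fin in simp)
  have bi: "integrable (lebesgue_on \<Omega>) (\<lambda>x. 2 * (f x)\<^sup>2 + 2 * B\<^sup>2)"
    using fi ci by (intro Bochner_Integration.integrable_add integrable_mult_right) auto
  show ?thesis
  proof (rule Bochner_Integration.integrable_bound[OF bi])
    show "AE x in lebesgue_on \<Omega>. norm ((f x - c x)\<^sup>2) \<le> norm (2 * (f x)\<^sup>2 + 2 * B\<^sup>2)"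
    proof (rule AE_I2)
      fix x assume "x \<in> space (lebesgue_on \<Omega>)"
      hence "\<bar>c x\<bar> \<le> B" using B closure_subset by auto
      hence "\<bar>c x\<bar>\<^sup>2 \<le> B\<^sup>2" by (intro power_mono) auto
      hence 1: "(c x)\<^sup>2 \<le> B\<^sup>2" by simp
      have "0 \<le> (f x + c x)\<^sup>2" by simp
      hence "(f x - c x)\<^sup>2 \<le> 2 * (f x)\<^sup>2 + 2 * (c x)\<^sup>2" by (simp add: power2_sum power2_diff)
      thus "norm ((f x - c x)\<^sup>2) \<le> norm (2 * (f x)\<^sup>2 + 2 * B\<^sup>2)" using 1 by simp
    qed
  qed measurable
qed

text \<open>Errors below \<open>(1/2)^n\<close> are summable. This gives convergence almost
  everywhere without extracting a subsequence, and a single integrable majorant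
  \<open>\<Gamma>\<close> for all squared gradients.\<close>

lemma H1_0_approximation:
  fixes \<Omega> :: "'a::euclidean_space set"
  assumes \<Omega>: "open \<Omega>" "bounded \<Omega>" and v: "v \<in> H1_0 \<Omega>"
  obtains \<phi> :: "nat \<Rightarrow> 'a \<Rightarrow> real" and \<Gamma> :: "'a \<Rightarrow> ennreal"
  where "\<And>n. \<phi> n \<in> test_functions \<Omega>" "\<Gamma> \<in> borel_measurable borel" "(\<integral>\<^sup>+y. \<Gamma> y \<partial>lborel) < \<infinity>"
    "\<And>n y. ennreal ((norm (grad (\<phi> n) y))\<^sup>2) \<le> \<Gamma> y"
    "AE y in lebesgue_on \<Omega>. (\<lambda>n. \<phi> n y) \<longlonglongrightarrow> v y"
proof -
  obtain G where vL: "v \<in> L2 \<Omega>" and G: "\<forall>i\<in>Basis. (\<lambda>x. G x \<bullet> i) \<in> L2 \<Omega>"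
    and ap: "\<forall>\<epsilon>>0. \<exists>\<phi>\<in>test_functions \<Omega>.
        integral\<^sup>L (lebesgue_on \<Omega>) (\<lambda>x. (v x - \<phi> x)\<^sup>2) +
        integral\<^sup>L (lebesgue_on \<Omega>) (\<lambda>x. (norm (G x - grad \<phi> x))\<^sup>2) < \<epsilon>"
    using v unfolding H1_0_def by blast
  have "\<forall>n::nat. \<exists>\<phi>\<in>test_functions \<Omega>.
        integral\<^sup>L (lebesgue_on \<Omega>) (\<lambda>x. (v x - \<phi> x)\<^sup>2) +
        integral\<^sup>L (lebesgue_on \<Omega>) (\<lambda>x. (norm (G x - grad \<phi> x))\<^sup>2) < (1/2)^n"
    using ap by simp
  from choice[OF this[unfolded Bex_def]] obtain \<phi> where \<phi>lt: "\<forall>n. \<phi> n \<in> test_functions \<Omega> \<and>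
        integral\<^sup>L (lebesgue_on \<Omega>) (\<lambda>x. (v x - \<phi> n x)\<^sup>2) +
        integral\<^sup>L (lebesgue_on \<Omega>) (\<lambda>x. (norm (G x - grad (\<phi> n) x))\<^sup>2) < (1/2)^n" ..
  hence \<phi>: "\<phi> n \<in> test_functions \<Omega>" for n by blast
  have lt: " integral\<^sup>L (lebesgue_on \<Omega>) (\<lambda>x. (v x - \<phi> n x)\<^sup>2) +
        integral\<^sup>L (lebesgue_on \<Omega>) (\<lambda>x. (norm (G x - grad (\<phi> n) x))\<^sup>2) < (1/2)^n" for n
    using \<phi>lt by blast
  let ?M = "lebesgue_on \<Omega>"
  have i1: "integrable ?M (\<lambda>x. (v x - \<phi> n x)\<^sup>2)" for n
    by (rule L2_diff_square_integrable[OF \<Omega> vL test_function_continuous[OF \<phi>] test_function_zero[OF \<phi>]])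
  have n2: "(norm (G x - grad (\<phi> n) x))\<^sup>2 = (\<Sum>i\<in>Basis. (G x \<bullet> i - partial_deriv i (\<phi> n) x)\<^sup>2)" for n x
  proof -
    have "grad (\<phi> n) x \<bullet> i = partial_deriv i (\<phi> n) x" if "i \<in> Basis" for i
      using that by (simp add: grad_def inner_sum_left inner_Basis if_distrib cong: if_cong)
    thus ?thesis unfolding power2_norm_eq_inner
      by (subst euclidean_inner) (simp add: inner_diff_left power2_eq_square)
  qed
  have i2: "integrable ?M (\<lambda>x. (norm (G x - grad (\<phi> n) x))\<^sup>2)" for n
    unfolding n2
    by (intro Bochner_Integration.integrable_sum L2_diff_square_integrable[OF \<Omega>] test_function_partial_continuous[OF \<phi>] test_function_grad_zero(1)[OF \<phi>])
       (use G in auto)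
  have nn: "(norm (G x))\<^sup>2 = (\<Sum>i\<in>Basis. (G x \<bullet> i)\<^sup>2)" for x
    unfolding power2_norm_eq_inner by (subst euclidean_inner) (simp add: power2_eq_square)
  have i3: "integrable ?M (\<lambda>x. (norm (G x))\<^sup>2)"
    unfolding nn by (intro Bochner_Integration.integrable_sum) (use G in \<open>auto simp: L2_def\<close>)
  have m1[measurable]: "(\<lambda>x. (v x - \<phi> n x)\<^sup>2) \<in> borel_measurable ?M" for n using i1 by (rule borel_measurable_integrable)
  have m2[measurable]: "(\<lambda>x. (norm (G x - grad (\<phi> n) x))\<^sup>2) \<in> borel_measurable ?M" for n using i2 by (rule borel_measurable_integrable)
  have m3[measurable]: "(\<lambda>x. (norm (G x))\<^sup>2) \<in> borel_measurable ?M" using i3 by (rule borel_measurable_integrable)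
  have p1: "0 \<le> integral\<^sup>L ?M (\<lambda>x. (v x - \<phi> n x)\<^sup>2)" "0 \<le> integral\<^sup>L ?M (\<lambda>x. (norm (G x - grad (\<phi> n) x))\<^sup>2)" for n
    by simp_all
  have b1: "(\<integral>\<^sup>+x. ennreal ((v x - \<phi> n x)\<^sup>2) \<partial>?M) \<le> ennreal ((1/2)^n)" for n
    unfolding nn_integral_eq_integral[OF i1 AE_I2[OF zero_le_power2]]
    by (rule ennreal_leI) (use lt[of n] p1(1)[of n] p1(2)[of n] in linarith)
  have b2: "(\<integral>\<^sup>+x. ennreal ((norm (G x - grad (\<phi> n) x))\<^sup>2) \<partial>?M) \<le> ennreal ((1/2)^n)" for n
    unfolding nn_integral_eq_integral[OF i2 AE_I2[OF zero_le_power2]]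
    by (rule ennreal_leI) (use lt[of n] p1(1)[of n] p1(2)[of n] in linarith)
  have geo: "(\<Sum>n. ennreal ((1/2)^n)) < \<infinity>"
  proof -
    have "(\<lambda>n. (1/2::real)^n) sums (1 / (1 - 1/2))" by (rule geometric_sums) simp
    hence "(\<Sum>n. ennreal ((1/2)^n)) = ennreal (1 / (1 - 1/2))"
      by (rule suminf_ennreal_eq[rotated]) (rule zero_le_power, simp)
    thus ?thesis by (simp only: ennreal_less_top infinity_ennreal_def)
  qed
  have "(\<integral>\<^sup>+x. (\<Sum>n. ennreal ((v x - \<phi> n x)\<^sup>2)) \<partial>?M) = (\<Sum>n. \<integral>\<^sup>+x. ennreal ((v x - \<phi> n x)\<^sup>2) \<partial>?M)"
    by (rule nn_integral_suminf) measurable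
  also have "\<dots> \<le> (\<Sum>n. ennreal ((1/2)^n))" by (intro suminf_le b1) auto
  finally have "(\<integral>\<^sup>+x. (\<Sum>n. ennreal ((v x - \<phi> n x)\<^sup>2)) \<partial>?M) \<noteq> \<infinity>" using geo by (auto simp: top_unique)
  hence "AE x in ?M. (\<Sum>n. ennreal ((v x - \<phi> n x)\<^sup>2)) \<noteq> \<infinity>"
    by (intro nn_integral_PInf_AE) measurable
  hence lim: "AE x in ?M. (\<lambda>n. \<phi> n x) \<longlonglongrightarrow> v x"
  proof eventually_elim
    case (elim x)
    have "summable (\<lambda>n. (v x - \<phi> n x)\<^sup>2)" by (rule summable_suminf_not_top) (use elim in auto)
    hence "(\<lambda>n. (v x - \<phi> n x)\<^sup>2) \<longlonglongrightarrow> 0" by (rule summable_LIMSEQ_zero)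
    hence "(\<lambda>n. sqrt ((v x - \<phi> n x)\<^sup>2)) \<longlonglongrightarrow> sqrt 0" by (rule tendsto_real_sqrt)
    hence "(\<lambda>n. v x - \<phi> n x) \<longlonglongrightarrow> 0" by (simp add: tendsto_rabs_zero_iff)
    hence "(\<lambda>n. v x - (v x - \<phi> n x)) \<longlonglongrightarrow> v x - 0" by (intro tendsto_intros)
    thus ?case by simp
  qed
  \<comment> \<open>At most twice \<open>(norm (G y))^2\<close> plus twice the sum of all squared
    gradient errors. As a countable supremum of continuous functions it is Borel measurable on the
    whole space, and it vanishes off \<open>\<Omega>\<close>, so it can be integrated along
    lines.\<close>
  define \<Gamma> where "\<Gamma> = (\<lambda>y. SUP n. ennreal ((norm (grad (\<phi> n) y))\<^sup>2))"
  have gm: "grad (\<phi> n) \<in> borel_measurable borel" for n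
    using test_function_grad_continuous[OF \<phi>] by (rule borel_measurable_continuous_onI)
  have \<Gamma>m: "\<Gamma> \<in> borel_measurable borel" unfolding \<Gamma>_def using gm by measurable
  have \<Gamma>le: "\<Gamma> x \<le> 2 * ennreal ((norm (G x))\<^sup>2) + 2 * (\<Sum>n. ennreal ((norm (G x - grad (\<phi> n) x))\<^sup>2))" for x
    unfolding \<Gamma>_def
  proof (rule SUP_least)
    fix n
    have "norm (grad (\<phi> n) x) \<le> norm (G x) + norm (G x - grad (\<phi> n) x)" by (metis diff_diff_eq2 add_diff_cancel_left' norm_triangle_ineq4)
    hence "(norm (grad (\<phi> n) x))\<^sup>2 \<le> (norm (G x) + norm (G x - grad (\<phi> n) x))\<^sup>2" by (intro power_mono) auto
    also have "\<dots> \<le> 2 * (norm (G x))\<^sup>2 + 2 * (norm (G x - grad (\<phi> n) x))\<^sup>2"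
      using zero_le_power2[of "norm (G x) - norm (G x - grad (\<phi> n) x)"] by (simp add: power2_sum power2_diff)
    finally have "ennreal ((norm (grad (\<phi> n) x))\<^sup>2) \<le> ennreal (2 * (norm (G x))\<^sup>2 + 2 * (norm (G x - grad (\<phi> n) x))\<^sup>2)" by (rule ennreal_leI)
    also have "\<dots> = 2 * ennreal ((norm (G x))\<^sup>2) + 2 * ennreal ((norm (G x - grad (\<phi> n) x))\<^sup>2)" by (simp add: ennreal_mult)
    also have "\<dots> \<le> 2 * ennreal ((norm (G x))\<^sup>2) + 2 * (\<Sum>n. ennreal ((norm (G x - grad (\<phi> n) x))\<^sup>2))"
    proof (intro add_left_mono mult_left_mono)
      have "(\<Sum>k\<in>{n}. ennreal ((norm (G x - grad (\<phi> k) x))\<^sup>2)) \<le> (\<Sum>k. ennreal ((norm (G x - grad (\<phi> k) x))\<^sup>2))"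
        by (rule sum_le_suminf) (rule summableI, rule finite.intros(2)[OF finite.intros(1)], rule zero_le)
      thus "ennreal ((norm (G x - grad (\<phi> n) x))\<^sup>2) \<le> (\<Sum>k. ennreal ((norm (G x - grad (\<phi> k) x))\<^sup>2))"
        by simp
    qed (rule zero_le)
    finally show "ennreal ((norm (grad (\<phi> n) x))\<^sup>2) \<le> 2 * ennreal ((norm (G x))\<^sup>2) + 2 * (\<Sum>n. ennreal ((norm (G x - grad (\<phi> n) x))\<^sup>2))" .
  qed
  have \<Gamma>0: "\<Gamma> x = 0" if "x \<notin> \<Omega>" for x
    unfolding \<Gamma>_def using test_function_grad_zero(2)[OF \<phi> that] by simp
  have "(\<integral>\<^sup>+y. \<Gamma> y \<partial>lborel) = (\<integral>\<^sup>+y. \<Gamma> y \<partial>lebesgue)" by (simp add: nn_integral_completion)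
  also have "\<dots> = (\<integral>\<^sup>+y. \<Gamma> y * indicator \<Omega> y \<partial>lebesgue)"
    by (intro nn_integral_cong) (auto simp: indicator_def \<Gamma>0)
  also have "\<dots> = (\<integral>\<^sup>+y. \<Gamma> y \<partial>?M)"
    using \<Omega> by (intro nn_integral_restrict_space[symmetric]) auto
  also have "\<dots> \<le> (\<integral>\<^sup>+x. 2 * ennreal ((norm (G x))\<^sup>2) + 2 * (\<Sum>n. ennreal ((norm (G x - grad (\<phi> n) x))\<^sup>2)) \<partial>?M)"
    by (intro nn_integral_mono \<Gamma>le)
  also have "\<dots> = 2 * (\<integral>\<^sup>+x. ennreal ((norm (G x))\<^sup>2) \<partial>?M) + 2 * (\<integral>\<^sup>+x. (\<Sum>n. ennreal ((norm (G x - grad (\<phi> n) x))\<^sup>2)) \<partial>?M)"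
    by (subst nn_integral_add) (auto simp: nn_integral_cmult)
  also have "\<dots> = 2 * (\<integral>\<^sup>+x. ennreal ((norm (G x))\<^sup>2) \<partial>?M) + 2 * (\<Sum>n. \<integral>\<^sup>+x. ennreal ((norm (G x - grad (\<phi> n) x))\<^sup>2) \<partial>?M)"
    by (subst nn_integral_suminf) auto
  also have "\<dots> \<le> 2 * (\<integral>\<^sup>+x. ennreal ((norm (G x))\<^sup>2) \<partial>?M) + 2 * (\<Sum>n. ennreal ((1/2)^n))"
    by (intro add_left_mono mult_left_mono suminf_le b2) auto
  also have "\<dots> < \<infinity>"
    using geo nn_integral_eq_integral[OF i3] by (simp add: ennreal_mult_less_top)
  finally have fin: "(\<integral>\<^sup>+y. \<Gamma> y \<partial>lborel) < \<infinity>" .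
  show ?thesis
    by (rule that[OF \<phi> \<Gamma>m fin _ lim]) (auto simp: \<Gamma>_def intro: SUP_upper)
qed

text \<open>The dilation about \<open>q\<close> by the factor \<open>t\<close> has Jacobian
  \<open>t\<close> to the power d, so for fixed \<open>t\<close> the integral over \<open>z\<close>
  is the reciprocal of that times the volume integral of \<open>f\<close>.\<close>

lemma nn_integral_lines:
  fixes f :: "'a::euclidean_space \<Rightarrow> ennreal"
  assumes [measurable]: "f \<in> borel_measurable borel" and w[measurable]: "w \<in> borel_measurable borel"
  shows "(\<integral>\<^sup>+z. (\<integral>\<^sup>+t\<in>{0<..}. w t * f (q + t *\<^sub>R (z - q)) \<partial>lborel) \<partial>lborel)
     = (\<integral>\<^sup>+t\<in>{0<..}. w t * ennreal ((1 / t) ^ DIM('a)) \<partial>lborel) * (\<integral>\<^sup>+y. f y \<partial>lborel)"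
proof -
  have inner: "(\<integral>\<^sup>+z. f (q + t *\<^sub>R (z - q)) \<partial>lborel) = ennreal ((1 / t) ^ DIM('a)) * (\<integral>\<^sup>+y. f y \<partial>lborel)" if t: "0 < t" for t
  proof -
    have e: "q + t *\<^sub>R (z - q) = (q - t *\<^sub>R q) + t *\<^sub>R z" for z by (simp add: algebra_simps)
    have "ennreal ((1 / t) ^ DIM('a)) * (\<integral>\<^sup>+y. f y \<partial>lborel) = ennreal ((1 / t) ^ DIM('a)) * (ennreal (t ^ DIM('a)) * (\<integral>\<^sup>+z. f (q + t *\<^sub>R (z - q)) \<partial>lborel))"
      unfolding e by (subst nn_integral_lborel_scale[OF _ t]) auto
    also have "\<dots> = ennreal ((1 / t) ^ DIM('a) * t ^ DIM('a)) * (\<integral>\<^sup>+z. f (q + t *\<^sub>R (z - q)) \<partial>lborel)"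
      using t by (subst ennreal_mult) (auto simp: mult.assoc)
    also have "(1 / t) ^ DIM('a) * t ^ DIM('a) = 1" using t by (simp add: power_mult_distrib[symmetric])
    finally show ?thesis by simp
  qed
  have "(\<integral>\<^sup>+z. (\<integral>\<^sup>+t\<in>{0<..}. w t * f (q + t *\<^sub>R (z - q)) \<partial>lborel) \<partial>lborel)
      = (\<integral>\<^sup>+t. (\<integral>\<^sup>+z. w t * f (q + t *\<^sub>R (z - q)) * indicator {0<..} t \<partial>lborel) \<partial>lborel)"
    by (rule nn_integral_lborel_swap) measurable
  also have "\<dots> = (\<integral>\<^sup>+t. (w t * ennreal ((1 / t) ^ DIM('a)) * indicator {0<..} t) * (\<integral>\<^sup>+y. f y \<partial>lborel) \<partial>lborel)"
  proof (rule nn_integral_cong)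
    fix t :: real
    show "(\<integral>\<^sup>+z. w t * f (q + t *\<^sub>R (z - q)) * indicator {0<..} t \<partial>lborel) = (w t * ennreal ((1 / t) ^ DIM('a)) * indicator {0<..} t) * (\<integral>\<^sup>+y. f y \<partial>lborel)"
    proof (cases "0 < t")
      case True
      thus ?thesis using inner[OF True] by (simp add: nn_integral_cmult mult.assoc)
    qed simp
  qed
  also have "\<dots> = (\<integral>\<^sup>+t\<in>{0<..}. w t * ennreal ((1 / t) ^ DIM('a)) \<partial>lborel) * (\<integral>\<^sup>+y. f y \<partial>lborel)"
    by (rule nn_integral_multc) measurable
  finally show ?thesis .
qed

section \<open>Finite element functions\<close>

context mesh_on_domain
begin

text \<open>Zero on the boundaries of the elements, which form a null set.\<close>
definition piecewise :: "('a set \<Rightarrow> 'a \<Rightarrow> real) \<Rightarrow> 'a \<Rightarrow> real" where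
  "piecewise w y = (\<Sum>K\<in>\<T>. w K y * indicator (interior K) y)"

lemma piecewise_eq:
  assumes K: "K \<in> \<T>" "y \<in> interior K" shows "piecewise w y = w K y"
proof -
  have "w L y * indicator (interior L) y = (if L = K then w K y else 0)" if "L \<in> \<T>" for L
    using element_interior_disjoint[OF that K(1)] K interior_subset[of K] by (auto simp: indicator_def)
  hence "piecewise w y = (\<Sum>L\<in>\<T>. if L = K then w K y else 0)" unfolding piecewise_def by (rule sum.cong[OF refl])
  thus ?thesis using finite_mesh K by simp
qed

lemma piecewise_none: "(\<And>K. K \<in> \<T> \<Longrightarrow> y \<notin> interior K) \<Longrightarrow> piecewise w y = 0"
  by (simp add: piecewise_def)

lemma piecewise_outside: "y \<notin> \<Omega> \<Longrightarrow> piecewise w y = 0"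
  using element_interior_subset_domain by (intro piecewise_none) blast

lemma piecewise_measurable:
  assumes "\<And>K. K \<in> \<T> \<Longrightarrow> continuous_on UNIV (w K)" shows "piecewise w \<in> borel_measurable borel"
proof -
  have "w K \<in> borel_measurable borel" if "K \<in> \<T>" for K using assms[OF that] by (rule borel_measurable_continuous_onI)
  thus ?thesis unfolding piecewise_def[abs_def] by (intro borel_measurable_sum borel_measurable_times) auto
qed

lemma line_eventually_interior:
  fixes U :: "'a set"
  assumes "q + t *\<^sub>R e \<in> U" "open U"
  shows "\<forall>\<^sub>F x in nhds t. q + x *\<^sub>R e \<in> U"
proof -
  have "isCont (\<lambda>x. q + x *\<^sub>R e) t" by (intro continuous_intros)
  hence "((\<lambda>x. q + x *\<^sub>R e) \<longlongrightarrow> q + t *\<^sub>R e) (nhds t)" by (simp add: isCont_def tendsto_nhds_iff)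
  from topological_tendstoD[OF this assms(2,1)] show ?thesis .
qed

lemma piecewise_line_tendsto:
  assumes K: "K \<in> \<T>" and c: "continuous_on UNIV (w K)" and ev: "\<forall>\<^sub>F t in at s within A. q + t *\<^sub>R e \<in> interior K"
  shows "((\<lambda>t. piecewise w (q + t *\<^sub>R e)) \<longlongrightarrow> w K (q + s *\<^sub>R e)) (at s within A)"
proof -
  have "isCont (w K) (q + s *\<^sub>R e)" using c by (simp add: continuous_on_eq_continuous_at)
  hence "((\<lambda>t. w K (q + t *\<^sub>R e)) \<longlongrightarrow> w K (q + s *\<^sub>R e)) (at s within A)"
    by (rule isCont_tendsto_compose) (intro tendsto_intros)
  moreover have "\<forall>\<^sub>F t in at s within A. w K (q + t *\<^sub>R e) = piecewise w (q + t *\<^sub>R e)"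
    using ev by eventually_elim (simp add: piecewise_eq[OF K])
  ultimately show ?thesis by (rule Lim_transform_eventually)
qed

lemma eventually_at_right_germ:
  fixes \<delta> :: real
  assumes "\<delta> > 0" "\<And>t. s < t \<Longrightarrow> t < s + \<delta> \<Longrightarrow> P t" shows "\<forall>\<^sub>F t in at_right s. P t"
  using eventually_at_right_real[of s "s + \<delta>"] assms by (auto elim!: eventually_mono)

lemma eventually_at_left_germ:
  fixes \<delta> :: real
  assumes "\<delta> > 0" "\<And>t. s - \<delta> < t \<Longrightarrow> t < s \<Longrightarrow> P t" shows "\<forall>\<^sub>F t in at_left s. P t"
  using eventually_at_left_real[of "s - \<delta>" s] assms by (auto elim!: eventually_mono)

end

locale finite_element_function = mesh_on_domain \<Omega> \<T>
  for \<Omega> :: "'a::euclidean_space set" and \<T> :: "'a set set" +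
  fixes k :: nat and v :: "'a \<Rightarrow> real"
  assumes fe: "v \<in> lagrange_space0 k \<Omega> \<T>"
begin

definition element_poly :: "'a set \<Rightarrow> 'a \<Rightarrow> real" where "element_poly K = local_poly k v K"

lemma element_poly_spec: assumes K: "K \<in> \<T>" shows "element_poly K \<in> poly_space k" "AE x in lebesgue_on K. v x = element_poly K x"
proof -
  obtain r where r: "r \<in> poly_space k" "AE x in lebesgue_on K. v x = r x"
    using fe K unfolding lagrange_space0_def lagrange_space_def by blast
  have "element_poly K = r" unfolding element_poly_def by (rule local_poly_eqI[OF element_closed[OF K] element_interior_nonempty[OF K] r])
  thus "element_poly K \<in> poly_space k" "AE x in lebesgue_on K. v x = element_poly K x" using r by auto
qed

lemma element_poly_poly: "K \<in> \<T> \<Longrightarrow> real_polynomial_function (element_poly K)"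
  using element_poly_spec poly_space_real_polynomial_function by blast

lemma element_poly_continuous: "K \<in> \<T> \<Longrightarrow> continuous_on A (element_poly K)"
  using element_poly_poly real_polynomial_function_continuous by blast

text \<open>Representatives that are defined everywhere, so that statements about a single line make
  sense although \<open>v\<close> matters only up to null sets.\<close>

definition fe_value where "fe_value = piecewise element_poly"
definition fe_deriv where "fe_deriv e = piecewise (\<lambda>K y. grad (element_poly K) y \<bullet> e)"
definition fe_second where "fe_second e = piecewise (\<lambda>K y. hess (element_poly K) y e)"
definition fe_hessian_sq where "fe_hessian_sq = piecewise (\<lambda>K. hessian_norm_sq (element_poly K))"

lemma fe_value_measurable[measurable]: "fe_value \<in> borel_measurable borel"
  unfolding fe_value_def by (rule piecewise_measurable) (rule element_poly_continuous)

lemma fe_deriv_continuous: "K \<in> \<T> \<Longrightarrow> continuous_on A (\<lambda>y. grad (element_poly K) y \<bullet> e)"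
  by (intro continuous_intros continuous_grad element_poly_poly)

lemma fe_second_continuous: "K \<in> \<T> \<Longrightarrow> continuous_on A (\<lambda>y. hess (element_poly K) y e)"
  unfolding hess_def by (intro continuous_intros continuous_grad real_polynomial_function_partial_deriv element_poly_poly)

lemma fe_second_measurable[measurable]: "fe_second e \<in> borel_measurable borel"
  unfolding fe_second_def by (rule piecewise_measurable) (rule fe_second_continuous)

lemma fe_hessian_sq_measurable[measurable]: "fe_hessian_sq \<in> borel_measurable borel"
  unfolding fe_hessian_sq_def by (rule piecewise_measurable) (intro real_polynomial_function_continuous real_polynomial_function_hessian_norm_sq element_poly_poly)

lemma fe_hessian_sq_nonneg: "0 \<le> fe_hessian_sq y"
  unfolding fe_hessian_sq_def piecewise_def by (intro sum_nonneg mult_nonneg_nonneg hessian_norm_sq_nonneg) auto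

lemma fe_second_le: "\<bar>fe_second e y\<bar> \<le> (norm e)\<^sup>2 * sqrt (fe_hessian_sq y)"
proof (cases "\<exists>K\<in>\<T>. y \<in> interior K")
  case True
  then obtain K where K: "K \<in> \<T>" "y \<in> interior K" by blast
  show ?thesis using hess_le[of "element_poly K" y e] by (simp add: fe_second_def fe_hessian_sq_def piecewise_eq[OF K])
next
  case False
  thus ?thesis using fe_hessian_sq_nonneg by (simp add: fe_second_def piecewise_none)
qed

lemma fe_hessian_sq_integral: "(\<integral>\<^sup>+y. ennreal (fe_hessian_sq y) \<partial>lborel) \<le> ennreal (\<Sum>K\<in>\<T>. integral\<^sup>L (lebesgue_on K) (hessian_norm_sq (element_poly K)))"
proof -
  have c: "continuous_on A (hessian_norm_sq (element_poly K))" if "K \<in> \<T>" for K A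
    by (intro real_polynomial_function_continuous real_polynomial_function_hessian_norm_sq element_poly_poly that)
  have m: "hessian_norm_sq (element_poly K) \<in> borel_measurable borel" if "K \<in> \<T>" for K
    using c[OF that] by (rule borel_measurable_continuous_onI)
  have "(\<integral>\<^sup>+y. ennreal (fe_hessian_sq y) \<partial>lborel) = (\<integral>\<^sup>+y. (\<Sum>K\<in>\<T>. ennreal (hessian_norm_sq (element_poly K) y) * indicator (interior K) y) \<partial>lborel)"
    unfolding fe_hessian_sq_def piecewise_def
    by (intro nn_integral_cong) (simp add: sum_ennreal[symmetric] hessian_norm_sq_nonneg ennreal_mult ennreal_indicator)
  also have "\<dots> = (\<Sum>K\<in>\<T>. \<integral>\<^sup>+y. ennreal (hessian_norm_sq (element_poly K) y) * indicator (interior K) y \<partial>lborel)"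
    using m by (intro nn_integral_sum) auto
  also have "\<dots> \<le> (\<Sum>K\<in>\<T>. ennreal (integral\<^sup>L (lebesgue_on K) (hessian_norm_sq (element_poly K))))"
  proof (rule sum_mono)
    fix K assume K: "K \<in> \<T>"
    have Ks: "K \<in> sets borel" by (intro borel_closed element_closed K)
    have "(\<integral>\<^sup>+y. ennreal (hessian_norm_sq (element_poly K) y) * indicator (interior K) y \<partial>lborel) \<le> (\<integral>\<^sup>+y. ennreal (hessian_norm_sq (element_poly K) y) * indicator K y \<partial>lborel)"
      using interior_subset[of K] by (intro nn_integral_mono) (auto simp: indicator_def)
    also have "\<dots> = (\<integral>\<^sup>+y. ennreal (hessian_norm_sq (element_poly K) y) * indicator K y \<partial>lebesgue)"
      using m[OF K] Ks by (simp add: nn_integral_completion)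
    also have "\<dots> = (\<integral>\<^sup>+y. ennreal (hessian_norm_sq (element_poly K) y) \<partial>lebesgue_on K)"
      using Ks by (intro nn_integral_restrict_space[symmetric]) simp
    also have "\<dots> = ennreal (integral\<^sup>L (lebesgue_on K) (hessian_norm_sq (element_poly K)))"
    proof (rule nn_integral_eq_integral)
      have "integrable lborel (\<lambda>x. indicator K x *\<^sub>R hessian_norm_sq (element_poly K) x)"
        by (rule borel_integrable_compact[OF element_compact[OF K] c[OF K]])
      hence "integrable lebesgue (\<lambda>x. indicator K x *\<^sub>R hessian_norm_sq (element_poly K) x)"
        using m[OF K] Ks by (subst integrable_completion) auto
      thus "integrable (lebesgue_on K) (hessian_norm_sq (element_poly K))"
        using Ks by (subst integrable_restrict_space) (auto simp: set_integrable_def)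
    qed (simp add: hessian_norm_sq_nonneg)
    finally show "(\<integral>\<^sup>+y. ennreal (hessian_norm_sq (element_poly K) y) * indicator (interior K) y \<partial>lborel) \<le> ennreal (integral\<^sup>L (lebesgue_on K) (hessian_norm_sq (element_poly K)))" .
  qed
  also have "\<dots> = ennreal (\<Sum>K\<in>\<T>. integral\<^sup>L (lebesgue_on K) (hessian_norm_sq (element_poly K)))"
    by (rule sum_ennreal) (simp add: hessian_norm_sq_nonneg integral_nonneg_AE)
  finally show ?thesis .
qed

lemma AE_lebesgue_on: "A \<in> sets lebesgue \<Longrightarrow> (AE x in lebesgue_on A. P x) \<longleftrightarrow> (AE x in lebesgue. x \<in> A \<longrightarrow> P x)"
  by (subst AE_restrict_space_iff) auto

text \<open>Boundaries of convex sets are null, so the default value 0 of \<open>piecewise\<close>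
  on them is harmless.\<close>

lemma AE_V: "AE y in lebesgue. y \<in> \<Omega> \<longrightarrow> v y = fe_value y"
proof -
  have 1: "AE y in lebesgue. \<forall>K\<in>\<T>. y \<in> K \<longrightarrow> v y = element_poly K y"
    using finite_mesh
  proof (rule AE_finite_allI)
    fix K assume K: "K \<in> \<T>"
    show "AE y in lebesgue. y \<in> K \<longrightarrow> v y = element_poly K y"
      using element_poly_spec(2)[OF K] element_closed[OF K] by (subst (asm) AE_lebesgue_on) auto
  qed
  have 2: "AE y in lebesgue. \<forall>K\<in>\<T>. y \<notin> frontier K"
    using finite_mesh
  proof (rule AE_finite_allI)
    fix K assume K: "K \<in> \<T>"
    have "negligible (frontier K)" using element_convex[OF K] by (rule negligible_convex_frontier)
    hence "frontier K \<in> null_sets lebesgue" by (simp add: negligible_iff_null_sets)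
    thus "AE y in lebesgue. y \<notin> frontier K" by (rule AE_not_in)
  qed
  show ?thesis using 1 2
  proof eventually_elim
    case (elim y)
    show ?case
    proof
      assume "y \<in> \<Omega>"
      then obtain K where K: "K \<in> \<T>" "y \<in> K" using union_mesh closure_subset by blast
      hence "y \<in> interior K" using elim(2) closure_subset by (auto simp: frontier_def)
      thus "v y = fe_value y" using elim(1) K piecewise_eq[of K y element_poly] by (simp add: fe_value_def)
    qed
  qed
qed

text \<open>A limit is required, not continuity: \<open>fe_value\<close> is zero on element
  boundaries by convention, so its value at a break carries no information. Parameter 0 is left out
  because the energy on lines is not controlled near the pole.\<close>

definition good_line :: "'a \<Rightarrow> 'a \<Rightarrow> bool" where
  "good_line q e \<longleftrightarrow> generic_line q e \<and> (\<forall>t\<in>{0<..<2}. \<exists>l. ((\<lambda>t. fe_value (q + t *\<^sub>R e)) \<longlongrightarrow> l) (at t))"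

text \<open>Off the breaks the point is interior to an element or outside the closure of
  \<open>\<Omega>\<close>, where the function is locally zero.\<close>

lemma isCont_line:
  assumes t: "t \<notin> breaks q e"
  shows "isCont (\<lambda>t. fe_value (q + t *\<^sub>R e)) t"
proof (cases "\<exists>K\<in>\<T>. q + t *\<^sub>R e \<in> interior K")
  case True
  then obtain K where K: "K \<in> \<T>" "q + t *\<^sub>R e \<in> interior K" by blast
  have "\<forall>\<^sub>F x in nhds t. q + x *\<^sub>R e \<in> interior K" by (rule line_eventually_interior[OF K(2) open_interior])
  hence "\<forall>\<^sub>F x in at t. q + x *\<^sub>R e \<in> interior K" by (simp add: eventually_at_filter eventually_mono)
  from piecewise_line_tendsto[where w = element_poly, OF K(1) element_poly_continuous[OF K(1)] this]
  show ?thesis by (simp add: isCont_def fe_value_def piecewise_eq[OF K])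
next
  case False
  have "q + t *\<^sub>R e \<notin> K" if "K \<in> \<T>" for K
    using False t that closure_subset[of K] by (auto simp: breaks_def frontier_def)
  hence "q + t *\<^sub>R e \<in> - closure \<Omega>" using union_mesh by blast
  hence "\<forall>\<^sub>F x in nhds t. q + x *\<^sub>R e \<in> - closure \<Omega>" by (rule line_eventually_interior) (simp add: open_Compl)
  hence "\<forall>\<^sub>F x in nhds t. fe_value (q + x *\<^sub>R e) = 0"
    by eventually_elim (use closure_subset in \<open>auto simp: fe_value_def intro!: piecewise_outside\<close>)
  hence "isCont (\<lambda>x. fe_value (q + x *\<^sub>R e)) t \<longleftrightarrow> isCont (\<lambda>x. 0::real) t" by (intro isCont_cong)
  thus ?thesis by simp
qed

text \<open>Almost every line through \<open>q\<close> is generic, has the test functions converging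
  almost everywhere on it, and has finite energy away from the pole. The last two properties give
  uniform continuity off a null set; the first leaves only finitely many parameters to treat by
  extension.\<close>

lemma AE_good_line:
  assumes q: "generic_point q"
  shows "AE z in lborel. good_line q (z - q)"
proof -
  have v0: "v \<in> H1_0 \<Omega>" using fe by (simp add: lagrange_space0_def)
  obtain \<phi> \<Gamma> where \<phi>: "\<And>n::nat. \<phi> n \<in> test_functions \<Omega>" and \<Gamma>m[measurable]: "\<Gamma> \<in> borel_measurable borel"
    and \<Gamma>fin: "(\<integral>\<^sup>+y. \<Gamma> y \<partial>lborel) < \<infinity>" and \<Gamma>: "\<And>n y. ennreal ((norm (grad (\<phi> n) y))\<^sup>2) \<le> \<Gamma> y"
    and lim: "AE y in lebesgue_on \<Omega>. (\<lambda>n. \<phi> n y) \<longlonglongrightarrow> v y"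
    using H1_0_approximation[OF open_domain bounded_domain v0] by blast
  have \<phi>m[measurable]: "\<phi> n \<in> borel_measurable borel" for n
    using test_function_continuous[OF \<phi>] by (rule borel_measurable_continuous_onI)
  have "AE y in lebesgue. y \<in> \<Omega> \<longrightarrow> (\<lambda>n. \<phi> n y) \<longlonglongrightarrow> v y"
    using lim open_domain by (subst (asm) AE_lebesgue_on) auto
  hence "AE y in lebesgue. (\<lambda>n. \<phi> n y) \<longlonglongrightarrow> fe_value y" using AE_V
  proof eventually_elim
    case (elim y)
    show ?case
    proof (cases "y \<in> \<Omega>")
      case False
      thus ?thesis using test_function_zero[OF \<phi> False] piecewise_outside[OF False] by (simp add: fe_value_def)
    qed (use elim in simp)
  qed
  hence limV: "AE y in lborel. (\<lambda>n. \<phi> n y) \<longlonglongrightarrow> fe_value y" by (simp add: AE_completion_iff)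
  define B where "B = {y. \<not> (\<lambda>n. \<phi> n y) \<longlonglongrightarrow> fe_value y}"
  have Bm[measurable]: "B \<in> sets borel"
  proof -
    have "{y \<in> space borel. (\<lambda>n. \<phi> n y) \<longlonglongrightarrow> fe_value y} \<in> sets borel" by measurable
    moreover have "B = space borel - {y \<in> space borel. (\<lambda>n. \<phi> n y) \<longlonglongrightarrow> fe_value y}" by (auto simp: B_def)
    ultimately show ?thesis by (metis sets.compl_sets)
  qed
  have B0: "(\<integral>\<^sup>+y. indicator B y \<partial>lborel) = 0"
    using limV by (subst nn_integral_0_iff_AE) (auto simp: B_def indicator_def elim!: eventually_mono)
  have a1: "AE z in lborel. generic_line q (z - q)"
  proof -
    have "AE z in lebesgue. z \<notin> {z. \<not> generic_line q (z - q)}"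
      using negligible_nongeneric_line[OF q] by (intro AE_not_in) (simp add: negligible_iff_null_sets)
    thus ?thesis by (simp add: AE_completion_iff)
  qed
  \<comment> \<open>The Jacobian integral over all positive \<open>t\<close> is infinite, but in
    \<open>ennreal\<close> its product with the measure 0 of \<open>B\<close> is 0.\<close>
  have a2: "AE z in lborel. AE t in lborel. t > 0 \<longrightarrow> q + t *\<^sub>R (z - q) \<notin> B"
  proof -
    have "(\<integral>\<^sup>+z. (\<integral>\<^sup>+t\<in>{0<..}. 1 * indicator B (q + t *\<^sub>R (z - q)) \<partial>lborel) \<partial>lborel) = 0"
      unfolding nn_integral_lines[OF borel_measurable_indicator[OF Bm] borel_measurable_const] B0 by simp
    hence "AE z in lborel. (\<integral>\<^sup>+t\<in>{0<..}. 1 * indicator B (q + t *\<^sub>R (z - q)) \<partial>lborel) = 0"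
      by (subst (asm) nn_integral_0_iff_AE) auto
    thus ?thesis
    proof eventually_elim
      case (elim z)
      hence "AE t in lborel. 1 * indicator B (q + t *\<^sub>R (z - q)) * indicator {0<..} t = (0::ennreal)"
        by (subst (asm) nn_integral_0_iff_AE) auto
      thus ?case by eventually_elim (auto simp: indicator_def split: if_splits)
    qed
  qed
  \<comment> \<open>The factor \<open>(1 / t) ^ DIM('a)\<close> is not integrable at 0; the
    intervals starting at \<open>1 / (real m + 1)\<close> stay away from 0 and together exhaust the
    parameters between 0 and 2.\<close>
  have a3: "AE z in lborel. \<forall>m::nat. (\<integral>\<^sup>+t\<in>{1 / (real m + 1)<..<2}. \<Gamma> (q + t *\<^sub>R (z - q)) \<partial>lborel) \<noteq> \<infinity>"
    unfolding AE_all_countable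
  proof
    fix m :: nat
    let ?c = "1 / (real m + 1)"
    let ?w = "indicator {?c<..<2} :: real \<Rightarrow> ennreal"
    have c: "?c > 0" by simp
    have "(\<integral>\<^sup>+t\<in>{0<..}. ?w t * ennreal ((1 / t) ^ DIM('a)) \<partial>lborel) \<le> (\<integral>\<^sup>+t. ennreal ((1 / ?c) ^ DIM('a)) * ?w t \<partial>lborel)"
    proof (rule nn_integral_mono)
      fix t :: real
      show "?w t * ennreal ((1 / t) ^ DIM('a)) * indicator {0<..} t \<le> ennreal ((1 / ?c) ^ DIM('a)) * ?w t"
      proof (cases "t \<in> {?c<..<2}")
        case True
        hence tc: "?c < t" by simp
        hence "0 < t" using c by linarith
        hence "(1 / t) ^ DIM('a) \<le> (1 / ?c) ^ DIM('a)" using c tc \<open>0 < t\<close> by (intro power_mono divide_left_mono mult_pos_pos) auto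
        hence "ennreal ((1 / t) ^ DIM('a)) \<le> ennreal ((1 / ?c) ^ DIM('a))" by (rule ennreal_leI)
        thus ?thesis using True \<open>0 < t\<close> by simp
      qed simp
    qed
    also have "\<dots> = ennreal ((1 / ?c) ^ DIM('a)) * emeasure lborel {?c<..<2}"
      by (rule nn_integral_cmult_indicator) simp
    also have "\<dots> < \<infinity>" by (cases "?c \<le> 2") (simp_all add: ennreal_mult_less_top)
    finally have f: "(\<integral>\<^sup>+t\<in>{0<..}. ?w t * ennreal ((1 / t) ^ DIM('a)) \<partial>lborel) < \<infinity>" .
    have "(\<integral>\<^sup>+z. (\<integral>\<^sup>+t\<in>{0<..}. ?w t * \<Gamma> (q + t *\<^sub>R (z - q)) \<partial>lborel) \<partial>lborel) < \<infinity>"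
      using f \<Gamma>fin by (subst nn_integral_lines) (auto simp: ennreal_mult_less_top)
    hence "AE z in lborel. (\<integral>\<^sup>+t\<in>{0<..}. ?w t * \<Gamma> (q + t *\<^sub>R (z - q)) \<partial>lborel) \<noteq> \<infinity>"
      by (intro nn_integral_PInf_AE) auto
    thus "AE z in lborel. (\<integral>\<^sup>+t\<in>{?c<..<2}. \<Gamma> (q + t *\<^sub>R (z - q)) \<partial>lborel) \<noteq> \<infinity>"
    proof eventually_elim
      case (elim z)
      have "(\<integral>\<^sup>+t\<in>{?c<..<2}. \<Gamma> (q + t *\<^sub>R (z - q)) \<partial>lborel) = (\<integral>\<^sup>+t\<in>{0<..}. ?w t * \<Gamma> (q + t *\<^sub>R (z - q)) \<partial>lborel)"
      proof (intro nn_integral_cong)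
        fix t :: real
        have "0 < t" if "?c < t" using c that by linarith
        thus "\<Gamma> (q + t *\<^sub>R (z - q)) * ?w t = ?w t * \<Gamma> (q + t *\<^sub>R (z - q)) * indicator {0<..} t"
          by (auto simp: indicator_def)
      qed
      thus ?case using elim by simp
    qed
  qed
  show ?thesis using a1 a2 a3
  proof eventually_elim
    case (elim z)
    let ?e = "z - q" and ?g = "\<lambda>t. fe_value (q + t *\<^sub>R (z - q))"
    have "\<exists>l. (?g \<longlongrightarrow> l) (at t)" if t: "t \<in> {0<..<2}" for t
    proof -
      obtain m :: nat where m: "1 / (real m + 1) < t"
        using t nat_approx_posE[of t] by (auto simp: add.commute)
      let ?c = "1 / (real m + 1)"
      obtain N where N: "{x \<in> space lborel. \<not> (x > 0 \<longrightarrow> q + x *\<^sub>R (z - q) \<notin> B)} \<subseteq> N" "N \<in> null_sets lborel"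
        using elim(2) by (auto simp: eventually_ae_filter)
      \<comment> \<open>Bounds the line energies of all test functions at once, since the derivative
        along the line is at most the length of the direction times that of the gradient.\<close>
      define Y where "Y = (norm ?e)\<^sup>2 * enn2real (\<integral>\<^sup>+t\<in>{?c<..<2}. \<Gamma> (q + t *\<^sub>R (z - q)) \<partial>lborel)"
      have Yen: "ennreal Y = ennreal ((norm ?e)\<^sup>2) * (\<integral>\<^sup>+t\<in>{?c<..<2}. \<Gamma> (q + t *\<^sub>R (z - q)) \<partial>lborel)"
        using elim(3)[rule_format, of m] by (simp add: Y_def ennreal_mult ennreal_enn2real less_top)
      have uc: "uniformly_continuous_on ({?c<..<2} - N) ?g"
      proof (rule bounded_energy_limit_uniformly_continuous[where f = "\<lambda>n t. \<phi> n (q + t *\<^sub>R ?e)" and f' = "\<lambda>n t. grad (\<phi> n) (q + t *\<^sub>R ?e) \<bullet> ?e" and Y = Y])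
        show "((\<lambda>t. \<phi> n (q + t *\<^sub>R ?e)) has_real_derivative grad (\<phi> n) (q + t *\<^sub>R ?e) \<bullet> ?e) (at t)" for n t
          by (rule has_derivative_along_line[OF test_function_differentiable[OF \<phi>]])
        show "continuous_on UNIV (\<lambda>t. grad (\<phi> n) (q + t *\<^sub>R ?e) \<bullet> ?e)" for n
          by (intro continuous_intros continuous_on_compose2[OF test_function_grad_continuous[OF \<phi>]]) auto
        show "(\<integral>\<^sup>+t\<in>{?c<..<2}. ennreal ((grad (\<phi> n) (q + t *\<^sub>R ?e) \<bullet> ?e)\<^sup>2) \<partial>lborel) \<le> ennreal Y" for n
        proof -
          have "ennreal ((grad (\<phi> n) y \<bullet> ?e)\<^sup>2) \<le> ennreal ((norm ?e)\<^sup>2) * \<Gamma> y" for y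
          proof -
            have "\<bar>grad (\<phi> n) y \<bullet> ?e\<bar>\<^sup>2 \<le> (norm (grad (\<phi> n) y) * norm ?e)\<^sup>2"
              by (intro power_mono Cauchy_Schwarz_ineq2) auto
            hence "ennreal ((grad (\<phi> n) y \<bullet> ?e)\<^sup>2) \<le> ennreal ((norm ?e)\<^sup>2 * (norm (grad (\<phi> n) y))\<^sup>2)"
              by (intro ennreal_leI) (simp add: power_mult_distrib mult.commute)
            also have "\<dots> = ennreal ((norm ?e)\<^sup>2) * ennreal ((norm (grad (\<phi> n) y))\<^sup>2)" by (rule ennreal_mult) auto
            also have "\<dots> \<le> ennreal ((norm ?e)\<^sup>2) * \<Gamma> y" by (intro mult_left_mono \<Gamma>) auto
            finally show ?thesis .
          qed
          hence "(\<integral>\<^sup>+t\<in>{?c<..<2}. ennreal ((grad (\<phi> n) (q + t *\<^sub>R ?e) \<bullet> ?e)\<^sup>2) \<partial>lborel) \<le> (\<integral>\<^sup>+t. ennreal ((norm ?e)\<^sup>2) * (\<Gamma> (q + t *\<^sub>R ?e) * indicator {?c<..<2} t) \<partial>lborel)"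
            by (intro nn_integral_mono) (auto simp: indicator_def)
          also have "\<dots> = ennreal Y" unfolding Yen by (rule nn_integral_cmult) measurable
          finally show ?thesis .
        qed
        show "(\<lambda>n. \<phi> n (q + t *\<^sub>R ?e)) \<longlonglongrightarrow> ?g t" if "t \<in> {?c<..<2} - N" for t
        proof -
          have "t > 0" using that by (meson Diff_iff divide_pos_pos greaterThanLessThan_iff less_trans of_nat_0_le_iff add_nonneg_pos zero_less_one)
          thus ?thesis using N(1) that by (auto simp: B_def)
        qed
      qed (auto simp: Y_def)
      show ?thesis
        by (rule uniformly_continuous_extension_off_finite[OF _ N(2) finite_breaks[OF elim(1)] uc])
           (use m t isCont_line in auto)
    qed
    thus ?case using elim(1) by (simp add: good_line_def)
  qed
qed


text \<open>Continuity is known only along almost every line. A line through a generic pole and a point near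
  \<open>y\<close> crosses the facet near \<open>y\<close>, so the two polynomials agree on a dense set of points of the facet.\<close>
lemma facet_continuity:
  assumes K: "K \<in> \<T>" "K' \<in> \<T>" "K \<noteq> K'" and F: "F facet_of K" "F facet_of K'"
    and y: "y \<in> rel_interior F" "y \<in> \<Omega>"
  shows "element_poly K y = element_poly K' y"
proof (rule ccontr)
  assume ne: "element_poly K y \<noteq> element_poly K' y"
  obtain q where q: "generic_point q"
    using negligible_nongeneric_point non_negligible_UNIV by (metis (mono_tags, lifting) UNIV_eq_I mem_Collect_eq)
  let ?n = "outward_normal K F"
  obtain b where b: "affine hull F = {x. ?n \<bullet> x = b}"
    using element_facet_normal[OF K(1) F(1)] by metis
  have "F face_of K" "aff_dim F < int DIM('a)" using F element_aff_dim K by (auto simp: facet_of_def)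
  hence "q \<notin> affine hull F" using q K by (auto simp: generic_point_def)
  hence a: "?n \<bullet> q \<noteq> b" by (simp add: b)
  have ny: "?n \<bullet> y = b" using y(1) rel_interior_subset hull_subset[of F affine] b by blast
  \<comment> \<open>The parameter at which the line through \<open>q\<close> and \<open>z\<close>
    meets the plane of \<open>F\<close>; \<open>Y z\<close> is the crossing point. Both are
    continuous at \<open>y\<close>, with \<open>s y = 1\<close> and \<open>Y y = y\<close>.\<close>
  define s where "s = (\<lambda>z. (b - ?n \<bullet> q) / (?n \<bullet> (z - q)))"
  define Y where "Y = (\<lambda>z. q + s z *\<^sub>R (z - q))"
  have nyq: "?n \<bullet> (y - q) = b - ?n \<bullet> q" by (simp add: inner_diff_right ny)
  have sy: "s y = 1" using a by (simp add: s_def nyq)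
  have Yy: "Y y = y" by (simp add: Y_def sy)
  have cs: "isCont s y" unfolding s_def using a nyq by (intro continuous_intros) auto
  have cY: "isCont Y y" unfolding Y_def by (intro continuous_intros cs)
  have ls: "(s \<longlongrightarrow> 1) (nhds y)" using cs by (simp add: isCont_def tendsto_nhds_iff sy)
  have lY: "(Y \<longlongrightarrow> y) (nhds y)" using cY by (simp add: isCont_def tendsto_nhds_iff Yy)
  obtain r where r: "r > 0" "ball y r \<inter> affine hull F \<subseteq> rel_interior F"
  proof -
    have "openin (top_of_set (affine hull F)) (rel_interior F)" by (rule openin_rel_interior)
    then obtain U where "open U" "rel_interior F = affine hull F \<inter> U" by (auto simp: openin_open)
    thus ?thesis using that y(1) open_contains_ball by (metis Int_commute Int_iff Int_mono order_refl)
  qed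
  have D: "isCont (\<lambda>z. element_poly K (Y z) - element_poly K' (Y z)) y"
  proof -
    have "isCont (element_poly L) (Y y)" if "L \<in> \<T>" for L using element_poly_continuous[OF that, of UNIV] by (simp add: continuous_on_eq_continuous_at)
    thus ?thesis using K by (intro continuous_intros isCont_o2[OF cY]) auto
  qed
  have lD: "((\<lambda>z. element_poly K (Y z) - element_poly K' (Y z)) \<longlongrightarrow> element_poly K y - element_poly K' y) (nhds y)" using D by (simp add: isCont_def tendsto_nhds_iff Yy)
  have e1: "\<forall>\<^sub>F z in nhds y. s z \<in> {0<..<2}" by (rule topological_tendstoD[OF ls]) auto
  have e2: "\<forall>\<^sub>F z in nhds y. Y z \<in> \<Omega> \<inter> ball y r" by (rule topological_tendstoD[OF lY]) (use y r open_domain in auto)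
  have e3: "\<forall>\<^sub>F z in nhds y. element_poly K (Y z) - element_poly K' (Y z) \<in> - {0}" by (rule topological_tendstoD[OF lD]) (use ne in auto)
  have "\<forall>\<^sub>F z in nhds y. s z \<in> {0<..<2} \<and> Y z \<in> \<Omega> \<inter> ball y r \<and> element_poly K (Y z) - element_poly K' (Y z) \<in> - {0}"
    using e1 e2 e3 by eventually_elim auto
  then obtain U where U: "open U" "y \<in> U" "\<And>z. z \<in> U \<Longrightarrow> s z \<in> {0<..<2} \<and> Y z \<in> \<Omega> \<inter> ball y r \<and> element_poly K (Y z) - element_poly K' (Y z) \<in> - {0}"
    unfolding eventually_nhds by blast
  \<comment> \<open>Good lines have full measure, so the nonempty open set \<open>U\<close> contains
    a point \<open>z\<close> that defines one.\<close>
  obtain z where z: "z \<in> U" "good_line q (z - q)"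
  proof -
    obtain N where N: "{z \<in> space lborel. \<not> good_line q (z - q)} \<subseteq> N" "N \<in> null_sets lborel"
      using AE_good_line[OF q] unfolding eventually_ae_filter by auto
    have "negligible N" using N by (simp add: negligible_iff_null_sets null_sets_completionI)
    hence "\<not> U \<subseteq> N" using open_not_negligible[OF U(1)] U(2) negligible_subset by blast
    thus ?thesis using that N(1) by auto
  qed
  have z3: "0 < s z" "s z < 2" "Y z \<in> \<Omega>" "Y z \<in> ball y r" "element_poly K (Y z) \<noteq> element_poly K' (Y z)" using U(3)[OF z(1)] by auto
  have "?n \<bullet> (z - q) \<noteq> 0" using z3(1) by (auto simp: s_def)
  hence "?n \<bullet> Y z = b" by (simp add: Y_def inner_add_right s_def)
  hence YF: "Y z \<in> rel_interior F" using r(2) z3(4) b by auto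
  have YF2: "Y z \<in> F" using YF rel_interior_subset by blast
  have YK: "Y z \<in> K" using YF2 F face_of_imp_subset by (auto simp: facet_of_def)
  have "F \<inter> interior K = {}" using F face_of_disjoint_interior by (metis facet_of_def facet_of_irrefl)
  hence "Y z \<in> frontier K" using YF2 YK closure_subset by (auto simp: frontier_def)
  hence br: "s z \<in> breaks q (z - q)" using K by (auto simp: breaks_def Y_def)
  have gl: "generic_line q (z - q)" using z by (simp add: good_line_def)
  have Yo: "q + s z *\<^sub>R (z - q) \<in> \<Omega>" using z3 by (simp add: Y_def)
  \<comment> \<open>The elements on the two sides of the crossing share \<open>F\<close> and are
    therefore \<open>K\<close> and \<open>K'\<close> in some order; the limit along the line equates
    their polynomials at \<open>Y z\<close>.\<close>
  obtain K1 K2 F' \<delta> where c: "K1 \<in> \<T>" "K2 \<in> \<T>" "K1 \<noteq> K2" "F' facet_of K1" "F' facet_of K2" "q + s z *\<^sub>R (z - q) \<in> rel_interior F'"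
    "\<delta> > 0" "\<And>t. s z - \<delta> < t \<Longrightarrow> t < s z \<Longrightarrow> q + t *\<^sub>R (z - q) \<in> interior K1" "\<And>t. s z < t \<Longrightarrow> t < s z + \<delta> \<Longrightarrow> q + t *\<^sub>R (z - q) \<in> interior K2"
    by (rule generic_line_crossing[OF gl Yo br]) blast
  have Y12: "Y z \<in> K1" "Y z \<in> K2" using c(4-6) rel_interior_subset[of F'] face_of_imp_subset by (auto simp: facet_of_def Y_def)
  have "F facet_of K1" "F facet_of K2" using facet_of_touching_element[OF K(1) _ F(1) YF] c Y12 by auto
  hence "{K1, K2} = {K, K'}" using elements_at_facet[OF K F] c(1-3) by (auto simp: doubleton_eq_iff)
  moreover obtain l where l: "((\<lambda>t. fe_value (q + t *\<^sub>R (z - q))) \<longlongrightarrow> l) (at (s z))"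
    using z(2) z3(1,2) unfolding good_line_def greaterThanLessThan_iff[symmetric] by (meson greaterThanLessThan_iff)
  have "((\<lambda>t. fe_value (q + t *\<^sub>R (z - q))) \<longlongrightarrow> element_poly K1 (Y z)) (at_left (s z))"
    unfolding fe_value_def Y_def by (rule piecewise_line_tendsto[where w = element_poly, OF c(1) element_poly_continuous[OF c(1)]], rule eventually_at_left_germ[OF c(7,8)])
  moreover have "((\<lambda>t. fe_value (q + t *\<^sub>R (z - q))) \<longlongrightarrow> element_poly K2 (Y z)) (at_right (s z))"
    unfolding fe_value_def Y_def by (rule piecewise_line_tendsto[where w = element_poly, OF c(2) element_poly_continuous[OF c(2)]], rule eventually_at_right_germ[OF c(7,9)])
  moreover have "((\<lambda>t. fe_value (q + t *\<^sub>R (z - q))) \<longlongrightarrow> l) (at_left (s z))" "((\<lambda>t. fe_value (q + t *\<^sub>R (z - q))) \<longlongrightarrow> l) (at_right (s z))"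
    using l by (auto intro: filterlim_mono[OF _ order_refl] simp: at_le)
  ultimately have "element_poly K1 (Y z) = element_poly K2 (Y z)"
    by (metis tendsto_unique trivial_limit_at_left_real trivial_limit_at_right_real)
  thus False using z3(5) \<open>{K1, K2} = {K, K'}\<close> by (auto simp: doubleton_eq_iff)
qed

definition normal_jump :: "'a set \<Rightarrow> 'a \<Rightarrow> real" where
  "normal_jump F = jump \<T> (\<lambda>K. grad (element_poly K)) F"

text \<open>By continuity the tangential derivatives agree, so the gradient jumps only in the normal
  direction.\<close>
lemma gradient_jump:
  assumes K: "K \<in> \<T>" "K' \<in> \<T>" "K \<noteq> K'" and F: "F facet_of K" "F facet_of K'"
    and y: "y \<in> rel_interior F" "y \<in> \<Omega>"
  shows "\<bar>grad (element_poly K') y \<bullet> e - grad (element_poly K) y \<bullet> e\<bar> = \<bar>outward_normal K F \<bullet> e\<bar> * \<bar>normal_jump F y\<bar>"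
proof -
  let ?n = "outward_normal K F" and ?D = "\<lambda>x. element_poly K' x - element_poly K x"
  obtain b where b: "norm ?n = 1" "affine hull F = {x. ?n \<bullet> x = b}"
    using element_facet_normal[OF K(1) F(1)] by metis
  have nn: "?n \<bullet> ?n = 1" using b by (simp add: norm_eq_1)
  have ny: "?n \<bullet> y = b" using y(1) rel_interior_subset hull_subset[of F affine] b by blast
  \<comment> \<open>The part of \<open>e\<close> tangential to the facet. Along it the two
    polynomials coincide near \<open>y\<close>, so the derivatives in this direction agree.\<close>
  define \<tau> where "\<tau> = e - (?n \<bullet> e) *\<^sub>R ?n"
  have nt: "?n \<bullet> \<tau> = 0" by (simp add: \<tau>_def inner_diff_right nn)
  have "openin (top_of_set (affine hull F)) (rel_interior F)" by (rule openin_rel_interior)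
  then obtain U where U: "open U" "rel_interior F = affine hull F \<inter> U" by (auto simp: openin_open)
  have "y + 0 *\<^sub>R \<tau> \<in> U \<inter> \<Omega>" using y U by auto
  hence "\<forall>\<^sub>F t in nhds 0. y + t *\<^sub>R \<tau> \<in> U \<inter> \<Omega>" by (rule line_eventually_interior) (use U open_domain in auto)
  hence ev: "\<forall>\<^sub>F t in nhds 0. element_poly K' (y + t *\<^sub>R \<tau>) - element_poly K (y + t *\<^sub>R \<tau>) = 0"
  proof eventually_elim
    case (elim t)
    have "y + t *\<^sub>R \<tau> \<in> affine hull F" by (simp add: b inner_add_right ny nt)
    hence "y + t *\<^sub>R \<tau> \<in> rel_interior F" using U elim by blast
    thus ?case using facet_continuity[OF K F] elim by simp
  qed
  have d: "((\<lambda>t. element_poly L (y + t *\<^sub>R \<tau>)) has_real_derivative grad (element_poly L) (y + 0 *\<^sub>R \<tau>) \<bullet> \<tau>) (at 0)" if "L \<in> \<T>" for L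
    by (rule has_derivative_along_line[OF real_polynomial_function_differentiable[OF element_poly_poly[OF that]]])
  have "((\<lambda>t. element_poly K' (y + t *\<^sub>R \<tau>) - element_poly K (y + t *\<^sub>R \<tau>)) has_real_derivative (grad (element_poly K') (y + 0 *\<^sub>R \<tau>) \<bullet> \<tau> - grad (element_poly K) (y + 0 *\<^sub>R \<tau>) \<bullet> \<tau>)) (at 0)"
    by (intro derivative_intros d K)
  moreover have "((\<lambda>t. element_poly K' (y + t *\<^sub>R \<tau>) - element_poly K (y + t *\<^sub>R \<tau>)) has_real_derivative 0) (at 0)"
  proof -
    have "((\<lambda>t. 0::real) has_real_derivative 0) (at 0)" by simp
    thus ?thesis using DERIV_cong_ev[OF refl ev refl, of 0] by blast
  qed
  ultimately have t0: "grad (element_poly K') y \<bullet> \<tau> - grad (element_poly K) y \<bullet> \<tau> = 0" using DERIV_unique by fastforce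
  have e: "e = (?n \<bullet> e) *\<^sub>R ?n + \<tau>" by (simp add: \<tau>_def)
  have 1: "g \<bullet> e = (?n \<bullet> e) * (g \<bullet> ?n) + g \<bullet> \<tau>" for g by (subst e) (simp add: inner_add_right)
  have 2: "grad (element_poly K') y \<bullet> e - grad (element_poly K) y \<bullet> e = (?n \<bullet> e) * (grad (element_poly K') y \<bullet> ?n - grad (element_poly K) y \<bullet> ?n)"
    by (subst right_diff_distrib) (use 1[of "grad (element_poly K') y"] 1[of "grad (element_poly K) y"] t0 in linarith)
  have "normal_jump F y = grad (element_poly K) y \<bullet> ?n - grad (element_poly K') y \<bullet> ?n"
    unfolding normal_jump_def jump_def elements_at_facet[OF K F] using K(3) facet_opposite_normal[OF K F] by simp
  thus ?thesis unfolding 2 abs_mult by (simp add: abs_minus_commute)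
qed

lemma normal_jump_continuous: "continuous_on UNIV (normal_jump F)"
  unfolding normal_jump_def jump_def[abs_def] by (intro continuous_intros continuous_grad element_poly_poly) auto

end

section \<open>The estimate along a line\<close>

context finite_element_function
begin

text \<open>An interior face has two opposite outward normals. One is fixed arbitrarily, and only
  expressions unchanged by reversing normal and offset together are formed from it.\<close>

definition face_unit_normal :: "'a set \<Rightarrow> 'a" where "face_unit_normal F = outward_normal (SOME K. K \<in> \<T> \<and> F facet_of K) F"
definition face_offset :: "'a set \<Rightarrow> real" where "face_offset F = (SOME b. affine hull F = {x. face_unit_normal F \<bullet> x = b})"

lemma face_normal:
  assumes "K \<in> \<T>" "F facet_of K"
  shows "norm (face_unit_normal F) = 1" "affine hull F = {x. face_unit_normal F \<bullet> x = face_offset F}"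
proof -
  let ?K = "SOME K. K \<in> \<T> \<and> F facet_of K"
  have K: "?K \<in> \<T>" "F facet_of ?K" using someI[of "\<lambda>K. K \<in> \<T> \<and> F facet_of K", OF conjI[OF assms]] by auto
  obtain b where b: "norm (outward_normal ?K F) = 1" "affine hull F = {x. outward_normal ?K F \<bullet> x = b}"
    using element_facet_normal[OF K] by metis
  show "norm (face_unit_normal F) = 1" using b(1) by (simp add: face_unit_normal_def)
  show "affine hull F = {x. face_unit_normal F \<bullet> x = face_offset F}"
    unfolding face_offset_def by (rule someI[of "\<lambda>b. affine hull F = {x. face_unit_normal F \<bullet> x = b}"]) (use b(2) in \<open>simp add: face_unit_normal_def\<close>)
qed

lemma abs_outward_normal_inner:
  assumes "K \<in> \<T>" "F facet_of K" shows "\<bar>outward_normal K F \<bullet> e\<bar> = \<bar>face_unit_normal F \<bullet> e\<bar>"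
proof -
  obtain b where b: "norm (outward_normal K F) = 1" "affine hull F = {x. outward_normal K F \<bullet> x = b}"
    using element_facet_normal[OF assms] by metis
  have "outward_normal K F = face_unit_normal F \<or> outward_normal K F = - face_unit_normal F"
    using face_normal[OF assms] b by (intro hyperplane_unit_normal_unique[of _ _ "face_offset F" b]) auto
  thus ?thesis by auto
qed

text \<open>The squared jump of the derivative along the line at its crossing with \<open>F\<close>, weighted by \<open>s\<^sup>2\<close>: the
  derivative jumps by \<open>\<bar>n \<bullet> (z - q)\<bar>\<close> times the normal jump, and \<open>s * (n \<bullet> (z - q)) = a\<close>. For lines
  parallel to the face, \<open>x / 0 = 0\<close> gives \<open>s = 0\<close>.\<close>
definition cone_density :: "'a \<Rightarrow> 'a set \<Rightarrow> 'a \<Rightarrow> ennreal" where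
  "cone_density q F z = (let a = face_offset F - face_unit_normal F \<bullet> q; s = a / (face_unit_normal F \<bullet> (z - q)); y = q + s *\<^sub>R (z - q) in
     if 0 < s \<and> s < 2 \<and> y \<in> F then ennreal (a\<^sup>2 * (normal_jump F y)\<^sup>2) else 0)"

lemma interior_faces_facet: "F \<in> interior_faces \<T> \<Longrightarrow> \<exists>K\<in>\<T>. F facet_of K"
  unfolding interior_faces_def by blast

lemma finite_interior_faces: "finite (interior_faces \<T>)"
  by (rule finite_subset[OF _ finite_faces]) (auto simp: interior_faces_def facet_of_def)

text \<open>Each crossing costs \<open>\<mu>\<close> plus a quadratic term, by
  \<open>x \<le> \<mu> + x^2 / \<mu>\<close>. The quadratic terms are then extended from the faces
  crossed to all interior faces.\<close>

lemma jump_sum_bound: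
  assumes g: "good_line q (z - q)" and ab: "0 \<le> a" "b \<le> 2" and \<Omega>: "\<And>t. a < t \<Longrightarrow> t < b \<Longrightarrow> q + t *\<^sub>R (z - q) \<in> \<Omega>"
    and RL: "\<And>t. a < t \<Longrightarrow> t < b \<Longrightarrow> ((\<lambda>t. fe_deriv (z - q) (q + t *\<^sub>R (z - q))) \<longlongrightarrow> R t) (at_right t)"
      "\<And>t. a < t \<Longrightarrow> t < b \<Longrightarrow> ((\<lambda>t. fe_deriv (z - q) (q + t *\<^sub>R (z - q))) \<longlongrightarrow> L t) (at_left t)"
    and \<mu>: "\<mu> > 0"
  shows "(\<Sum>s\<in>breaks q (z - q) \<inter> {a<..<b}. ennreal (s * \<bar>R s - L s\<bar>))
    \<le> ennreal (\<mu> * real (card (breaks q (z - q) \<inter> {0<..<2}))) + (\<Sum>F\<in>interior_faces \<T>. cone_density q F z * ennreal (1 / \<mu>))"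
proof -
  let ?e = "z - q" and ?B = "breaks q (z - q) \<inter> {a<..<b}"
  have gl: "generic_line q ?e" using g by (simp add: good_line_def)
  have gq: "generic_point q" using gl by (simp add: generic_line_def)
  have ex: "\<exists>F. F \<in> interior_faces \<T> \<and> s = (face_offset F - face_unit_normal F \<bullet> q) / (face_unit_normal F \<bullet> ?e) \<and> ennreal (s * \<bar>R s - L s\<bar>) \<le> ennreal \<mu> + cone_density q F z * ennreal (1 / \<mu>)" if s: "s \<in> ?B" for s
  proof -
    have s0: "a < s" "s < b" "0 < s" "s < 2" using s ab by auto
    have ys: "q + s *\<^sub>R ?e \<in> \<Omega>" using \<Omega> s0 by blast
    obtain K K' F \<delta> where c: "K \<in> \<T>" "K' \<in> \<T>" "K \<noteq> K'" "F facet_of K" "F facet_of K'" "q + s *\<^sub>R ?e \<in> rel_interior F"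
      "\<delta> > 0" "\<And>t. s - \<delta> < t \<Longrightarrow> t < s \<Longrightarrow> q + t *\<^sub>R ?e \<in> interior K" "\<And>t. s < t \<Longrightarrow> t < s + \<delta> \<Longrightarrow> q + t *\<^sub>R ?e \<in> interior K'"
      by (rule generic_line_crossing[OF gl ys]) (use s in auto)
    let ?y = "q + s *\<^sub>R ?e" and ?a = "face_offset F - face_unit_normal F \<bullet> q"
    have yF: "?y \<in> F" using c(6) rel_interior_subset by blast
    have "((\<lambda>t. fe_deriv ?e (q + t *\<^sub>R ?e)) \<longlongrightarrow> grad (element_poly K) ?y \<bullet> ?e) (at_left s)"
      unfolding fe_deriv_def by (rule piecewise_line_tendsto[where w = "\<lambda>K y. grad (element_poly K) y \<bullet> ?e", OF c(1) fe_deriv_continuous[OF c(1)]], rule eventually_at_left_germ[OF c(7,8)])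
    hence Ls: "L s = grad (element_poly K) ?y \<bullet> ?e" using tendsto_unique[OF trivial_limit_at_left_real RL(2)[OF s0(1,2)]] by blast
    have "((\<lambda>t. fe_deriv ?e (q + t *\<^sub>R ?e)) \<longlongrightarrow> grad (element_poly K') ?y \<bullet> ?e) (at_right s)"
      unfolding fe_deriv_def by (rule piecewise_line_tendsto[where w = "\<lambda>K y. grad (element_poly K) y \<bullet> ?e", OF c(2) fe_deriv_continuous[OF c(2)]], rule eventually_at_right_germ[OF c(7,9)])
    hence Rs: "R s = grad (element_poly K') ?y \<bullet> ?e" using tendsto_unique[OF trivial_limit_at_right_real RL(1)[OF s0(1,2)]] by blast
    have jump: "\<bar>R s - L s\<bar> = \<bar>face_unit_normal F \<bullet> ?e\<bar> * \<bar>normal_jump F ?y\<bar>"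
      unfolding Ls Rs gradient_jump[OF c(1-6) ys] abs_outward_normal_inner[OF c(1,4)] ..
    have "?y \<in> affine hull F" using yF by (rule hull_inc)
    hence "face_unit_normal F \<bullet> ?y = face_offset F" using face_normal(2)[OF c(1,4)] by blast
    hence sa: "s * (face_unit_normal F \<bullet> ?e) = ?a" by (simp add: inner_add_right)
    have "face_unit_normal F \<bullet> ?e \<noteq> 0"
      using generic_line_transversal[OF gl c(1,4) yF] abs_outward_normal_inner[OF c(1,4), of ?e] by auto
    hence sq: "s = ?a / (face_unit_normal F \<bullet> ?e)" using sa by (simp add: field_simps)
    have cone_density: "cone_density q F z = ennreal (?a\<^sup>2 * (normal_jump F ?y)\<^sup>2)"
      unfolding cone_density_def Let_def sq[symmetric] using s0 yF by simp
    let ?x = "s * \<bar>R s - L s\<bar>"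
    \<comment> \<open>The weight cancels the obliqueness: \<open>s\<close> times the normal
      component of the direction is, up to sign, the distance of the pole from the plane of the
      face.\<close>
    have x2: "?x\<^sup>2 = ?a\<^sup>2 * (normal_jump F ?y)\<^sup>2" unfolding jump sa[symmetric] by (simp add: power_mult_distrib)
    have "?x \<le> \<mu> + ?x\<^sup>2 / \<mu>"
    proof -
      have "0 \<le> (?x - \<mu>)\<^sup>2" by simp
      hence "2 * (?x * \<mu>) \<le> ?x\<^sup>2 + \<mu>\<^sup>2" by (simp only: power2_diff)
      moreover have "0 \<le> ?x * \<mu>" using s0 \<mu> by simp
      ultimately have "?x * \<mu> \<le> \<mu>\<^sup>2 + ?x\<^sup>2" by linarith
      thus ?thesis using \<mu> by (simp add: field_simps power2_eq_square)
    qed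
    hence "ennreal ?x \<le> ennreal (\<mu> + ?a\<^sup>2 * (normal_jump F ?y)\<^sup>2 * (1 / \<mu>))" unfolding x2 by (intro ennreal_leI) simp
    also have "\<dots> = ennreal \<mu> + cone_density q F z * ennreal (1 / \<mu>)"
      unfolding cone_density using \<mu> by (subst ennreal_plus) (auto simp: ennreal_mult[symmetric])
    finally show ?thesis using common_facet_interior_face[OF c(1-5)] sq by blast
  qed
  obtain Fs where Fs: "\<And>s. s \<in> ?B \<Longrightarrow> Fs s \<in> interior_faces \<T>" "\<And>s. s \<in> ?B \<Longrightarrow> s = (face_offset (Fs s) - face_unit_normal (Fs s) \<bullet> q) / (face_unit_normal (Fs s) \<bullet> ?e)"
    "\<And>s. s \<in> ?B \<Longrightarrow> ennreal (s * \<bar>R s - L s\<bar>) \<le> ennreal \<mu> + cone_density q (Fs s) z * ennreal (1 / \<mu>)"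
  proof -
    have "\<forall>s\<in>?B. \<exists>F. F \<in> interior_faces \<T> \<and> s = (face_offset F - face_unit_normal F \<bullet> q) / (face_unit_normal F \<bullet> ?e) \<and> ennreal (s * \<bar>R s - L s\<bar>) \<le> ennreal \<mu> + cone_density q F z * ennreal (1 / \<mu>)"
      using ex by blast
    from bchoice[OF this] show ?thesis using that by blast
  qed
  have fin: "finite (breaks q ?e)" by (rule finite_breaks[OF gl])
  \<comment> \<open>A face determines the parameter of its crossing, so no face is counted
    twice.\<close>
  have inj: "inj_on Fs ?B" by (rule inj_onI) (metis Fs(2))
  have "(\<Sum>s\<in>?B. ennreal (s * \<bar>R s - L s\<bar>)) \<le> (\<Sum>s\<in>?B. ennreal \<mu> + cone_density q (Fs s) z * ennreal (1 / \<mu>))"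
    by (rule sum_mono) (rule Fs(3))
  also have "\<dots> = ennreal \<mu> * of_nat (card ?B) + (\<Sum>s\<in>?B. cone_density q (Fs s) z * ennreal (1 / \<mu>))"
    by (simp add: sum.distrib mult.commute)
  also have "(\<Sum>s\<in>?B. cone_density q (Fs s) z * ennreal (1 / \<mu>)) = (\<Sum>F\<in>Fs ` ?B. cone_density q F z * ennreal (1 / \<mu>))"
    using sum.reindex[OF inj, of "\<lambda>F. cone_density q F z * ennreal (1 / \<mu>)"] by simp
  also have "ennreal \<mu> * of_nat (card ?B) + (\<Sum>F\<in>Fs ` ?B. cone_density q F z * ennreal (1 / \<mu>))
     \<le> ennreal \<mu> * of_nat (card (breaks q ?e \<inter> {0<..<2})) + (\<Sum>F\<in>interior_faces \<T>. cone_density q F z * ennreal (1 / \<mu>))"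
  proof (intro add_mono mult_left_mono sum_mono2 finite_interior_faces)
    show "of_nat (card ?B) \<le> (of_nat (card (breaks q ?e \<inter> {0<..<2})) :: ennreal)"
      using fin ab by (intro of_nat_mono card_mono) auto
  qed (use Fs(1) in auto)
  also have "ennreal \<mu> * of_nat (card (breaks q ?e \<inter> {0<..<2})) = ennreal (\<mu> * real (card (breaks q ?e \<inter> {0<..<2})))"
    using \<mu> by (simp add: ennreal_mult ennreal_of_nat_eq_real_of_nat)
  finally show ?thesis .
qed

text \<open>The function \<open>\<kappa> * t\<close> majorises the kernel of the second difference.
  One-sided limits \<open>ca\<close> and \<open>cb\<close> stand in for end values, because
  \<open>fe_value\<close> may be zero at the ends by convention.\<close>

lemma line_bound:
  assumes g: "good_line q (z - q)" and ab: "0 \<le> a" "a < m" "m < b" "b \<le> 2"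
    and \<Omega>: "\<And>t. a < t \<Longrightarrow> t < b \<Longrightarrow> q + t *\<^sub>R (z - q) \<in> \<Omega>" and m: "m \<notin> breaks q (z - q)"
    and \<kappa>: "0 \<le> \<kappa>" "\<And>t. a < t \<Longrightarrow> t \<le> m \<Longrightarrow> (b - m) * (t - a) \<le> \<kappa> * t" "\<And>t. m \<le> t \<Longrightarrow> t < b \<Longrightarrow> (m - a) * (b - t) \<le> \<kappa> * t"
    and ca: "((\<lambda>t. fe_value (q + t *\<^sub>R (z - q))) \<longlongrightarrow> ca) (at_right a)" and cb: "((\<lambda>t. fe_value (q + t *\<^sub>R (z - q))) \<longlongrightarrow> cb) (at_left b)"
    and \<mu>: "\<mu> > 0"
  shows "ennreal \<bar>(b - m) * ca - (b - a) * fe_value (q + m *\<^sub>R (z - q)) + (m - a) * cb\<bar> \<le> ennreal \<kappa> *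
    ((\<integral>\<^sup>+t\<in>{0<..<2}. ennreal (t * ((norm (z - q))\<^sup>2 * sqrt (fe_hessian_sq (q + t *\<^sub>R (z - q))))) \<partial>lborel)
     + (ennreal (\<mu> * real (card (breaks q (z - q) \<inter> {0<..<2}))) + (\<Sum>F\<in>interior_faces \<T>. cone_density q F z * ennreal (1 / \<mu>))))"
proof -
  let ?e = "z - q" and ?y = "\<lambda>t. q + t *\<^sub>R (z - q)"
  have gl: "generic_line q ?e" using g by (simp add: good_line_def)
  define R where "R t = Lim (at_right t) (\<lambda>t. fe_deriv ?e (?y t))" for t
  define L where "L t = Lim (at_left t) (\<lambda>t. fe_deriv ?e (?y t))" for t
  have R: "((\<lambda>t. fe_deriv ?e (?y t)) \<longlongrightarrow> R t) (at_right t)" if t: "a \<le> t" "t < b" for t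
  proof -
    have "\<forall>\<^sub>F x in at_right t. ?y x \<in> \<Omega>" by (rule eventually_at_right_germ[of "b - t"]) (use \<Omega> t in auto)
    then obtain K \<delta> where K: "K \<in> \<T>" "\<delta> > 0" "\<And>x. t < x \<Longrightarrow> x < t + \<delta> \<Longrightarrow> ?y x \<in> interior K"
      using generic_line_right_element[OF gl] by metis
    have "((\<lambda>t. fe_deriv ?e (?y t)) \<longlongrightarrow> grad (element_poly K) (?y t) \<bullet> ?e) (at_right t)"
      unfolding fe_deriv_def by (rule piecewise_line_tendsto[where w = "\<lambda>K y. grad (element_poly K) y \<bullet> ?e", OF K(1) fe_deriv_continuous[OF K(1)]], rule eventually_at_right_germ[OF K(2,3)])
    thus ?thesis unfolding R_def using tendsto_Lim[OF trivial_limit_at_right_real] by metis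
  qed
  have L: "((\<lambda>t. fe_deriv ?e (?y t)) \<longlongrightarrow> L t) (at_left t)" if t: "a < t" "t \<le> b" for t
  proof -
    have "\<forall>\<^sub>F x in at_left t. ?y x \<in> \<Omega>" by (rule eventually_at_left_germ[of "t - a"]) (use \<Omega> t in auto)
    then obtain K \<delta> where K: "K \<in> \<T>" "\<delta> > 0" "\<And>x. t - \<delta> < x \<Longrightarrow> x < t \<Longrightarrow> ?y x \<in> interior K"
      using generic_line_left_element[OF gl] by metis
    have "((\<lambda>t. fe_deriv ?e (?y t)) \<longlongrightarrow> grad (element_poly K) (?y t) \<bullet> ?e) (at_left t)"
      unfolding fe_deriv_def by (rule piecewise_line_tendsto[where w = "\<lambda>K y. grad (element_poly K) y \<bullet> ?e", OF K(1) fe_deriv_continuous[OF K(1)]], rule eventually_at_left_germ[OF K(2,3)])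
    thus ?thesis unfolding L_def using tendsto_Lim[OF trivial_limit_at_left_real] by metis
  qed
  have loc: "\<exists>K\<in>\<T>. ?y t \<in> interior K \<and> (\<forall>\<^sub>F x in nhds t. ?y x \<in> interior K)" if t: "a < t" "t < b" "t \<notin> breaks q ?e" for t
    using not_break_imp_interior[OF \<Omega>[OF t(1,2)] t(3)] line_eventually_interior[OF _ open_interior] by metis
  have d1: "((\<lambda>t. fe_value (?y t)) has_real_derivative fe_deriv ?e (?y t)) (at t)" if t: "a < t" "t < b" "t \<notin> breaks q ?e" for t
  proof -
    obtain K where K: "K \<in> \<T>" "?y t \<in> interior K" "\<forall>\<^sub>F x in nhds t. ?y x \<in> interior K" using loc[OF t] by blast
    have ev: "\<forall>\<^sub>F x in nhds t. fe_value (?y x) = element_poly K (?y x)"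
      using K(3) by eventually_elim (simp add: fe_value_def piecewise_eq[OF K(1)])
    have "fe_deriv ?e (?y t) = grad (element_poly K) (?y t) \<bullet> ?e" by (simp add: fe_deriv_def piecewise_eq[OF K(1,2)])
    thus ?thesis using DERIV_cong_ev[OF refl ev refl]
      has_derivative_along_line[OF real_polynomial_function_differentiable[OF element_poly_poly[OF K(1)]], where q = q and t = t and e = ?e] by simp
  qed
  have d2: "((\<lambda>t. fe_deriv ?e (?y t)) has_real_derivative fe_second ?e (?y t)) (at t)" if t: "a < t" "t < b" "t \<notin> breaks q ?e" for t
  proof -
    obtain K where K: "K \<in> \<T>" "?y t \<in> interior K" "\<forall>\<^sub>F x in nhds t. ?y x \<in> interior K" using loc[OF t] by blast
    have ev: "\<forall>\<^sub>F x in nhds t. fe_deriv ?e (?y x) = grad (element_poly K) (?y x) \<bullet> ?e"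
      using K(3) by eventually_elim (simp add: fe_deriv_def piecewise_eq[OF K(1)])
    have "fe_second ?e (?y t) = hess (element_poly K) (?y t) ?e" by (simp add: fe_second_def piecewise_eq[OF K(1,2)])
    thus ?thesis using DERIV_cong_ev[OF refl ev refl]
      has_second_derivative_along_line[OF element_poly_poly[OF K(1)], of q ?e t] by simp
  qed
  \<comment> \<open>The limits at inner parameters, with the prescribed ones at the ends. At
    \<open>m\<close>, which is not a break, the limit is the value of
    \<open>fe_value\<close>.\<close>
  define c where "c t = (if t = a then ca else if t = b then cb else Lim (at t) (\<lambda>t. fe_value (?y t)))" for t
  have c: "((\<lambda>t. fe_value (?y t)) \<longlongrightarrow> c t) (at t)" if t: "a < t" "t < b" for t
  proof -
    have "t \<in> {0<..<2}" using t ab by auto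
    then obtain l where "((\<lambda>t. fe_value (?y t)) \<longlongrightarrow> l) (at t)" using g unfolding good_line_def by blast
    thus ?thesis using t tendsto_Lim[OF trivial_limit_at] unfolding c_def by force
  qed
  have cm: "c m = fe_value (?y m)"
  proof -
    have "((\<lambda>t. fe_value (?y t)) \<longlongrightarrow> fe_value (?y m)) (at m)" using isCont_line[OF m] by (simp add: isCont_def)
    thus ?thesis using c[OF ab(2,3)] tendsto_unique[OF trivial_limit_at] by blast
  qed
  have "ennreal \<bar>(b - m) * c a - (b - a) * c m + (m - a) * c b\<bar>
    \<le> (\<integral>\<^sup>+t\<in>{a<..<b}. ennreal (\<kappa> * t * \<bar>fe_second ?e (?y t)\<bar>) \<partial>lborel) + (\<Sum>s\<in>breaks q ?e \<inter> {a<..<b}. ennreal (\<kappa> * s * \<bar>R s - L s\<bar>))"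
    by (rule divided_difference_bound[where g = "\<lambda>t. fe_value (?y t)" and ?g1.0 = "\<lambda>t. fe_deriv ?e (?y t)" and ?g2.0 = "\<lambda>t. fe_second ?e (?y t)", OF finite_breaks[OF gl] ab(2,3) d1 d2 R L c])
       (use ca cb ab \<kappa> in \<open>auto simp: c_def\<close>)
  also have "(\<Sum>s\<in>breaks q ?e \<inter> {a<..<b}. ennreal (\<kappa> * s * \<bar>R s - L s\<bar>)) = ennreal \<kappa> * (\<Sum>s\<in>breaks q ?e \<inter> {a<..<b}. ennreal (s * \<bar>R s - L s\<bar>))"
    unfolding sum_distrib_left using \<kappa> ab by (intro sum.cong refl) (auto simp: ennreal_mult[symmetric] mult.assoc)
  also have "(\<integral>\<^sup>+t\<in>{a<..<b}. ennreal (\<kappa> * t * \<bar>fe_second ?e (?y t)\<bar>) \<partial>lborel) \<le> (\<integral>\<^sup>+t. ennreal \<kappa> * (ennreal (t * ((norm ?e)\<^sup>2 * sqrt (fe_hessian_sq (?y t)))) * indicator {0<..<2} t) \<partial>lborel)"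
  proof (rule nn_integral_mono)
    fix t
    show "ennreal (\<kappa> * t * \<bar>fe_second ?e (?y t)\<bar>) * indicator {a<..<b} t \<le> ennreal \<kappa> * (ennreal (t * ((norm ?e)\<^sup>2 * sqrt (fe_hessian_sq (?y t)))) * indicator {0<..<2} t)"
    proof (cases "t \<in> {a<..<b}")
      case True
      hence t: "0 < t" "t < 2" using ab by auto
      have "ennreal (\<kappa> * t * \<bar>fe_second ?e (?y t)\<bar>) \<le> ennreal (\<kappa> * (t * ((norm ?e)\<^sup>2 * sqrt (fe_hessian_sq (?y t)))))"
        unfolding mult.assoc using t \<kappa> by (intro ennreal_leI mult_left_mono fe_second_le) auto
      also have "\<dots> = ennreal \<kappa> * ennreal (t * ((norm ?e)\<^sup>2 * sqrt (fe_hessian_sq (?y t))))" using \<kappa> t fe_hessian_sq_nonneg by (intro ennreal_mult) auto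
      finally show ?thesis using True t by simp
    qed simp
  qed
  also have "\<dots> = ennreal \<kappa> * (\<integral>\<^sup>+t\<in>{0<..<2}. ennreal (t * ((norm ?e)\<^sup>2 * sqrt (fe_hessian_sq (?y t)))) \<partial>lborel)"
    by (rule nn_integral_cmult) measurable
  finally have main: "ennreal \<bar>(b - m) * c a - (b - a) * c m + (m - a) * c b\<bar> \<le>
     ennreal \<kappa> * (\<integral>\<^sup>+t\<in>{0<..<2}. ennreal (t * ((norm ?e)\<^sup>2 * sqrt (fe_hessian_sq (?y t)))) \<partial>lborel)
     + ennreal \<kappa> * (\<Sum>s\<in>breaks q ?e \<inter> {a<..<b}. ennreal (s * \<bar>R s - L s\<bar>))"
    by (meson add_right_mono order_trans)
  have "c a = ca" "c b = cb" using ab by (auto simp: c_def)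
  with main cm have "ennreal \<bar>(b - m) * ca - (b - a) * fe_value (?y m) + (m - a) * cb\<bar> \<le>
     ennreal \<kappa> * ((\<integral>\<^sup>+t\<in>{0<..<2}. ennreal (t * ((norm ?e)\<^sup>2 * sqrt (fe_hessian_sq (?y t)))) \<partial>lborel)
     + (\<Sum>s\<in>breaks q ?e \<inter> {a<..<b}. ennreal (s * \<bar>R s - L s\<bar>)))" by (simp add: distrib_left)
  also have "\<dots> \<le> ennreal \<kappa> *
    ((\<integral>\<^sup>+t\<in>{0<..<2}. ennreal (t * ((norm ?e)\<^sup>2 * sqrt (fe_hessian_sq (?y t)))) \<partial>lborel)
     + (ennreal (\<mu> * real (card (breaks q ?e \<inter> {0<..<2}))) + (\<Sum>F\<in>interior_faces \<T>. cone_density q F z * ennreal (1 / \<mu>))))"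
    by (intro mult_left_mono add_left_mono jump_sum_bound[OF g ab(1,4) \<Omega> _ _ \<mu>] R L) auto
  finally show ?thesis .
qed

end

section \<open>Averaging over lines\<close>

lemma nn_integral_inverse_sqrt: "(\<integral>\<^sup>+t\<in>{0<..<2}. ennreal (1 / sqrt t) \<partial>lborel) \<le> ennreal 4"
proof -
  have hi: "((\<lambda>x. x powr (-1/2)) has_integral (2 powr (-1/2 + 1) / (-1/2 + 1))) {0..2::real}"
    by (rule has_integral_powr_from_0) auto
  have "(\<integral>\<^sup>+t\<in>{0<..<2}. ennreal (1 / sqrt t) \<partial>lborel) \<le> (\<integral>\<^sup>+t. ennreal (t powr (-1/2)) * indicator {0..2} t \<partial>lborel)"
  proof (rule nn_integral_mono)
    fix t :: real
    have "1 / sqrt t = t powr (-1/2)" if "0 < t" using that by (simp add: powr_minus_divide powr_half_sqrt)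
    thus "ennreal (1 / sqrt t) * indicator {0<..<2} t \<le> ennreal (t powr (-1/2)) * indicator {0..2} t"
      by (auto simp: indicator_def)
  qed
  also have "\<dots> = ennreal (2 powr (-1/2 + 1) / (-1/2 + 1))"
    by (rule nn_integral_has_integral_lebesgue'[OF _ hi]) simp
  \<comment> \<open>The integral equals twice the square root of 2.\<close>
  also have "\<dots> \<le> ennreal 4"
  proof (rule ennreal_leI)
    have "(2::real) powr (1/2) \<le> 2 powr 1" by (rule powr_mono) auto
    thus "2 powr (-1/2 + 1) / (-1/2 + 1) \<le> (4::real)" by simp
  qed
  finally show ?thesis .
qed

lemma plane_integral_translate:
  fixes f :: "'a::euclidean_space \<Rightarrow> ennreal"
  assumes [measurable]: "f \<in> borel_measurable borel" and n: "norm n = 1"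
  shows "plane_integral n (\<lambda>u. f (q + u)) (b - n \<bullet> q) = plane_integral n f b"
proof -
  let ?F = "\<lambda>w. indicator {n \<bullet> q..<n \<bullet> q + 1} (n \<bullet> w) * f (w + (b - n \<bullet> w) *\<^sub>R n)"
  have "plane_integral n (\<lambda>u. f (q + u)) (b - n \<bullet> q) = (\<integral>\<^sup>+w. ?F (w + q) \<partial>lborel)"
    unfolding plane_integral_def
  proof (rule nn_integral_cong)
    fix w
    have 1: "q + (w + (b - n \<bullet> q - n \<bullet> w) *\<^sub>R n) = w + q + (b - n \<bullet> (w + q)) *\<^sub>R n"
      by (simp add: algebra_simps)
    have 2: "n \<bullet> (w + q) \<in> {n \<bullet> q..<n \<bullet> q + 1} \<longleftrightarrow> 0 \<le> n \<bullet> w \<and> n \<bullet> w < 1" by (auto simp: inner_add_right)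
    show "f (q + (w + (b - n \<bullet> q - n \<bullet> w) *\<^sub>R n)) * indicator {w. 0 \<le> n \<bullet> w \<and> n \<bullet> w < 1} w = ?F (w + q)"
      unfolding 1 using 2 by (simp add: indicator_def del: inner_add_right)
  qed
  also have "\<dots> = (\<integral>\<^sup>+w. ?F w \<partial>lborel)" by (rule nn_integral_lborel_translate) measurable
  also have "\<dots> = plane_integral n f b" using n by (subst plane_integral_product) auto
  finally show ?thesis .
qed

text \<open>The central projection estimate with the pole moved from the origin to \<open>q\<close>.
  The condition on nonzero values of \<open>G\<close> describes the cone: a positive crossing
  parameter below 2 and distance at most \<open>D\<close> from the pole.\<close>

lemma cone_surface_bound:
  fixes f :: "'a::euclidean_space \<Rightarrow> ennreal"
  assumes f[measurable]: "f \<in> borel_measurable borel" and n: "norm n = 1" and D: "0 \<le> D"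
    and dim: "DIM('a) = 2 \<or> DIM('a) = 3" and b: "n \<bullet> q < b"
    and G: "\<And>z. G z \<noteq> 0 \<Longrightarrow> norm (z - q) \<le> D \<and> 0 < (b - n \<bullet> q) / (n \<bullet> (z - q)) \<and> (b - n \<bullet> q) / (n \<bullet> (z - q)) < 2"
      "\<And>z. G z \<le> ennreal ((b - n \<bullet> q)\<^sup>2) * f (q + ((b - n \<bullet> q) / (n \<bullet> (z - q))) *\<^sub>R (z - q))"
  shows "(\<integral>\<^sup>+z. G z \<partial>lborel) \<le> ennreal (2 * D ^ 3) * plane_integral n f b"
proof -
  let ?a = "b - n \<bullet> q"
  let ?I = "\<lambda>u. indicator {u. ?a < 2 * (n \<bullet> u) \<and> n \<bullet> u \<le> D} u * ennreal (?a\<^sup>2) * f (q + (?a / (n \<bullet> u)) *\<^sub>R u)"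
  have "(\<integral>\<^sup>+z. G z \<partial>lborel) \<le> (\<integral>\<^sup>+z. ?I (z + (- q)) \<partial>lborel)"
  proof (rule nn_integral_mono)
    fix z
    show "G z \<le> ?I (z + (- q))"
    proof (cases "G z = 0")
      case False
      have s: "norm (z - q) \<le> D" "0 < ?a / (n \<bullet> (z - q))" "?a / (n \<bullet> (z - q)) < 2" using G(1)[OF False] by auto
      have l: "0 < n \<bullet> (z - q)" using s(2) b by (simp add: zero_less_divide_iff)
      have "?a < 2 * (n \<bullet> (z - q))" using s(3) l by (simp add: divide_less_eq)
      moreover have "n \<bullet> (z - q) \<le> D"
      proof -
        have "n \<bullet> (z - q) \<le> norm n * norm (z - q)" by (rule norm_cauchy_schwarz)
        thus ?thesis using s(1) n by simp
      qed
      ultimately have "z + - q \<in> {u. ?a < 2 * (n \<bullet> u) \<and> n \<bullet> u \<le> D}" by simp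
      thus ?thesis using G(2)[of z] by simp
    qed simp
  qed
  also have "\<dots> = (\<integral>\<^sup>+u. ?I u \<partial>lborel)" by (rule nn_integral_lborel_translate) measurable
  also have "\<dots> \<le> ennreal (2 * D ^ 3) * plane_integral n (\<lambda>u. f (q + u)) ?a"
    using cone_integral_bound[of "\<lambda>u. f (q + u)" n ?a D] n D b dim by simp
  also have "plane_integral n (\<lambda>u. f (q + u)) ?a = plane_integral n f b" by (rule plane_integral_translate[OF f n])
  finally show ?thesis .
qed

text \<open>AM-GM with a free parameter \<open>\<nu>\<close> replaces the Cauchy--Schwarz inequality for all sums and integrals; the
  parameter is chosen as the discrete norm at the end.\<close>
lemma le_add_of_power2_le_mult:
  fixes x A B :: real
  assumes "x\<^sup>2 \<le> A * B" "0 \<le> A" "0 \<le> B" shows "x \<le> A + B"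
proof (rule power2_le_imp_le)
  have "A * B \<le> (A + B)\<^sup>2" using assms by (simp add: power2_eq_square algebra_simps)
  thus "x\<^sup>2 \<le> (A + B)\<^sup>2" using assms by linarith
qed (use assms in simp)

context finite_element_function
begin

lemma facet_compact: "K \<in> \<T> \<Longrightarrow> F facet_of K \<Longrightarrow> compact F"
  by (metis element_polytope face_of_polytope_polytope facet_of_def polytope_imp_compact)

lemma cone_density_measurable: assumes F: "F \<in> interior_faces \<T>" shows "cone_density q F \<in> borel_measurable borel"
proof -
  obtain K where "K \<in> \<T>" "F facet_of K" using interior_faces_facet[OF F] by blast
  hence [measurable]: "F \<in> sets borel" using facet_compact by (intro borel_closed compact_imp_closed) auto
  have [measurable]: "normal_jump F \<in> borel_measurable borel" using normal_jump_continuous by (rule borel_measurable_continuous_onI)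
  show ?thesis unfolding cone_density_def[abs_def] Let_def by measurable
qed

lemma cone_density_integral:
  assumes F: "F \<in> interior_faces \<T>" and q: "generic_point q" and D: "0 \<le> D" "\<And>z. z \<in> \<Omega> \<Longrightarrow> norm (z - q) \<le> D"
    and dim: "DIM('a) = 2 \<or> DIM('a) = 3"
  shows "(\<integral>\<^sup>+z\<in>\<Omega>. cone_density q F z \<partial>lborel) \<le> ennreal (2 * D ^ 3) * ennreal (LINT x:F|surface_measure F. (normal_jump F x)\<^sup>2)"
proof -
  obtain K where K: "K \<in> \<T>" "F facet_of K" using interior_faces_facet[OF F] by blast
  have cF: "compact F" by (rule facet_compact[OF K])
  hence [measurable]: "F \<in> sets borel" by (intro borel_closed compact_imp_closed)
  have [measurable]: "normal_jump F \<in> borel_measurable borel" using normal_jump_continuous by (rule borel_measurable_continuous_onI)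
  let ?f = "\<lambda>x. ennreal ((normal_jump F x)\<^sup>2) * indicator F x"
  have fm: "?f \<in> borel_measurable borel" by measurable
  note fnb = face_normal[OF K]
  have "F face_of K" "aff_dim F < int DIM('a)" using K element_aff_dim by (auto simp: facet_of_def)
  hence "q \<notin> affine hull F" using q K by (auto simp: generic_point_def)
  hence a0: "face_unit_normal F \<bullet> q \<noteq> face_offset F" using fnb by simp
  have surf: "ennreal (LINT x:F|surface_measure F. (normal_jump F x)\<^sup>2) = plane_integral n ?f b" if "norm n = 1" "affine hull F = {x. n \<bullet> x = b}" for n b
    by (rule surface_integral_eq_plane_integral[OF that cF]) (auto intro!: continuous_intros normal_jump_continuous)
  have main: "(\<integral>\<^sup>+z. cone_density q F z * indicator \<Omega> z \<partial>lborel) \<le> ennreal (2 * D ^ 3) * plane_integral n ?f b"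
    if n: "norm n = 1" "n \<bullet> q < b" and eq: "\<And>z. (b - n \<bullet> q) / (n \<bullet> (z - q)) = (face_offset F - face_unit_normal F \<bullet> q) / (face_unit_normal F \<bullet> (z - q))" "(b - n \<bullet> q)\<^sup>2 = (face_offset F - face_unit_normal F \<bullet> q)\<^sup>2" for n b
  proof (rule cone_surface_bound[OF fm n(1) D(1) dim n(2)])
    fix z assume "cone_density q F z * indicator \<Omega> z \<noteq> 0"
    thus "norm (z - q) \<le> D \<and> 0 < (b - n \<bullet> q) / (n \<bullet> (z - q)) \<and> (b - n \<bullet> q) / (n \<bullet> (z - q)) < 2"
      using D(2)[of z] unfolding eq(1) by (auto simp: cone_density_def Let_def indicator_def split: if_splits)
  next
    fix z
    show "cone_density q F z * indicator \<Omega> z \<le> ennreal ((b - n \<bullet> q)\<^sup>2) * ?f (q + ((b - n \<bullet> q) / (n \<bullet> (z - q))) *\<^sub>R (z - q))"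
      unfolding eq by (auto simp: cone_density_def Let_def indicator_def ennreal_mult)
  qed
  show ?thesis
  proof (cases "face_unit_normal F \<bullet> q < face_offset F")
    case True
    show ?thesis using main[OF fnb(1) True] surf[OF fnb] by simp
  next
    \<comment> \<open>With the pole on the other side of the plane the opposite normal is used;
      crossing parameter, squared distance and surface integral are unchanged. Genericity excludes a
      pole in the plane.\<close>
    case False
    have n: "norm (- face_unit_normal F) = 1" "(- face_unit_normal F) \<bullet> q < - face_offset F" "affine hull F = {x. (- face_unit_normal F) \<bullet> x = - face_offset F}" using fnb False a0 by auto
    have e1: "(- face_offset F - (- face_unit_normal F) \<bullet> q) / ((- face_unit_normal F) \<bullet> (z - q)) = (face_offset F - face_unit_normal F \<bullet> q) / (face_unit_normal F \<bullet> (z - q))" for z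
      by (metis (no_types, lifting) inner_minus_left minus_diff_eq minus_diff_minus minus_divide_divide uminus_add_conv_diff diff_minus_eq_add)
    have e2: "(- face_offset F - (- face_unit_normal F) \<bullet> q)\<^sup>2 = (face_offset F - face_unit_normal F \<bullet> q)\<^sup>2" by (simp add: power2_commute)
    show ?thesis using main[OF n(1,2) e1 e2] surf[OF n(1,3)] by simp
  qed
qed

text \<open>A facet has dimension at least one, hence two distinct points. So
  \<open>inverse (diameter F)\<close> is a genuine reciprocal and not the default 0.\<close>

lemma facet_diameter_pos:
  assumes K: "K \<in> \<T>" "F facet_of K" and dim: "2 \<le> DIM('a)"
  shows "0 < diameter F"
proof -
  have d: "aff_dim F = int DIM('a) - 1" "F \<noteq> {}" using K element_aff_dim by (auto simp: facet_of_def)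
  obtain x where x: "x \<in> F" using d by blast
  have "F \<noteq> {x}" using d dim by auto
  then obtain y where y: "y \<in> F" "y \<noteq> x" using x by blast
  have "dist x y \<le> diameter F" using compact_imp_bounded[OF facet_compact[OF K]] x y by (intro diameter_bounded_bound)
  moreover have "0 < dist x y" using y by auto
  ultimately show ?thesis by linarith
qed

text \<open>The line estimate after AM-GM with parameter \<open>\<nu>\<close>. The 4 bounds the
  integral of \<open>1 / sqrt t\<close>, and \<open>N\<close> stands for a bound on the number of
  crossings times the mesh size. Jumps are split with parameter
  \<open>\<nu> * mesh_size \<T>\<close>, which produces the reciprocal mesh size.\<close>

definition line_functional :: "real \<Rightarrow> real \<Rightarrow> real \<Rightarrow> 'a \<Rightarrow> 'a \<Rightarrow> ennreal" where
  "line_functional D N \<nu> q z = ennreal (D\<^sup>2) * (ennreal (4 * \<nu>) + ennreal (1 / \<nu>) *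
       (\<integral>\<^sup>+t\<in>{0<..}. (ennreal (t\<^sup>2 * sqrt t) * indicator {0<..<2} t) * ennreal (fe_hessian_sq (q + t *\<^sub>R (z - q))) \<partial>lborel))
     + (ennreal (\<nu> * N) + (\<Sum>F\<in>interior_faces \<T>. cone_density q F z * ennreal (1 / (\<nu> * mesh_size \<T>))))"

lemma line_functional_le_W:
  assumes D: "norm (z - q) \<le> D" and N: "real (card (breaks q (z - q) \<inter> {0<..<2})) * mesh_size \<T> \<le> N" and \<nu>: "0 < \<nu>"
  shows "(\<integral>\<^sup>+t\<in>{0<..<2}. ennreal (t * ((norm (z - q))\<^sup>2 * sqrt (fe_hessian_sq (q + t *\<^sub>R (z - q))))) \<partial>lborel)
     + (ennreal ((\<nu> * mesh_size \<T>) * real (card (breaks q (z - q) \<inter> {0<..<2}))) + (\<Sum>F\<in>interior_faces \<T>. cone_density q F z * ennreal (1 / (\<nu> * mesh_size \<T>))))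
     \<le> line_functional D N \<nu> q z"
proof -
  let ?H = "\<lambda>t. fe_hessian_sq (q + t *\<^sub>R (z - q))"
  let ?w = "\<lambda>t. (ennreal (t\<^sup>2 * sqrt t) * indicator {0<..<2} t)"
  have "(\<integral>\<^sup>+t\<in>{0<..<2}. ennreal (t * ((norm (z - q))\<^sup>2 * sqrt (?H t))) \<partial>lborel)
     \<le> (\<integral>\<^sup>+t. ennreal (D\<^sup>2) * (ennreal \<nu> * (ennreal (1 / sqrt t) * indicator {0<..<2} t) + ennreal (1 / \<nu>) * (?w t * ennreal (?H t) * indicator {0<..} t)) \<partial>lborel)"
  proof (rule nn_integral_mono)
    fix t
    show "ennreal (t * ((norm (z - q))\<^sup>2 * sqrt (?H t))) * indicator {0<..<2} t \<le> ennreal (D\<^sup>2) * (ennreal \<nu> * (ennreal (1 / sqrt t) * indicator {0<..<2} t) + ennreal (1 / \<nu>) * (?w t * ennreal (?H t) * indicator {0<..} t))"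
    proof (cases "t \<in> {0<..<2}")
      case True
      hence t: "0 < t" by simp
      have A: "0 \<le> \<nu> * (1 / sqrt t)" "0 \<le> 1 / \<nu> * (t\<^sup>2 * sqrt t * ?H t)" using t \<nu> fe_hessian_sq_nonneg by auto
      \<comment> \<open>The square of the left side is the product of the two summands. The powers
        of \<open>t\<close> are divided so that \<open>1 / sqrt t\<close> is integrable at 0 and the
        other weight remains so after division by the Jacobian.\<close>
      have "t * sqrt (?H t) \<le> \<nu> * (1 / sqrt t) + 1 / \<nu> * (t\<^sup>2 * sqrt t * ?H t)"
      proof (rule le_add_of_power2_le_mult[OF _ A])
        have "\<nu> * (1 / sqrt t) * (1 / \<nu> * (t\<^sup>2 * sqrt t * ?H t)) = t\<^sup>2 * ?H t" using t \<nu> by simp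
        thus "(t * sqrt (?H t))\<^sup>2 \<le> \<nu> * (1 / sqrt t) * (1 / \<nu> * (t\<^sup>2 * sqrt t * ?H t))"
          using fe_hessian_sq_nonneg by (simp add: power_mult_distrib)
      qed
      moreover have "(norm (z - q))\<^sup>2 \<le> D\<^sup>2" using D by (intro power_mono) auto
      ultimately have "(norm (z - q))\<^sup>2 * (t * sqrt (?H t)) \<le> D\<^sup>2 * (\<nu> * (1 / sqrt t) + 1 / \<nu> * (t\<^sup>2 * sqrt t * ?H t))"
        using t fe_hessian_sq_nonneg by (intro mult_mono) auto
      hence "ennreal (t * ((norm (z - q))\<^sup>2 * sqrt (?H t))) \<le> ennreal (D\<^sup>2 * (\<nu> * (1 / sqrt t) + 1 / \<nu> * (t\<^sup>2 * sqrt t * ?H t)))"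
        by (intro ennreal_leI) (simp only: mult.left_commute)
      also have "\<dots> = ennreal (D\<^sup>2) * (ennreal \<nu> * ennreal (1 / sqrt t) + ennreal (1 / \<nu>) * (ennreal (t\<^sup>2 * sqrt t) * ennreal (?H t)))"
      proof -
        have "ennreal (\<nu> * (1 / sqrt t)) = ennreal \<nu> * ennreal (1 / sqrt t)" using t \<nu> by (intro ennreal_mult) auto
        moreover have "ennreal (1 / \<nu> * (t\<^sup>2 * sqrt t * ?H t)) = ennreal (1 / \<nu>) * (ennreal (t\<^sup>2 * sqrt t) * ennreal (?H t))"
        proof -
          have "ennreal (1 / \<nu> * (t\<^sup>2 * sqrt t * ?H t)) = ennreal (1 / \<nu>) * ennreal (t\<^sup>2 * sqrt t * ?H t)"
            using t \<nu> fe_hessian_sq_nonneg by (intro ennreal_mult) auto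
          also have "ennreal (t\<^sup>2 * sqrt t * ?H t) = ennreal (t\<^sup>2 * sqrt t) * ennreal (?H t)" using t fe_hessian_sq_nonneg by (intro ennreal_mult) auto
          finally show ?thesis .
        qed
        moreover have "ennreal (D\<^sup>2 * (\<nu> * (1 / sqrt t) + 1 / \<nu> * (t\<^sup>2 * sqrt t * ?H t))) = ennreal (D\<^sup>2) * ennreal (\<nu> * (1 / sqrt t) + 1 / \<nu> * (t\<^sup>2 * sqrt t * ?H t))"
          by (intro ennreal_mult add_nonneg_nonneg A) simp
        ultimately show ?thesis by (simp only: ennreal_plus[OF A])
      qed
      finally show ?thesis using True t by simp
    qed simp
  qed
  also have "\<dots> = ennreal (D\<^sup>2) * (ennreal \<nu> * (\<integral>\<^sup>+t\<in>{0<..<2}. ennreal (1 / sqrt t) \<partial>lborel) + ennreal (1 / \<nu>) * (\<integral>\<^sup>+t\<in>{0<..}. ?w t * ennreal (?H t) \<partial>lborel))"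
    by (subst nn_integral_cmult, measurable, subst nn_integral_add, measurable) (simp add: nn_integral_cmult)
  also have "\<dots> \<le> ennreal (D\<^sup>2) * (ennreal \<nu> * ennreal 4 + ennreal (1 / \<nu>) * (\<integral>\<^sup>+t\<in>{0<..}. ?w t * ennreal (?H t) \<partial>lborel))"
    by (intro mult_left_mono add_right_mono nn_integral_inverse_sqrt) auto
  also have "ennreal \<nu> * ennreal 4 = ennreal (4 * \<nu>)" using \<nu> by (subst ennreal_mult[symmetric]) (auto simp: mult.commute)
  finally have 1: "(\<integral>\<^sup>+t\<in>{0<..<2}. ennreal (t * ((norm (z - q))\<^sup>2 * sqrt (?H t))) \<partial>lborel) \<le> ennreal (D\<^sup>2) * (ennreal (4 * \<nu>) + ennreal (1 / \<nu>) * (\<integral>\<^sup>+t\<in>{0<..}. ?w t * ennreal (?H t) \<partial>lborel))" .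
  have "\<nu> * (real (card (breaks q (z - q) \<inter> {0<..<2})) * mesh_size \<T>) \<le> \<nu> * N" using N \<nu> by (intro mult_left_mono) auto
  hence 2: "ennreal ((\<nu> * mesh_size \<T>) * real (card (breaks q (z - q) \<inter> {0<..<2}))) \<le> ennreal (\<nu> * N)"
    by (intro ennreal_leI) (simp only: mult.assoc mult.commute)
  show ?thesis unfolding line_functional_def by (intro add_mono 1 2 order_refl)
qed

definition energy :: real where
  "energy = (\<Sum>K\<in>\<T>. integral\<^sup>L (lebesgue_on K) (hessian_norm_sq (element_poly K))) +
        (\<Sum>F\<in>interior_faces \<T>. inverse (diameter F) * (LINT x:F|surface_measure F. (normal_jump F x)\<^sup>2))"

lemma discrete_norm_eq: "discrete_norm k \<T> v = sqrt energy"
  unfolding discrete_norm_def energy_def normal_jump_def element_poly_def ..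

text \<open>For d = 2 the weight is \<open>sqrt t\<close>, at most \<open>2 / sqrt t\<close> because
  \<open>t < 2\<close>; for d = 3 it is exactly \<open>1 / sqrt t\<close>. The constant 8 is 2 times
  4.\<close>

lemma weight_bound:
  assumes dim: "DIM('a) = 2 \<or> DIM('a) = 3"
  shows "(\<integral>\<^sup>+t\<in>{0<..}. (ennreal (t\<^sup>2 * sqrt t) * indicator {0<..<2} t) * ennreal ((1 / t) ^ DIM('a)) \<partial>lborel) \<le> ennreal 8"
proof -
  have "(\<integral>\<^sup>+t\<in>{0<..}. (ennreal (t\<^sup>2 * sqrt t) * indicator {0<..<2} t) * ennreal ((1 / t) ^ DIM('a)) \<partial>lborel)
      \<le> (\<integral>\<^sup>+t. ennreal 2 * (ennreal (1 / sqrt t) * indicator {0<..<2} t) \<partial>lborel)"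
  proof (rule nn_integral_mono)
    fix t :: real
    show "(ennreal (t\<^sup>2 * sqrt t) * indicator {0<..<2} t) * ennreal ((1 / t) ^ DIM('a)) * indicator {0<..} t \<le> ennreal 2 * (ennreal (1 / sqrt t) * indicator {0<..<2} t)"
    proof (cases "t \<in> {0<..<2}")
      case True
      hence t: "0 < t" "t < 2" by auto
      have ss: "sqrt t * sqrt t = t" using t by simp
      have "t\<^sup>2 * sqrt t * (1 / t) ^ DIM('a) \<le> 2 * (1 / sqrt t)"
        using dim
      proof
        assume d: "DIM('a) = 2"
        have "t\<^sup>2 * sqrt t * (1 / t) ^ DIM('a) = sqrt t" using t d by (simp add: power_one_over field_simps)
        also have "\<dots> \<le> 2 * (1 / sqrt t)" using t ss by (simp add: le_divide_eq)
        finally show ?thesis .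
      next
        assume d: "DIM('a) = 3"
        have "t\<^sup>2 * sqrt t * (1 / t) ^ DIM('a) = sqrt t / t" using t d by (simp add: power_one_over field_simps power2_eq_square power3_eq_cube)
        also have "\<dots> = 1 / sqrt t" using t ss by (simp add: field_simps)
        finally have e: "t\<^sup>2 * sqrt t * (1 / t) ^ DIM('a) = 1 / sqrt t" .
        have "0 \<le> 1 / sqrt t" using t by simp
        thus ?thesis unfolding e by linarith
      qed
      hence "ennreal (t\<^sup>2 * sqrt t * (1 / t) ^ DIM('a)) \<le> ennreal (2 * (1 / sqrt t))" by (rule ennreal_leI)
      also have "ennreal (t\<^sup>2 * sqrt t * (1 / t) ^ DIM('a)) = ennreal (t\<^sup>2 * sqrt t) * ennreal ((1 / t) ^ DIM('a))" using t by (intro ennreal_mult) auto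
      also have "ennreal (2 * (1 / sqrt t)) = ennreal 2 * ennreal (1 / sqrt t)" using t by (intro ennreal_mult) auto
      finally show ?thesis using True t by simp
    qed simp
  qed
  also have "\<dots> = ennreal 2 * (\<integral>\<^sup>+t\<in>{0<..<2}. ennreal (1 / sqrt t) \<partial>lborel)"
    by (rule nn_integral_cmult) measurable
  also have "\<dots> \<le> ennreal 2 * ennreal 4" by (intro mult_left_mono nn_integral_inverse_sqrt) auto
  also have "\<dots> = ennreal 8" by (simp add: ennreal_mult[symmetric])
  finally show ?thesis .
qed

lemma hessian_integral_nonneg: "0 \<le> integral\<^sup>L (lebesgue_on K) (hessian_norm_sq (element_poly K))"
  by (simp add: hessian_norm_sq_nonneg integral_nonneg_AE)

lemma jump_integral_nonneg: "0 \<le> (LINT x:F|surface_measure F. (normal_jump F x)\<^sup>2)"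
  unfolding set_lebesgue_integral_def by (intro Bochner_Integration.integral_nonneg) auto

lemma line_functional_measurable: "line_functional D N \<nu> q \<in> borel_measurable borel"
proof -
  have "(\<lambda>z. \<integral>\<^sup>+t\<in>{0<..}. (ennreal (t\<^sup>2 * sqrt t) * indicator {0<..<2} t) * ennreal (fe_hessian_sq (q + t *\<^sub>R (z - q))) \<partial>lborel) \<in> borel_measurable borel"
    by measurable
  thus ?thesis unfolding line_functional_def[abs_def] using cone_density_measurable
    by (intro borel_measurable_add borel_measurable_times borel_measurable_sum borel_measurable_const) auto
qed

text \<open>The constants integrate to multiples of the volume, the Hessian term to a volume
  integral by dilation about the pole, and the cone terms to surface integrals by central
  projection.\<close>

lemma line_functional_integral:
  assumes q: "generic_point q" and D: "0 \<le> D" "\<And>z. z \<in> \<Omega> \<Longrightarrow> norm (z - q) \<le> D"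
    and dim: "DIM('a) = 2 \<or> DIM('a) = 3" and \<nu>: "0 < \<nu>" and N: "0 \<le> N"
  shows "(\<integral>\<^sup>+z\<in>\<Omega>. line_functional D N \<nu> q z \<partial>lborel) \<le> ennreal ((4 * D\<^sup>2 + N) * measure lborel \<Omega> * \<nu> + (8 * D\<^sup>2 + 2 * D ^ 3) * energy / \<nu>)"
proof -
  let ?h = "mesh_size \<T>" and ?vol = "measure lborel \<Omega>"
  let ?I = "\<lambda>z. \<integral>\<^sup>+t\<in>{0<..}. (ennreal (t\<^sup>2 * sqrt t) * indicator {0<..<2} t) * ennreal (fe_hessian_sq (q + t *\<^sub>R (z - q))) \<partial>lborel"
  let ?A = "\<Sum>K\<in>\<T>. integral\<^sup>L (lebesgue_on K) (hessian_norm_sq (element_poly K))"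
  let ?S = "\<lambda>F. LINT x:F|surface_measure F. (normal_jump F x)\<^sup>2"
  have [measurable]: "\<Omega> \<in> sets borel" using open_domain by simp
  have h: "0 < ?h" by (rule mesh_size_pos)
  have Im[measurable]: "?I \<in> borel_measurable borel" by measurable
  have cm: "cone_density q F \<in> borel_measurable borel" if "F \<in> interior_faces \<T>" for F using cone_density_measurable[OF that] .
  have vol: "emeasure lborel \<Omega> = ennreal ?vol"
    using emeasure_bounded_finite[OF bounded_domain] by (intro emeasure_eq_ennreal_measure) (auto simp: less_top)
  have 1: "(\<integral>\<^sup>+z. ennreal (D\<^sup>2) * (ennreal (1 / \<nu>) * (?I z * indicator \<Omega> z)) \<partial>lborel) \<le> ennreal (D\<^sup>2 * (1 / \<nu> * (8 * ?A)))"
  proof -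
    have "(\<integral>\<^sup>+z. ?I z * indicator \<Omega> z \<partial>lborel) \<le> (\<integral>\<^sup>+z. ?I z \<partial>lborel)" by (intro nn_integral_mono) (auto simp: indicator_def)
    also have "\<dots> = (\<integral>\<^sup>+t\<in>{0<..}. (ennreal (t\<^sup>2 * sqrt t) * indicator {0<..<2} t) * ennreal ((1 / t) ^ DIM('a)) \<partial>lborel) * (\<integral>\<^sup>+y. ennreal (fe_hessian_sq y) \<partial>lborel)"
      by (rule nn_integral_lines) measurable
    also have "\<dots> \<le> ennreal 8 * ennreal ?A" by (intro mult_mono weight_bound dim fe_hessian_sq_integral) auto
    also have "\<dots> = ennreal (8 * ?A)" by (intro ennreal_mult[symmetric] sum_nonneg hessian_integral_nonneg) auto
    finally have "ennreal (D\<^sup>2) * (ennreal (1 / \<nu>) * (\<integral>\<^sup>+z. ?I z * indicator \<Omega> z \<partial>lborel)) \<le> ennreal (D\<^sup>2) * (ennreal (1 / \<nu>) * ennreal (8 * ?A))"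
      by (intro mult_left_mono) auto
    also have "\<dots> = ennreal (D\<^sup>2 * (1 / \<nu> * (8 * ?A)))"
      using \<nu> by (simp add: ennreal_mult[symmetric] sum_nonneg hessian_integral_nonneg)
    finally show ?thesis by (simp add: nn_integral_cmult)
  qed
  have 2: "(\<integral>\<^sup>+z. (\<Sum>F\<in>interior_faces \<T>. (cone_density q F z * indicator \<Omega> z) * ennreal (1 / (\<nu> * ?h))) \<partial>lborel)
     \<le> ennreal (2 * D ^ 3 * (1 / \<nu>) * (\<Sum>F\<in>interior_faces \<T>. inverse (diameter F) * ?S F))"
  proof -
    have "(\<integral>\<^sup>+z. (\<Sum>F\<in>interior_faces \<T>. (cone_density q F z * indicator \<Omega> z) * ennreal (1 / (\<nu> * ?h))) \<partial>lborel)
       = (\<Sum>F\<in>interior_faces \<T>. (\<integral>\<^sup>+z\<in>\<Omega>. cone_density q F z \<partial>lborel) * ennreal (1 / (\<nu> * ?h)))"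
      using cm by (subst nn_integral_sum) (auto simp: nn_integral_multc)
    also have "\<dots> \<le> (\<Sum>F\<in>interior_faces \<T>. ennreal (2 * D ^ 3 * (1 / \<nu>) * (inverse (diameter F) * ?S F)))"
    proof (rule sum_mono)
      fix F assume F: "F \<in> interior_faces \<T>"
      obtain K where K: "K \<in> \<T>" "F facet_of K" using interior_faces_facet[OF F] by blast
      have dF: "0 < diameter F" using facet_diameter_pos[OF K] dim by auto
      have "diameter F \<le> diameter K"
        using K element_bounded face_of_imp_subset by (intro diameter_subset) (auto simp: facet_of_def)
      hence "diameter F \<le> ?h" using diameter_le_mesh_size[OF K(1)] by linarith
      \<comment> \<open>A face is no larger than the mesh size, so the reciprocal mesh size is
        absorbed by the weight in the discrete norm.\<close>
      hence ih: "1 / ?h \<le> inverse (diameter F)" using dF h by (simp add: divide_simps)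
      have "(\<integral>\<^sup>+z\<in>\<Omega>. cone_density q F z \<partial>lborel) * ennreal (1 / (\<nu> * ?h)) \<le> ennreal (2 * D ^ 3) * ennreal (?S F) * ennreal (1 / (\<nu> * ?h))"
        by (intro mult_right_mono cone_density_integral F q D dim) auto
      also have "\<dots> = ennreal (2 * D ^ 3 * ?S F * (1 / (\<nu> * ?h)))"
        using D \<nu> h jump_integral_nonneg[of F] by (simp add: ennreal_mult[symmetric])
      also have "\<dots> \<le> ennreal (2 * D ^ 3 * (1 / \<nu>) * (inverse (diameter F) * ?S F))"
      proof (rule ennreal_leI)
        have "(2 * D ^ 3 * ?S F * (1 / \<nu>)) * (1 / ?h) \<le> (2 * D ^ 3 * ?S F * (1 / \<nu>)) * inverse (diameter F)"
          using D \<nu> jump_integral_nonneg[of F] by (intro mult_left_mono ih) auto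
        thus "2 * D ^ 3 * ?S F * (1 / (\<nu> * ?h)) \<le> 2 * D ^ 3 * (1 / \<nu>) * (inverse (diameter F) * ?S F)"
          by (simp add: mult_ac)
      qed
      finally show "(\<integral>\<^sup>+z\<in>\<Omega>. cone_density q F z \<partial>lborel) * ennreal (1 / (\<nu> * ?h)) \<le> ennreal (2 * D ^ 3 * (1 / \<nu>) * (inverse (diameter F) * ?S F))" .
    qed
    also have "\<dots> = ennreal (\<Sum>F\<in>interior_faces \<T>. 2 * D ^ 3 * (1 / \<nu>) * (inverse (diameter F) * ?S F))"
    proof (rule sum_ennreal)
      fix F assume F: "F \<in> interior_faces \<T>"
      obtain K where K: "K \<in> \<T>" "F facet_of K" using interior_faces_facet[OF F] by blast
      have dF: "0 < diameter F" using facet_diameter_pos[OF K] dim by auto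
      show "0 \<le> 2 * D ^ 3 * (1 / \<nu>) * (inverse (diameter F) * ?S F)" using dF D \<nu> jump_integral_nonneg[of F] by auto
    qed
    also have "\<dots> = ennreal (2 * D ^ 3 * (1 / \<nu>) * (\<Sum>F\<in>interior_faces \<T>. inverse (diameter F) * ?S F))" by (simp add: sum_distrib_left)
    finally show ?thesis .
  qed
  let ?SF = "\<Sum>F\<in>interior_faces \<T>. inverse (diameter F) * ?S F"
  have A0: "0 \<le> ?A" by (intro sum_nonneg hessian_integral_nonneg)
  have S0: "0 \<le> ?SF"
  proof (rule sum_nonneg)
    fix F assume F: "F \<in> interior_faces \<T>"
    obtain K where K: "K \<in> \<T>" "F facet_of K" using interior_faces_facet[OF F] by blast
    have dF: "0 < diameter F" using facet_diameter_pos[OF K] dim by auto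
    show "0 \<le> inverse (diameter F) * ?S F" using dF jump_integral_nonneg[of F] by auto
  qed
  let ?c = "D\<^sup>2 * (4 * \<nu>) + \<nu> * N"
  have c0: "0 \<le> ?c" using \<nu> N by auto
  have "(\<integral>\<^sup>+z\<in>\<Omega>. line_functional D N \<nu> q z \<partial>lborel) = (\<integral>\<^sup>+z. ennreal ?c * indicator \<Omega> z + (ennreal (D\<^sup>2) * (ennreal (1 / \<nu>) * (?I z * indicator \<Omega> z))
      + (\<Sum>F\<in>interior_faces \<T>. (cone_density q F z * indicator \<Omega> z) * ennreal (1 / (\<nu> * ?h)))) \<partial>lborel)"
  proof (rule nn_integral_cong)
    fix z
    have "ennreal ?c = ennreal (D\<^sup>2) * ennreal (4 * \<nu>) + ennreal (\<nu> * N)" using \<nu> N by (simp add: ennreal_mult)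
    thus "line_functional D N \<nu> q z * indicator \<Omega> z = ennreal ?c * indicator \<Omega> z + (ennreal (D\<^sup>2) * (ennreal (1 / \<nu>) * (?I z * indicator \<Omega> z))
      + (\<Sum>F\<in>interior_faces \<T>. (cone_density q F z * indicator \<Omega> z) * ennreal (1 / (\<nu> * ?h))))"
      by (cases "z \<in> \<Omega>") (simp_all add: line_functional_def distrib_left add_ac)
  qed
  also have "\<dots> = ennreal ?c * emeasure lborel \<Omega> + ((\<integral>\<^sup>+z. ennreal (D\<^sup>2) * (ennreal (1 / \<nu>) * (?I z * indicator \<Omega> z)) \<partial>lborel)
      + (\<integral>\<^sup>+z. (\<Sum>F\<in>interior_faces \<T>. (cone_density q F z * indicator \<Omega> z) * ennreal (1 / (\<nu> * ?h))) \<partial>lborel))"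
    using cm by (subst nn_integral_add, measurable, subst nn_integral_add) (auto simp: nn_integral_cmult_indicator)
  also have "\<dots> \<le> ennreal (?c * ?vol) + (ennreal (D\<^sup>2 * (1 / \<nu> * (8 * ?A))) + ennreal (2 * D ^ 3 * (1 / \<nu>) * ?SF))"
    using c0 by (intro add_mono 1 2) (simp add: vol ennreal_mult)
  also have "\<dots> = ennreal (?c * ?vol + (D\<^sup>2 * (1 / \<nu> * (8 * ?A)) + 2 * D ^ 3 * (1 / \<nu>) * ?SF))"
    using c0 A0 S0 D \<nu> by (simp add: ennreal_plus[symmetric] del: ennreal_plus)
  also have "\<dots> \<le> ennreal ((4 * D\<^sup>2 + N) * ?vol * \<nu> + (8 * D\<^sup>2 + 2 * D ^ 3) * energy / \<nu>)"
  proof (rule ennreal_leI)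
    have e: "energy = ?A + ?SF" by (simp add: energy_def)
    have "8 * D\<^sup>2 * ?A + 2 * D ^ 3 * ?SF \<le> (8 * D\<^sup>2 + 2 * D ^ 3) * (?A + ?SF)"
      using A0 S0 D by (simp add: algebra_simps)
    hence "(8 * D\<^sup>2 * ?A + 2 * D ^ 3 * ?SF) / \<nu> \<le> (8 * D\<^sup>2 + 2 * D ^ 3) * energy / \<nu>"
      unfolding e using \<nu> by (intro divide_right_mono) auto
    thus "?c * ?vol + (D\<^sup>2 * (1 / \<nu> * (8 * ?A)) + 2 * D ^ 3 * (1 / \<nu>) * ?SF) \<le> (4 * D\<^sup>2 + N) * ?vol * \<nu> + (8 * D\<^sup>2 + 2 * D ^ 3) * energy / \<nu>"
      by (simp add: algebra_simps add_divide_distrib)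
  qed
  finally show ?thesis .
qed

end

section \<open>The pointwise bound\<close>

context finite_element_function
begin

lemma AE_affine_not_frontier:
  assumes s: "0 < s"
  shows "AE z in lborel. \<forall>K\<in>\<T>. c + s *\<^sub>R z \<notin> frontier K"
  using finite_mesh
proof (rule AE_finite_allI)
  fix K assume K: "K \<in> \<T>"
  have [measurable]: "frontier K \<in> sets borel" by (intro borel_closed) simp
  have "negligible (frontier K)" using element_convex[OF K] by (rule negligible_convex_frontier)
  hence "emeasure lborel (frontier K) = 0" by (simp add: negligible_iff_null_sets null_sets_def)
  hence "(\<integral>\<^sup>+z. indicator (frontier K) z \<partial>(lborel::'a measure)) = 0" by simp
  hence "ennreal (s ^ DIM('a)) * (\<integral>\<^sup>+z. indicator (frontier K) (c + s *\<^sub>R z) \<partial>lborel) = 0"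
    by (subst nn_integral_lborel_scale[OF _ s]) auto
  hence "(\<integral>\<^sup>+z. indicator (frontier K) (c + s *\<^sub>R z) \<partial>lborel) = (0::ennreal)" using s by simp
  hence "AE z in lborel. indicator (frontier K) (c + s *\<^sub>R z) = (0::ennreal)"
    by (subst (asm) nn_integral_0_iff_AE) auto
  thus "AE z in lborel. c + s *\<^sub>R z \<notin> frontier K" by eventually_elim (auto simp: indicator_def split: if_splits)
qed

lemma AE_not_break:
  assumes t: "0 < t" shows "AE z in lborel. t \<notin> breaks q (z - q)"
proof -
  have e: "q + t *\<^sub>R (z - q) = (q - t *\<^sub>R q) + t *\<^sub>R z" for z by (simp add: algebra_simps)
  show ?thesis using AE_affine_not_frontier[OF t, of "q - t *\<^sub>R q"]
    by eventually_elim (simp add: breaks_def e)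
qed

text \<open>The limits at both ends of the chord are zero, so up to sign the second difference is
  \<open>b - a\<close> times the value at \<open>z\<close>. Confinement to parameters between 1/2
  and 3/2 places the ends where a good line has limits.\<close>

lemma chord_bound:
  assumes g: "good_line q (z - q)" and z: "z \<in> \<Omega>" "1 \<notin> breaks q (z - q)"
    and far: "\<And>t. q + t *\<^sub>R (z - q) \<in> \<Omega> \<Longrightarrow> 1/2 \<le> t \<and> t \<le> 3/2"
    and D: "norm (z - q) \<le> D" and N: "real (card (breaks q (z - q) \<inter> {0<..<2})) * mesh_size \<T> \<le> N" and \<nu>: "0 < \<nu>"
  shows "ennreal \<bar>fe_value z\<bar> \<le> line_functional D N \<nu> q z"
proof -
  let ?y = "\<lambda>t. q + t *\<^sub>R (z - q)"
  define I where "I = {t. ?y t \<in> \<Omega>}"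
  have I1: "1 \<in> I" using z by (simp add: I_def)
  have Ib: "I \<subseteq> {1/2..3/2}" using far by (auto simp: I_def)
  have bdd: "bdd_below I" "bdd_above I" using Ib by (auto intro: bdd_below_mono bdd_above_mono)
  have Iop: "\<exists>\<epsilon>>0. \<forall>x. \<bar>x - t\<bar> < \<epsilon> \<longrightarrow> x \<in> I" if "t \<in> I" for t
  proof -
    have "\<forall>\<^sub>F x in nhds t. ?y x \<in> \<Omega>" by (rule line_eventually_interior) (use that open_domain in \<open>auto simp: I_def\<close>)
    thus ?thesis by (auto simp: eventually_nhds_metric dist_real_def I_def)
  qed
  define a where "a = Inf I"
  define b where "b = Sup I"
  have aI: "a \<le> t" "t \<le> b" if "t \<in> I" for t using that bdd by (auto simp: a_def b_def intro: cInf_lower cSup_upper)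
  have ne: "I \<noteq> {}" using I1 by auto
  have a12: "1/2 \<le> a" using Ib ne unfolding a_def by (intro cInf_greatest) auto
  have b32: "b \<le> 3/2" using Ib ne unfolding b_def by (intro cSup_least) auto
  obtain \<epsilon> where \<epsilon>: "\<epsilon> > 0" "\<And>x. \<bar>x - 1\<bar> < \<epsilon> \<Longrightarrow> x \<in> I" using Iop[OF I1] by blast
  have a1: "a < 1" using aI(1)[OF \<epsilon>(2)[of "1 - \<epsilon>/2"]] \<epsilon>(1) by auto
  have b1: "1 < b" using aI(2)[OF \<epsilon>(2)[of "1 + \<epsilon>/2"]] \<epsilon>(1) by auto
  have ins: "?y t \<in> \<Omega>" if t: "a < t" "t < b" for t
  proof -
    obtain t1 where t1: "t1 \<in> I" "t1 < t" using t(1) cInf_less_iff[OF ne bdd(1)] by (auto simp: a_def)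
    obtain t2 where t2: "t2 \<in> I" "t < t2" using t(2) less_cSup_iff[OF ne bdd(2)] by (auto simp: b_def)
    define u where "u = (t - t1) / (t2 - t1)"
    have u: "0 \<le> u" "u \<le> 1" using t1 t2 by (auto simp: u_def divide_simps)
    have "u * (t2 - t1) = t - t1" using t1 t2 by (simp add: u_def)
    hence tu: "t = (1 - u) * t1 + u * t2" by (simp add: algebra_simps)
    have "?y t = (1 - u) *\<^sub>R ?y t1 + u *\<^sub>R ?y t2" unfolding tu by (simp add: algebra_simps)
    thus ?thesis using convex_domain t1(1) t2(1) u by (simp add: I_def convex_alt)
  qed
  \<comment> \<open>The two-sided limit exists on a good line, and on one side the line is outside
    \<open>\<Omega>\<close>, where \<open>fe_value\<close> is zero.\<close>
  have z0: "((\<lambda>t. fe_value (?y t)) \<longlongrightarrow> 0) (at t0)" if t0: "t0 \<in> {0<..<2}" and ev: "(\<forall>\<^sub>F t in at_left t0. t \<notin> I) \<or> (\<forall>\<^sub>F t in at_right t0. t \<notin> I)" for t0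
  proof -
    obtain l where l: "((\<lambda>t. fe_value (?y t)) \<longlongrightarrow> l) (at t0)" using g t0 unfolding good_line_def by blast
    hence ll: "((\<lambda>t. fe_value (?y t)) \<longlongrightarrow> l) (at_left t0)" "((\<lambda>t. fe_value (?y t)) \<longlongrightarrow> l) (at_right t0)"
      by (auto intro: filterlim_mono[OF _ order_refl] simp: at_le)
    have Vz: "fe_value (?y t) = 0" if "t \<notin> I" for t using piecewise_outside[of "?y t" element_poly] that by (simp add: I_def fe_value_def)
    from ev have "l = 0"
    proof
      assume "\<forall>\<^sub>F t in at_left t0. t \<notin> I"
      hence "\<forall>\<^sub>F t in at_left t0. fe_value (?y t) = 0" by eventually_elim (rule Vz)
      hence "((\<lambda>t. fe_value (?y t)) \<longlongrightarrow> 0) (at_left t0)" by (rule tendsto_eventually)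
      thus "l = 0" using tendsto_unique[OF trivial_limit_at_left_real ll(1)] by blast
    next
      assume "\<forall>\<^sub>F t in at_right t0. t \<notin> I"
      hence "\<forall>\<^sub>F t in at_right t0. fe_value (?y t) = 0" by eventually_elim (rule Vz)
      hence "((\<lambda>t. fe_value (?y t)) \<longlongrightarrow> 0) (at_right t0)" by (rule tendsto_eventually)
      thus "l = 0" using tendsto_unique[OF trivial_limit_at_right_real ll(2)] by blast
    qed
    thus ?thesis using l by simp
  qed
  have "\<forall>\<^sub>F t in at_left a. t \<notin> I" by (rule eventually_at_left_germ[of 1]) (use aI in force)+
  hence "((\<lambda>t. fe_value (?y t)) \<longlongrightarrow> 0) (at a)" using a12 a1 by (intro z0) auto
  hence la: "((\<lambda>t. fe_value (?y t)) \<longlongrightarrow> 0) (at_right a)" by (auto intro: filterlim_mono[OF _ order_refl] simp: at_le)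
  have "\<forall>\<^sub>F t in at_right b. t \<notin> I" by (rule eventually_at_right_germ[of 1]) (use aI in force)+
  hence "((\<lambda>t. fe_value (?y t)) \<longlongrightarrow> 0) (at b)" using b32 b1 by (intro z0) auto
  hence lb: "((\<lambda>t. fe_value (?y t)) \<longlongrightarrow> 0) (at_left b)" by (auto intro: filterlim_mono[OF _ order_refl] simp: at_le)
  have h: "0 < \<nu> * mesh_size \<T>" using \<nu> mesh_size_pos by simp
  \<comment> \<open>With \<open>\<kappa> = b - a\<close> the factor on the left cancels, so short
    chords cause no loss.\<close>
  have "ennreal \<bar>(b - 1) * 0 - (b - a) * fe_value (?y 1) + (1 - a) * 0\<bar> \<le> ennreal (b - a) *
    ((\<integral>\<^sup>+t\<in>{0<..<2}. ennreal (t * ((norm (z - q))\<^sup>2 * sqrt (fe_hessian_sq (?y t)))) \<partial>lborel)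
     + (ennreal (\<nu> * mesh_size \<T> * real (card (breaks q (z - q) \<inter> {0<..<2}))) + (\<Sum>F\<in>interior_faces \<T>. cone_density q F z * ennreal (1 / (\<nu> * mesh_size \<T>)))))"
  proof (rule line_bound[OF g _ a1 b1 _ ins z(2) _ _ _ la lb h])
    show "(b - 1) * (t - a) \<le> (b - a) * t" if "a < t" "t \<le> 1" for t
      using that a1 a12 b1 by (intro mult_mono) auto
    show "(1 - a) * (b - t) \<le> (b - a) * t" if "1 \<le> t" "t < b" for t
      using that a1 a12 b1 b32 by (intro mult_mono) auto
  qed (use a12 b32 a1 b1 in auto)
  also have "\<dots> \<le> ennreal (b - a) * line_functional D N \<nu> q z"
    by (intro mult_left_mono line_functional_le_W D N \<nu>) auto
  finally have "ennreal (b - a) * ennreal \<bar>fe_value z\<bar> \<le> ennreal (b - a) * line_functional D N \<nu> q z"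
    using a1 b1 by (simp add: ennreal_mult[symmetric] abs_mult)
  thus ?thesis using a1 b1 by (subst (asm) ennreal_mult_le_mult_iff) auto
qed

text \<open>A second difference at parameters 0, 1/2 and 1. The limit at the pole is available since
  a generic point lies on no element boundary, so \<open>fe_value\<close> is continuous there along
  the line.\<close>

lemma pole_bound:
  assumes g: "good_line x (z - x)" and z: "x \<in> \<Omega>" "z \<in> \<Omega>" "1 \<notin> breaks x (z - x)" "1/2 \<notin> breaks x (z - x)"
    and D: "norm (z - x) \<le> D" and N: "real (card (breaks x (z - x) \<inter> {0<..<2})) * mesh_size \<T> \<le> N" and \<nu>: "0 < \<nu>"
  shows "ennreal \<bar>fe_value x\<bar> \<le> 2 * ennreal \<bar>fe_value ((1/2) *\<^sub>R x + (1/2) *\<^sub>R z)\<bar> + ennreal \<bar>fe_value z\<bar> + line_functional D N \<nu> x z"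
proof -
  let ?y = "\<lambda>t. x + t *\<^sub>R (z - x)" and ?m = "(1/2) *\<^sub>R x + (1/2) *\<^sub>R z"
  have gx: "generic_point x" using g by (simp add: good_line_def generic_line_def)
  have "?y t = (1 - t) *\<^sub>R x + t *\<^sub>R z" for t by (simp add: algebra_simps)
  from this[of "1/2"] have y12: "?y (1/2) = ?m" by simp
  have "0 \<notin> breaks x (z - x)" using generic_point_not_frontier[OF gx] by (auto simp: breaks_def)
  from isCont_line[OF this] have l0: "((\<lambda>t. fe_value (?y t)) \<longlongrightarrow> fe_value x) (at_right 0)"
    by (auto simp: isCont_def intro: filterlim_mono[OF _ order_refl] at_le)
  from isCont_line[OF z(3)] have l1: "((\<lambda>t. fe_value (?y t)) \<longlongrightarrow> fe_value z) (at_left 1)"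
    by (auto simp: isCont_def intro: filterlim_mono[OF _ order_refl] at_le)
  have ins: "?y t \<in> \<Omega>" if "0 < t" "t < 1" for t
  proof -
    have "?y t = (1 - t) *\<^sub>R x + t *\<^sub>R z" by (simp add: algebra_simps)
    thus ?thesis using convex_domain z(1,2) that by (simp add: convex_alt)
  qed
  have h: "0 < \<nu> * mesh_size \<T>" using \<nu> mesh_size_pos by simp
  \<comment> \<open>Here \<open>\<kappa> = 1/2\<close>: the kernel is \<open>t / 2\<close> up to the
    midpoint and \<open>(1 - t) / 2\<close> beyond it, which is at most
    \<open>t / 2\<close>.\<close>
  have "ennreal \<bar>(1 - 1/2) * fe_value x - (1 - 0) * fe_value (?y (1/2)) + (1/2 - 0) * fe_value z\<bar> \<le> ennreal (1/2) *
    ((\<integral>\<^sup>+t\<in>{0<..<2}. ennreal (t * ((norm (z - x))\<^sup>2 * sqrt (fe_hessian_sq (?y t)))) \<partial>lborel)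
     + (ennreal (\<nu> * mesh_size \<T> * real (card (breaks x (z - x) \<inter> {0<..<2}))) + (\<Sum>F\<in>interior_faces \<T>. cone_density x F z * ennreal (1 / (\<nu> * mesh_size \<T>)))))"
    by (rule line_bound[OF g _ _ _ _ ins z(4) _ _ _ l0 l1 h]) auto
  also have "\<dots> \<le> ennreal (1/2) * line_functional D N \<nu> x z"
    by (intro mult_left_mono line_functional_le_W D N \<nu>) auto
  finally have 1: "ennreal \<bar>fe_value x / 2 - fe_value ?m + fe_value z / 2\<bar> \<le> ennreal (1/2) * line_functional D N \<nu> x z"
    unfolding y12 by simp
  show ?thesis
  proof (cases "line_functional D N \<nu> x z = \<infinity>")
    case True thus ?thesis by simp
  next
    case False
    then obtain w where w: "line_functional D N \<nu> x z = ennreal w" "0 \<le> w" by (cases "line_functional D N \<nu> x z") auto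
    have "\<bar>fe_value x / 2 - fe_value ?m + fe_value z / 2\<bar> \<le> 1/2 * w"
      using 1 w by (simp add: ennreal_mult[symmetric] del: ennreal_half)
    hence "\<bar>fe_value x\<bar> \<le> 2 * \<bar>fe_value ?m\<bar> + \<bar>fe_value z\<bar> + w" by linarith
    hence "ennreal \<bar>fe_value x\<bar> \<le> ennreal (2 * \<bar>fe_value ?m\<bar> + \<bar>fe_value z\<bar> + w)" by (rule ennreal_leI)
    thus ?thesis using w by (simp add: ennreal_mult)
  qed
qed

lemma energy_nonneg:
  assumes dim: "DIM('a) = 2 \<or> DIM('a) = 3"
  shows "0 \<le> energy"
  unfolding energy_def
proof (intro add_nonneg_nonneg sum_nonneg hessian_integral_nonneg mult_nonneg_nonneg jump_integral_nonneg)
  fix F assume F: "F \<in> interior_faces \<T>"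
  obtain K where K: "K \<in> \<T>" "F facet_of K" using interior_faces_facet[OF F] by blast
  show "0 \<le> inverse (diameter F)" using facet_diameter_pos[OF K] dim by auto
qed

lemma nongeneric_null: "AE q in lborel. generic_point q"
proof -
  have "AE q in lebesgue. q \<notin> {q. \<not> generic_point q}"
    using negligible_nongeneric_point by (intro AE_not_in) (simp add: negligible_iff_null_sets)
  thus ?thesis by (simp add: AE_completion_iff)
qed

lemma domain_radius_pos: assumes "\<Omega> \<subseteq> ball 0 R" shows "0 < R"
  using assms nonempty_domain by (metis ball_eq_empty not_le subset_empty)

lemma regularity_nonneg:
  assumes sr: "shape_regular \<sigma> \<T>" and qu: "quasi_uniform \<tau> \<T>" and R: "\<Omega> \<subseteq> ball 0 R"
  shows "0 \<le> 36 * R * (8 * \<sigma> * \<tau>) ^ DIM('a)"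
proof -
  obtain K0 where K0: "K0 \<in> \<T>" using mesh_nonempty by blast
  show ?thesis using element_contains_ball(1,2)[OF sr qu K0] domain_radius_pos[OF R] by simp
qed

lemma breaks_le:
  assumes sr: "shape_regular \<sigma> \<T>" and qu: "quasi_uniform \<tau> \<T>" and R: "\<Omega> \<subseteq> ball 0 R"
    and q: "norm (z - q) \<le> 8 * R" and g: "good_line q (z - q)"
  shows "real (card (breaks q (z - q) \<inter> {0<..<2})) * mesh_size \<T> \<le> 36 * R * (8 * \<sigma> * \<tau>) ^ DIM('a)"
proof -
  obtain K0 where K0: "K0 \<in> \<T>" using mesh_nonempty by blast
  have st: "\<sigma> > 0" "\<tau> > 0" using element_contains_ball[OF sr qu K0] by auto
  have R0: "0 < R" by (rule domain_radius_pos[OF R])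
  have "mesh_size \<T> \<le> 2 * R"
    unfolding mesh_size_def
  proof (rule Max.boundedI)
    fix d assume "d \<in> diameter ` \<T>"
    then obtain K where K: "K \<in> \<T>" "d = diameter K" by blast
    have "K \<subseteq> cball 0 R"
    proof -
      have "closure \<Omega> \<subseteq> cball 0 R" using R ball_subset_cball by (intro closure_minimal) auto
      thus ?thesis using K(1) union_mesh by blast
    qed
    hence "diameter K \<le> diameter (cball (0::'a) R)" by (intro diameter_subset) auto
    thus "d \<le> 2 * R" using K R0 by simp
  qed (use finite_mesh mesh_nonempty in auto)
  \<comment> \<open>The constant 36 is twice the sum of 16, from
    \<open>norm (z - q) \<le> 8 * R\<close>, and 2, from the bound on the mesh size.\<close>
  hence "2 * (2 * norm (z - q) + mesh_size \<T>) * (8 * \<sigma> * \<tau>) ^ DIM('a) \<le> (36 * R) * (8 * \<sigma> * \<tau>) ^ DIM('a)"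
    using q st by (intro mult_right_mono) auto
  thus "real (card (breaks q (z - q) \<inter> {0<..<2})) * mesh_size \<T> \<le> 36 * R * (8 * \<sigma> * \<tau>) ^ DIM('a)"
    using card_breaks_bound[OF sr qu] g by (fastforce simp: good_line_def)
qed

lemma fe_value_integral_bound:
  assumes sr: "shape_regular \<sigma> \<T>" and qu: "quasi_uniform \<tau> \<T>" and R: "\<Omega> \<subseteq> ball 0 R"
    and dim: "DIM('a) = 2 \<or> DIM('a) = 3" and \<nu>: "0 < \<nu>"
  shows "(\<integral>\<^sup>+z\<in>\<Omega>. ennreal \<bar>fe_value z\<bar> \<partial>lborel)
    \<le> ennreal ((4 * (8 * R)\<^sup>2 + 36 * R * (8 * \<sigma> * \<tau>) ^ DIM('a)) * measure lborel \<Omega> * \<nu> + (8 * (8 * R)\<^sup>2 + 2 * (8 * R) ^ 3) * energy / \<nu>)"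
proof -
  have R0: "0 < R" by (rule domain_radius_pos[OF R])
  obtain i :: 'a where i: "i \<in> Basis" using nonempty_Basis by blast
  \<comment> \<open>A pole within \<open>R\<close> of this point has norm between
    \<open>5 * R\<close> and \<open>7 * R\<close>, hence distance between \<open>4 * R\<close> and
    \<open>8 * R\<close> from every point of \<open>\<Omega>\<close>. Two points of
    \<open>\<Omega>\<close> are less than \<open>2 * R\<close> apart, so the parameters of a chord
    differ from 1 by at most 1/2.\<close>
  let ?c = "(6 * R) *\<^sub>R i"
  have nc: "norm ?c = 6 * R" using i R0 by simp
  obtain q where q: "generic_point q" "q \<in> ball ?c R"
  proof -
    obtain M where M: "{q \<in> space lborel. \<not> generic_point q} \<subseteq> M" "M \<in> null_sets lborel"
      using nongeneric_null unfolding eventually_ae_filter by auto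
    have "negligible M" using M by (simp add: negligible_iff_null_sets null_sets_completionI)
    hence "\<not> ball ?c R \<subseteq> M" using open_not_negligible[OF open_ball] R0 negligible_subset by (metis ball_eq_empty not_le)
    then obtain y where "y \<in> ball ?c R" "y \<notin> M" by blast
    thus ?thesis using that[of y] M(1) by auto
  qed
  have nq: "5 * R \<le> norm q" "norm q \<le> 7 * R"
  proof -
    have d: "norm (?c - q) < R" using q(2) by (simp add: dist_norm)
    have "norm ?c \<le> norm (?c - q) + norm q" using norm_triangle_ineq[of "?c - q" q] by simp
    thus "5 * R \<le> norm q" using d nc by linarith
    have "norm q \<le> norm ?c + norm (?c - q)" using norm_triangle_ineq4[of ?c "?c - q"] by simp
    thus "norm q \<le> 7 * R" using d nc by linarith
  qed
  have nz: "norm z < R" if "z \<in> \<Omega>" for z using that R by auto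
  have D: "norm (z - q) \<le> 8 * R" if "z \<in> \<Omega>" for z
    using norm_triangle_ineq4[of z q] nz[OF that] nq by linarith
  have far: "1/2 \<le> t \<and> t \<le> 3/2" if z: "z \<in> \<Omega>" and t: "q + t *\<^sub>R (z - q) \<in> \<Omega>" for z t
  proof -
    have "norm (z - q) \<ge> 4 * R" using norm_triangle_ineq2[of q z] nz[OF z] nq norm_minus_commute[of z q] by linarith
    hence "\<bar>t - 1\<bar> * (4 * R) \<le> \<bar>t - 1\<bar> * norm (z - q)" by (intro mult_left_mono) auto
    also have "\<dots> = norm ((q + t *\<^sub>R (z - q)) - z)"
    proof -
      have "(q + t *\<^sub>R (z - q)) - z = (t - 1) *\<^sub>R (z - q)" by (simp add: algebra_simps)
      thus ?thesis by simp
    qed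
    also have "\<dots> \<le> norm (q + t *\<^sub>R (z - q)) + norm z" by (rule norm_triangle_ineq4)
    also have "\<dots> \<le> 2 * R" using nz[OF z] nz[OF t] by linarith
    finally have "(2 * R) * (2 * \<bar>t - 1\<bar>) \<le> (2 * R) * 1" by (simp add: algebra_simps)
    hence t1: "2 * \<bar>t - 1\<bar> \<le> 1" using R0 by (simp only: mult_le_cancel_left_pos)
    have 1: "t - 1 \<le> \<bar>t - 1\<bar>" by (rule abs_ge_self)
    have 2: "- (t - 1) \<le> \<bar>t - 1\<bar>" by (rule abs_ge_minus_self)
    have "1/2 \<le> t" using t1 2 by (simp add: field_simps)
    moreover have "t \<le> 3/2" using t1 1 by (simp add: field_simps)
    ultimately show ?thesis ..
  qed
  have N0: "0 \<le> 36 * R * (8 * \<sigma> * \<tau>) ^ DIM('a)" by (rule regularity_nonneg[OF sr qu R])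
  have "(\<integral>\<^sup>+z\<in>\<Omega>. ennreal \<bar>fe_value z\<bar> \<partial>lborel) \<le> (\<integral>\<^sup>+z\<in>\<Omega>. line_functional (8 * R) (36 * R * (8 * \<sigma> * \<tau>) ^ DIM('a)) \<nu> q z \<partial>lborel)"
  proof (rule nn_integral_mono_AE)
    show "AE z in lborel. ennreal \<bar>fe_value z\<bar> * indicator \<Omega> z \<le> line_functional (8 * R) (36 * R * (8 * \<sigma> * \<tau>) ^ DIM('a)) \<nu> q z * indicator \<Omega> z"
      using AE_good_line[OF q(1)] AE_not_break[OF zero_less_one, of q]
    proof eventually_elim
      case (elim z)
      show ?case
      proof (cases "z \<in> \<Omega>")
        case True
        have "ennreal \<bar>fe_value z\<bar> \<le> line_functional (8 * R) (36 * R * (8 * \<sigma> * \<tau>) ^ DIM('a)) \<nu> q z"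
          by (rule chord_bound[OF elim(1) True elim(2) far[OF True] D[OF True] breaks_le[OF sr qu R D[OF True] elim(1)] \<nu>])
        thus ?thesis using True by simp
      qed simp
    qed
  qed
  also have "\<dots> \<le> ennreal ((4 * (8 * R)\<^sup>2 + 36 * R * (8 * \<sigma> * \<tau>) ^ DIM('a)) * measure lborel \<Omega> * \<nu> + (8 * (8 * R)\<^sup>2 + 2 * (8 * R) ^ 3) * energy / \<nu>)"
    by (rule line_functional_integral[OF q(1) _ D dim \<nu> N0]) (use R0 in auto)
  finally show ?thesis .
qed

lemma ennreal_two_products:
  fixes c B :: real
  assumes "0 \<le> c" "0 \<le> B"
  shows "2 * (ennreal c * ennreal B) + (ennreal B + ennreal B) = ennreal ((2 * c + 2) * B)"
proof -
  have "(2 * c + 2) * B = 2 * (c * B) + (B + B)" by (simp add: algebra_simps)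
  also have "ennreal \<dots> = ennreal (2 * (c * B)) + ennreal (B + B)" using assms by (intro ennreal_plus) auto
  also have "ennreal (B + B) = ennreal B + ennreal B" using assms by (intro ennreal_plus)
  also have "ennreal (2 * (c * B)) = ennreal 2 * ennreal (c * B)" using assms by (intro ennreal_mult) auto
  also have "ennreal (c * B) = ennreal c * ennreal B" using assms by (intro ennreal_mult)
  finally show ?thesis by simp
qed

text \<open>The three-point bound at the pole is integrated over \<open>z\<close>. The midpoint map
  scales volumes by the reciprocal of \<open>2 ^ DIM('a)\<close>, hence the first part of the
  constant; the value at \<open>z\<close> and the line functional contribute 1 each.\<close>

lemma fe_value_pointwise_bound:
  assumes sr: "shape_regular \<sigma> \<T>" and qu: "quasi_uniform \<tau> \<T>" and R: "\<Omega> \<subseteq> ball 0 R"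
    and dim: "DIM('a) = 2 \<or> DIM('a) = 3" and \<nu>: "0 < \<nu>" and x: "x \<in> \<Omega>" "generic_point x"
  shows "\<bar>fe_value x\<bar> * measure lborel \<Omega> \<le> (2 * 2 ^ DIM('a) + 2) *
     ((4 * (8 * R)\<^sup>2 + 36 * R * (8 * \<sigma> * \<tau>) ^ DIM('a)) * measure lborel \<Omega> * \<nu> + (8 * (8 * R)\<^sup>2 + 2 * (8 * R) ^ 3) * energy / \<nu>)"
proof -
  let ?N = "36 * R * (8 * \<sigma> * \<tau>) ^ DIM('a)" and ?vol = "measure lborel \<Omega>"
  let ?B = "(4 * (8 * R)\<^sup>2 + ?N) * ?vol * \<nu> + (8 * (8 * R)\<^sup>2 + 2 * (8 * R) ^ 3) * energy / \<nu>"
  let ?m = "\<lambda>z. (1/2) *\<^sub>R x + (1/2) *\<^sub>R z"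
  have R0: "0 < R" by (rule domain_radius_pos[OF R])
  have N0: "0 \<le> ?N" by (rule regularity_nonneg[OF sr qu R])
  have B0: "0 \<le> ?B"
  proof (rule add_nonneg_nonneg)
    have "0 \<le> 4 * (8 * R)\<^sup>2 + ?N" using N0 by (intro add_nonneg_nonneg) auto
    thus "0 \<le> (4 * (8 * R)\<^sup>2 + ?N) * ?vol * \<nu>" using \<nu> by (intro mult_nonneg_nonneg[OF mult_nonneg_nonneg]) auto
    show "0 \<le> (8 * (8 * R)\<^sup>2 + 2 * (8 * R) ^ 3) * energy / \<nu>" using R0 \<nu> energy_nonneg[OF dim] by simp
  qed
  have D: "norm (z - x) \<le> 8 * R" if "z \<in> \<Omega>" for z
  proof -
    have "norm z < R" "norm x < R" using that x(1) R by auto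
    thus ?thesis using norm_triangle_ineq4[of z x] R0 by linarith
  qed
  have [measurable]: "\<Omega> \<in> sets borel" using open_domain by simp
  have [measurable]: "line_functional (8 * R) ?N \<nu> x \<in> borel_measurable borel" by (rule line_functional_measurable)
  have vol: "emeasure lborel \<Omega> = ennreal ?vol"
    using emeasure_bounded_finite[OF bounded_domain] by (intro emeasure_eq_ennreal_measure) (auto simp: less_top)
  have VB: "(\<integral>\<^sup>+z\<in>\<Omega>. ennreal \<bar>fe_value z\<bar> \<partial>lborel) \<le> ennreal ?B" by (rule fe_value_integral_bound[OF sr qu R dim \<nu>])
  have WB: "(\<integral>\<^sup>+z\<in>\<Omega>. line_functional (8 * R) ?N \<nu> x z \<partial>lborel) \<le> ennreal ?B"
    by (rule line_functional_integral[OF x(2) _ D dim \<nu> N0]) (use R0 in auto)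
  \<comment> \<open>The integral is enlarged to the whole space, rescaled there, and returned to
    \<open>\<Omega>\<close>, outside of which \<open>fe_value\<close> is zero.\<close>
  have mid: "(\<integral>\<^sup>+z\<in>\<Omega>. ennreal \<bar>fe_value (?m z)\<bar> \<partial>lborel) \<le> ennreal (2 ^ DIM('a)) * ennreal ?B"
  proof -
    have "(\<integral>\<^sup>+z\<in>\<Omega>. ennreal \<bar>fe_value (?m z)\<bar> \<partial>lborel) \<le> (\<integral>\<^sup>+z. ennreal \<bar>fe_value (?m z)\<bar> \<partial>lborel)"
      by (intro nn_integral_mono) (auto simp: indicator_def)
    also have "\<dots> = ennreal (2 ^ DIM('a)) * (ennreal ((1/2) ^ DIM('a)) * (\<integral>\<^sup>+z. ennreal \<bar>fe_value (?m z)\<bar> \<partial>lborel))"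
    proof -
      have "(2::real) ^ DIM('a) * (1/2) ^ DIM('a) = 1" by (simp add: power_mult_distrib[symmetric])
      hence "ennreal (2 ^ DIM('a)) * ennreal ((1/2) ^ DIM('a)) = 1" by (subst ennreal_mult[symmetric]) auto
      thus ?thesis by (simp only: mult.assoc[symmetric] mult_1_left)
    qed
    also have "ennreal ((1/2) ^ DIM('a)) * (\<integral>\<^sup>+z. ennreal \<bar>fe_value (?m z)\<bar> \<partial>lborel) = (\<integral>\<^sup>+z. ennreal \<bar>fe_value z\<bar> \<partial>lborel)"
      by (rule nn_integral_lborel_scale) auto
    also have "(\<integral>\<^sup>+z. ennreal \<bar>fe_value z\<bar> \<partial>lborel) = (\<integral>\<^sup>+z\<in>\<Omega>. ennreal \<bar>fe_value z\<bar> \<partial>lborel)"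
      using piecewise_outside[of _ element_poly] by (intro nn_integral_cong) (auto simp: indicator_def fe_value_def)
    also have "ennreal (2 ^ DIM('a)) * \<dots> \<le> ennreal (2 ^ DIM('a)) * ennreal ?B" by (intro mult_left_mono VB) auto
    finally show ?thesis .
  qed
  have "ennreal \<bar>fe_value x\<bar> * ennreal ?vol = (\<integral>\<^sup>+z. ennreal \<bar>fe_value x\<bar> * indicator \<Omega> z \<partial>lborel)"
    unfolding vol[symmetric] by (rule nn_integral_cmult_indicator[symmetric]) simp
  also have "\<dots> \<le> (\<integral>\<^sup>+z. 2 * (ennreal \<bar>fe_value (?m z)\<bar> * indicator \<Omega> z) + (ennreal \<bar>fe_value z\<bar> * indicator \<Omega> z + line_functional (8 * R) ?N \<nu> x z * indicator \<Omega> z) \<partial>lborel)"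
  proof (rule nn_integral_mono_AE)
    have half: "0 < (1/2::real)" by simp
    show "AE z in lborel. ennreal \<bar>fe_value x\<bar> * indicator \<Omega> z \<le> 2 * (ennreal \<bar>fe_value (?m z)\<bar> * indicator \<Omega> z) + (ennreal \<bar>fe_value z\<bar> * indicator \<Omega> z + line_functional (8 * R) ?N \<nu> x z * indicator \<Omega> z)"
      using AE_good_line[OF x(2)] AE_not_break[OF zero_less_one, of x] AE_not_break[OF half, of x]
    proof eventually_elim
      case (elim z)
      show ?case
      proof (cases "z \<in> \<Omega>")
        case True
        have "ennreal \<bar>fe_value x\<bar> \<le> 2 * ennreal \<bar>fe_value (?m z)\<bar> + ennreal \<bar>fe_value z\<bar> + line_functional (8 * R) ?N \<nu> x z"
          by (rule pole_bound[OF elim(1) x(1) True elim(2,3) D[OF True] breaks_le[OF sr qu R D[OF True] elim(1)] \<nu>])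
        thus ?thesis using True by (simp add: add.assoc)
      qed simp
    qed
  qed
  also have "\<dots> = 2 * (\<integral>\<^sup>+z\<in>\<Omega>. ennreal \<bar>fe_value (?m z)\<bar> \<partial>lborel) + ((\<integral>\<^sup>+z\<in>\<Omega>. ennreal \<bar>fe_value z\<bar> \<partial>lborel) + (\<integral>\<^sup>+z\<in>\<Omega>. line_functional (8 * R) ?N \<nu> x z \<partial>lborel))"
    by (subst nn_integral_add, measurable, subst nn_integral_add, measurable) (simp add: nn_integral_cmult)
  also have "\<dots> \<le> 2 * (ennreal (2 ^ DIM('a)) * ennreal ?B) + (ennreal ?B + ennreal ?B)"
    by (intro add_mono mult_left_mono mid VB WB) auto
  also have "\<dots> = ennreal ((2 * 2 ^ DIM('a) + 2) * ?B)"
    by (rule ennreal_two_products) (simp, rule B0)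
  finally have "ennreal (\<bar>fe_value x\<bar> * ?vol) \<le> ennreal ((2 * 2 ^ DIM('a) + 2) * ?B)" by (simp only: ennreal_mult abs_ge_zero measure_nonneg)
  thus ?thesis using B0 by (subst (asm) ennreal_le_iff) (intro mult_nonneg_nonneg, auto)
qed

lemma fe_value_sup_bound:
  assumes sr: "shape_regular \<sigma> \<T>" and qu: "quasi_uniform \<tau> \<T>" and R: "\<Omega> \<subseteq> ball 0 R"
    and dim: "DIM('a) = 2 \<or> DIM('a) = 3" and x: "x \<in> \<Omega>" "generic_point x"
  shows "\<bar>fe_value x\<bar> \<le> (2 * 2 ^ DIM('a) + 2) * ((4 * (8 * R)\<^sup>2 + 36 * R * (8 * \<sigma> * \<tau>) ^ DIM('a)) * measure lborel \<Omega>
     + (8 * (8 * R)\<^sup>2 + 2 * (8 * R) ^ 3)) / measure lborel \<Omega> * discrete_norm k \<T> v"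
proof -
  let ?vol = "measure lborel \<Omega>" and ?c = "2 * 2 ^ DIM('a) + 2 :: real"
  let ?C1 = "(4 * (8 * R)\<^sup>2 + 36 * R * (8 * \<sigma> * \<tau>) ^ DIM('a)) * ?vol" and ?C2 = "8 * (8 * R)\<^sup>2 + 2 * (8 * R) ^ 3"
  have vol: "0 < ?vol"
  proof -
    obtain y r where y: "0 < r" "ball y r \<subseteq> \<Omega>" using open_domain nonempty_domain open_contains_ball by blast
    have fin: "\<Omega> \<in> fmeasurable lborel" using open_domain emeasure_bounded_finite[OF bounded_domain] by (intro fmeasurableI) (auto simp: less_top)
    have "0 < measure lborel (ball y r)" using content_ball_pos[OF y(1)] by simp
    also have "\<dots> \<le> ?vol" by (rule measure_mono_fmeasurable[OF y(2) _ fin]) simp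
    finally show ?thesis .
  qed
  have key: "\<bar>fe_value x\<bar> * ?vol \<le> ?c * (?C1 * \<nu> + ?C2 * energy / \<nu>)" if "0 < \<nu>" for \<nu>
    using fe_value_pointwise_bound[OF sr qu R dim that x] .
  have E: "0 \<le> energy" by (rule energy_nonneg[OF dim])
  have "\<bar>fe_value x\<bar> * ?vol \<le> ?c * (?C1 + ?C2) * sqrt energy"
  \<comment> \<open>For positive energy \<open>\<nu>\<close> is its square root, which makes both
    terms proportional to the norm. For zero energy this choice is not positive, and
    \<open>\<nu>\<close> tends to 0 instead.\<close>
  proof (cases "energy = 0")
    case True
    have "((\<lambda>\<nu>. ?c * (?C1 * \<nu> + ?C2 * energy / \<nu>)) \<longlongrightarrow> 0) (at_right 0)"
    proof -
      have "((\<lambda>\<nu>. ?c * (?C1 * \<nu>)) \<longlongrightarrow> ?c * (?C1 * 0)) (at_right 0)" by (intro tendsto_intros)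
      thus ?thesis using True by simp
    qed
    moreover have "\<forall>\<^sub>F \<nu> in at_right 0. \<bar>fe_value x\<bar> * ?vol \<le> ?c * (?C1 * \<nu> + ?C2 * energy / \<nu>)"
      using eventually_at_right_less[of "0::real"] by eventually_elim (rule key)
    ultimately have "\<bar>fe_value x\<bar> * ?vol \<le> 0" by (intro tendsto_lowerbound[of _ 0 "at_right 0"]) auto
    thus ?thesis using True by simp
  next
    case False
    hence s: "0 < sqrt energy" using E by simp
    have "energy / sqrt energy = sqrt energy" using E by (simp add: real_div_sqrt)
    hence "?C2 * energy / sqrt energy = ?C2 * sqrt energy" by (metis times_divide_eq_right)
    hence eq: "?c * (?C1 * sqrt energy + ?C2 * energy / sqrt energy) = ?c * (?C1 + ?C2) * sqrt energy" by (simp only: distrib_right mult.assoc)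
    show ?thesis using key[OF s] unfolding eq .
  qed
  hence "\<bar>fe_value x\<bar> \<le> ?c * (?C1 + ?C2) * sqrt energy / ?vol" using vol by (simp add: pos_le_divide_eq)
  thus ?thesis by (simp add: discrete_norm_eq)
qed

end

theorem theorem2p3:
  fixes \<Omega> :: "'a::euclidean_space set" and k :: nat and \<sigma> \<tau> :: real
  assumes "DIM('a) \<in> {2, 3}"
    and "convex_polyhedral_domain \<Omega>"
  shows "\<exists>C::real. \<forall>\<T> v.
    simplicial_mesh \<Omega> \<T> \<and> shape_regular \<sigma> \<T> \<and> quasi_uniform \<tau> \<T> \<and> v \<in> lagrange_space0 k \<Omega> \<T>
      \<longrightarrow> Linf_norm \<Omega> v \<le> ereal (C * discrete_norm k \<T> v)"
proof -
  have dim: "DIM('a) = 2 \<or> DIM('a) = 3" using assms(1) by auto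
  have "bounded \<Omega>" "open \<Omega>" using assms(2) by (auto simp: convex_polyhedral_domain_def)
  then obtain R where R: "\<Omega> \<subseteq> ball 0 R" using bounded_subset_ballD by blast
  \<comment> \<open>Built from the dimension, the domain and the two regularity constants;
    \<open>R\<close> depends on \<open>\<Omega>\<close> only.\<close>
  define C where "C = (2 * 2 ^ DIM('a) + 2) * ((4 * (8 * R)\<^sup>2 + 36 * R * (8 * \<sigma> * \<tau>) ^ DIM('a)) * measure lborel \<Omega>
     + (8 * (8 * R)\<^sup>2 + 2 * (8 * R) ^ 3)) / measure lborel \<Omega>"
  show ?thesis
  proof (intro exI[of _ C] allI impI)
    fix \<T> v
    assume a: "simplicial_mesh \<Omega> \<T> \<and> shape_regular \<sigma> \<T> \<and> quasi_uniform \<tau> \<T> \<and> v \<in> lagrange_space0 k \<Omega> \<T>"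
    interpret finite_element_function \<Omega> \<T> k v
      by unfold_locales (use a assms in auto)
    \<comment> \<open>The pointwise bound needs a generic pole. The excluded points depend on the
      mesh but form a null set for each one, which the essential supremum ignores.\<close>
    have "AE x in lebesgue. generic_point x" using nongeneric_null by (simp add: AE_completion_iff)
    hence "AE x in lebesgue. x \<in> \<Omega> \<longrightarrow> ereal \<bar>v x\<bar> \<le> ereal (C * discrete_norm k \<T> v)"
      using AE_V
    proof eventually_elim
      case (elim x)
      show ?case using fe_value_sup_bound[OF _ _ R dim _ elim(1)] a elim(2) by (simp add: C_def)
    qed
    hence "AE x in lebesgue_on \<Omega>. ereal \<bar>v x\<bar> \<le> ereal (C * discrete_norm k \<T> v)"
      using \<open>open \<Omega>\<close> by (subst AE_lebesgue_on) auto
    moreover have "v \<in> borel_measurable (lebesgue_on \<Omega>)"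
      using a by (auto simp: lagrange_space0_def H1_0_def L2_def)
    ultimately show "Linf_norm \<Omega> v \<le> ereal (C * discrete_norm k \<T> v)"
      unfolding Linf_norm_def by (intro esssup_I) measurable
  qed
qed

end
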